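(* Let $p\geq 7$ be a Mersenne prime and let $k\geq 2$ be an integer. Then there exists a finite transitive permutation group $X$ of degree $p^{3k-4}(p+1)/2$ which is elusive and has the following structure: $X$ has a normal subgroup $N$ with $X/N\cong \mathrm{PSL}_2(p)$ such that $X$ does not split over $N$ (i.e. $N$ has no complement in $X$), and $N$ has a chain of subgroups $N=N_1> N_2>\cdots> N_{k}=1$, each normal in $X$, with $N_\ell/N_{\ell+1}\cong \mathrm{C}_p^3$ for every $\ell\in\{1,\ldots,k-1\}$; moreover the point stabilizer of $X$ is isomorphic to a semidirect product $\mathrm{C}_p^2{:}\mathrm{D}_{p-1}$.
   Context: All permutation groups act on finite sets. A derangement is a permutation with no fixed points. A transitive permutation group is elusive if it contains no derangements of prime order. A Mersenne prime is a prime of the form $2^m-1$. $\mathrm{C}_n$ denotes the cyclic group of order $n$, $\mathrm{D}_{n}$ the dihedral group of order $n$, and $A{:}B$ a semidirect product of a normal subgroup $A$ by $B$. *)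

theory Defs
  imports "HOL-Algebra.Algebra" "HOL-Computational_Algebra.Primes"
begin

definition mersenne_prime :: "nat \<Rightarrow> bool" where
  "mersenne_prime p \<longleftrightarrow> Factorial_Ring.prime p \<and> (\<exists>m::nat. p = 2 ^ m - 1)"

definition perm_grp :: "nat \<Rightarrow> (nat \<Rightarrow> nat) set \<Rightarrow> (nat \<Rightarrow> nat) monoid" where
  "perm_grp d H = (sym_group d) \<lparr> carrier := H \<rparr>"

definition transitive_perm_grp :: "nat \<Rightarrow> (nat \<Rightarrow> nat) set \<Rightarrow> bool" where
  "transitive_perm_grp d H \<longleftrightarrow> subgroup H (sym_group d) \<and>
     (\<forall>i\<in>{1..d}. \<forall>j\<in>{1..d}. \<exists>\<sigma>\<in>H. \<sigma> i = j)"

definition derangement :: "nat \<Rightarrow> (nat \<Rightarrow> nat) \<Rightarrow> bool" where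
  "derangement d \<sigma> \<longleftrightarrow> (\<forall>i\<in>{1..d}. \<sigma> i \<noteq> i)"

definition elusive :: "nat \<Rightarrow> (nat \<Rightarrow> nat) set \<Rightarrow> bool" where
  "elusive d H \<longleftrightarrow> transitive_perm_grp d H \<and>
     \<not> (\<exists>\<sigma>\<in>H. derangement d \<sigma> \<and> Factorial_Ring.prime (group.ord (perm_grp d H) \<sigma>))"

definition point_stab :: "(nat \<Rightarrow> nat) set \<Rightarrow> nat \<Rightarrow> (nat \<Rightarrow> nat) set" where
  "point_stab H x = {\<sigma> \<in> H. \<sigma> x = x}"

definition SL2 :: "nat \<Rightarrow> (int \<times> int \<times> int \<times> int) monoid" where
  "SL2 p = \<lparr> carrier = {(x,y,z,w). x \<in> {0..<int p} \<and> y \<in> {0..<int p} \<and> z \<in> {0..<int p}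
                \<and> w \<in> {0..<int p} \<and> (x*w - y*z) mod int p = 1},
            monoid.mult = (\<lambda>(x,y,z,w) (x',y',z',w'). ((x*x'+y*z') mod int p, (x*y'+y*w') mod int p,
                                         (z*x'+w*z') mod int p, (z*y'+w*w') mod int p)),
            one = (1,0,0,1) \<rparr>"

definition SL2_center :: "nat \<Rightarrow> (int \<times> int \<times> int \<times> int) set" where
  "SL2_center p = {(1,0,0,1), (int p - 1, 0, 0, int p - 1)}"

definition PSL2 :: "nat \<Rightarrow> (int \<times> int \<times> int \<times> int) set monoid" where
  "PSL2 p = SL2 p Mod SL2_center p"

definition elem_ab :: "nat \<Rightarrow> nat \<Rightarrow> (nat \<Rightarrow> int) monoid" where
  "elem_ab p n = product_group {..<n} (\<lambda>_. integer_mod_group p)"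

text \<open>Dihedral group of order n (n even): rotations a in Z/(n/2), flag s for reflection.\<close>
definition dihedral :: "nat \<Rightarrow> (int \<times> bool) monoid" where
  "dihedral n = \<lparr> carrier = {0..<int (n div 2)} \<times> UNIV,
       monoid.mult = (\<lambda>(a,s) (b,t). ((a + (if s then - b else b)) mod int (n div 2), s \<noteq> t)),
       one = (0, False) \<rparr>"

definition internal_semidirect :: "('g, 'm) monoid_scheme \<Rightarrow> 'g set \<Rightarrow> 'g set \<Rightarrow> bool" where
  "internal_semidirect G A B \<longleftrightarrow> A \<lhd> G \<and> subgroup B G \<and> A \<inter> B = {\<one>\<^bsub>G\<^esub>}
      \<and> A <#>\<^bsub>G\<^esub> B = carrier G"

end

theory Submission
  imports Defs "HOL-Number_Theory.Residue_Primitive_Roots"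
begin

text \<open>
  Take \<open>X = PSL\<^sub>2(\<int>/q)\<close> with \<open>q = p\<^sup>k\<close>, let \<open>N\<^sub>l\<close> be the image of the congruence subgroup
  of level \<open>p\<^sup>l\<close>, and let \<open>X\<close> act on the cosets of the image \<open>Y\<close> of the group of all matrices
  that are monomial modulo \<open>p\<^sup>k\<^sup>-\<^sup>1\<close> with nonzero entries \<open>(p - 1)\<close>-st roots of unity modulo \<open>q\<close>.
  The degree is \<open>p\<^sup>3\<^sup>k\<^sup>-\<^sup>4 (p + 1) / 2\<close>, and \<open>p + 1\<close> is a power of 2, so only elements of order
  2 and \<open>p\<close> could be derangements of prime order. An involution lifts to a matrix with square \<open>-1\<close>,
  which is conjugate to \<open>((0, 1), (-1, 0))\<close> up to sign because \<open>-1\<close> is not a square modulo \<open>p\<close>. Since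
  \<open>p \<ge> 5\<close>, an element of order \<open>p\<close> lifts to \<open>1 + p\<^sup>k\<^sup>-\<^sup>1 M\<close> with \<open>M\<close> of trace 0 modulo \<open>p\<close>, and \<open>M\<close> is
  conjugate to a matrix with zero diagonal. In both cases the element is conjugate into \<open>Y\<close>. That
  elements of order \<open>p\<close> lie in \<open>N\<^sub>1\<close> also shows that \<open>X\<close> does not split over \<open>N\<^sub>1\<close>.
\<close>

section \<open>Group-theoretic preliminaries\<close>

text \<open>All computation takes place in \<open>SL2 q\<close>; the permutation group is the image
  of a coset action \<open>\<Phi>\<close> with kernel {1, -1}, so orders and equations lift only up
  to sign. For elements of order \<open>p\<close> the sign can be removed because \<open>p\<close>
  is odd. Y admits only roots of unity, not all units: they form a complement to 1 + pZ in the units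
  modulo q, so the torus part keeps order \<open>p - 1\<close>, which leaves the full power of
  \<open>p\<close> in the degree, and a root of unity that is 1 modulo p is 1. Closure of the
  preimage of Y under products rests on 2(k - 1) >= k: two multiples of p^(k-1) multiply to 0 modulo
  q. The main obstacle is elements of order \<open>p\<close>. Such a matrix A fixes a nonzero vector
  modulo p, so p divides e = tr A - 2. For p >= 5, Cayley-Hamilton gives A^p = 1 + p(e u + (1 + e
  v)(A - 1)), which makes A - 1 as divisible as e, up to p^(k-1). Conversely det A = 1 makes e as
  divisible as a product of two entries of A - 1. The two facts reinforce each other until p^(k-1)
  divides A - 1.\<close>

lemma funpow_closed: "f ` S \<subseteq> S \<Longrightarrow> x \<in> S \<Longrightarrow> (f ^^ i) x \<in> S"
  by (induction i) auto

text \<open>Without a fixed point every orbit has exactly \<open>r\<close> elements, so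
  \<open>r\<close> would divide \<open>card S\<close>. It is applied to nonzero vectors modulo a
  prime and to the points of the permutation group.\<close>

lemma prime_period_imp_fixpoint:
  fixes f :: "'a \<Rightarrow> 'a" and r :: nat
  assumes fin: "finite S" and into: "f ` S \<subseteq> S" and r: "Factorial_Ring.prime r"
    and per: "\<And>x. x \<in> S \<Longrightarrow> (f ^^ r) x = x" and ndvd: "\<not> r dvd card S"
  obtains x where "x \<in> S" "f x = x"
proof -
  have closed: "(f ^^ i) x \<in> S" if "x \<in> S" for x i
    using funpow_closed[OF into that] .
  have permul: "(f ^^ (r * i)) x = x" if "x \<in> S" for x i
    using that by (induction i) (auto simp: funpow_add per)
  have "\<exists>x\<in>S. f x = x"
  proof (rule ccontr)
    assume nofix: "\<not> (\<exists>x\<in>S. f x = x)"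
    \<comment> \<open>Only forward iterates are needed: after \<open>i\<close> steps,
      \<open>(r - 1) * i\<close> further steps lead back, which gives symmetry.\<close>
    define R where "R = {(x, y). x \<in> S \<and> (\<exists>i. y = (f ^^ i) x)}"
    have rev_step: "x = (f ^^ ((r - 1) * i)) ((f ^^ i) x)" if "x \<in> S" for x i
    proof -
      have "(r - 1) * i + i = r * i"
        using prime_gt_0_nat[OF r] by (simp add: diff_mult_distrib)
      then show ?thesis
        using permul[OF that, of i] by (metis comp_apply funpow_add)
    qed
    have "equiv S R"
    proof (rule equivI)
      show "R \<subseteq> S \<times> S"
        using closed by (auto simp: R_def)
      show "refl_on S R"
        by (auto simp: refl_on_def R_def intro: exI[of _ 0])
      show "sym R"
        unfolding sym_def R_def using rev_step closed by blast
      show "trans R"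
        unfolding trans_def R_def by (clarsimp) (metis comp_apply funpow_add)
    qed
    moreover have "r dvd card Z" if Z: "Z \<in> S // R" for Z
    proof -
      obtain x where x: "x \<in> S" "Z = R `` {x}"
        using Z by (auto simp: quotient_def)
      have "Z = (\<lambda>i. (f ^^ i) x) ` {..<r}"
      proof -
        have "(f ^^ i) x = (f ^^ (i mod r)) x" for i
        proof -
          have "(f ^^ i) x = (f ^^ (i mod r + r * (i div r))) x"
            by simp
          then show ?thesis
            using permul[OF x(1)] by (simp only: funpow_add comp_apply)
        qed
        moreover have "i mod r < r" for i
          using prime_gt_0_nat[OF r] by simp
        ultimately show ?thesis
          using x by (fastforce simp: R_def)
      qed
      moreover have "inj_on (\<lambda>i. (f ^^ i) x) {..<r}"
      proof (rule linorder_inj_onI)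
        fix i j assume ij: "i < j" "i \<in> {..<r}" "j \<in> {..<r}"
        show "(f ^^ i) x \<noteq> (f ^^ j) x"
        proof
          assume eq: "(f ^^ i) x = (f ^^ j) x"
          define y where "y = (f ^^ i) x"
          define m where "m = j - i"
          have y: "y \<in> S"
            using closed x by (simp add: y_def)
          have "j = m + i"
            using ij by (simp add: m_def)
          then have fix1: "(f ^^ m) y = y"
            using eq by (simp add: y_def funpow_add)
          have fixm: "(f ^^ (m * u)) y = y" for u
            by (induction u) (auto simp: funpow_add fix1)
          have m: "0 < m" "m < r"
            using ij by (auto simp: m_def)
          \<comment> \<open>Bezout combines the periods \<open>m\<close> and \<open>r\<close> of
            \<open>y\<close> into the period 1, against \<open>nofix\<close>.\<close>
          have "coprime m r"
            using m r by (meson coprime_commute nat_dvd_not_less prime_imp_coprime)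
          then obtain u v where "m * u = r * v + 1"
            using bezout_nat[of m r] m by (metis bot_nat_0.not_eq_extremum coprime_iff_gcd_eq_1)
          then have "f ((f ^^ (r * v)) y) = y"
            using fixm[of u] by simp
          then show False
            using permul[OF y] nofix y by metis
        qed
      qed auto
      ultimately show ?thesis
        by (simp add: card_image)
    qed
    ultimately show False
      using equiv_imp_dvd_card[OF fin] ndvd by blast
  qed
  then show ?thesis
    using that by blast
qed

text \<open>Maps are easy to write down on matrices, whereas the group of interest is only an image
  of matrices. Two preimages of a point differ by an element of the kernel of \<open>\<phi>\<close>,
  on which \<open>f\<close> is trivial, so any choice of preimages works.\<close>

lemma hom_factor_through_epi:
  assumes A: "group A" and B: "group B" and C: "group C"
    and phi: "\<phi> \<in> hom A B" "\<phi> ` carrier A = carrier B"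
    and f: "f \<in> hom A C" "f ` carrier A = carrier C"
    and ker: "\<And>x. x \<in> carrier A \<Longrightarrow> \<phi> x = \<one>\<^bsub>B\<^esub> \<Longrightarrow> f x = \<one>\<^bsub>C\<^esub>"
  obtains h where "h \<in> hom B C" "h ` carrier B = carrier C"
    "kernel B C h = \<phi> ` kernel A C f" "\<And>x. x \<in> carrier A \<Longrightarrow> h (\<phi> x) = f x"
proof -
  interpret A: group A by fact
  interpret B: group B by fact
  interpret C: group C by fact
  interpret p: group_hom A B \<phi>
    using phi by unfold_locales
  interpret f: group_hom A C f
    using f by unfold_locales
  define s where "s = inv_into (carrier A) \<phi>"
  define h where "h y = f (s y)" for y
  have h: "h (\<phi> x) = f x" if x: "x \<in> carrier A" for x
  proof -
    have s: "s (\<phi> x) \<in> carrier A" "\<phi> (s (\<phi> x)) = \<phi> x"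
      using x by (auto simp: s_def inv_into_into f_inv_into_f)
    then have "\<phi> (s (\<phi> x) \<otimes>\<^bsub>A\<^esub> inv\<^bsub>A\<^esub> x) = \<one>\<^bsub>B\<^esub>"
      using x by simp
    then have "f (s (\<phi> x) \<otimes>\<^bsub>A\<^esub> inv\<^bsub>A\<^esub> x) = \<one>\<^bsub>C\<^esub>"
      using ker s x by simp
    then have "f (s (\<phi> x)) \<otimes>\<^bsub>C\<^esub> inv\<^bsub>C\<^esub> f x = \<one>\<^bsub>C\<^esub>"
      using s x by simp
    then show ?thesis
      using s x C.inv_equality by (metis C.inv_closed C.inv_inv f.hom_closed h_def)
  qed
  have "h \<in> hom B C"
  proof (rule homI)
    fix x y assume "x \<in> carrier B" "y \<in> carrier B"
    then obtain a b where "a \<in> carrier A" "b \<in> carrier A" "x = \<phi> a" "y = \<phi> b"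
      using phi(2) by (metis imageE)
    then show "h x \<in> carrier C" "h (x \<otimes>\<^bsub>B\<^esub> y) = h x \<otimes>\<^bsub>C\<^esub> h y"
      using h by (auto simp flip: p.hom_mult)
  qed
  moreover have "h ` carrier B = carrier C"
    using h phi(2) f(2) by (metis (no_types, lifting) image_cong image_image)
  moreover have "kernel B C h = \<phi> ` kernel A C f"
  proof -
    have "kernel B C h = {y \<in> \<phi> ` carrier A. h y = \<one>\<^bsub>C\<^esub>}"
      by (simp add: kernel_def phi(2))
    also have "\<dots> = \<phi> ` kernel A C f"
      by (auto simp: kernel_def h)
    finally show ?thesis .
  qed
  ultimately show ?thesis
    using h that by blast
qed

lemma epi_FactGroup_iso:
  assumes "group A" "group B" "group C"
    and "\<phi> \<in> hom A B" "\<phi> ` carrier A = carrier B"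
    and "f \<in> hom A C" "f ` carrier A = carrier C"
    and "\<And>x. x \<in> carrier A \<Longrightarrow> \<phi> x = \<one>\<^bsub>B\<^esub> \<Longrightarrow> f x = \<one>\<^bsub>C\<^esub>"
  shows "B Mod (\<phi> ` kernel A C f) \<cong> C"
proof -
  obtain h where h: "h \<in> hom B C" "h ` carrier B = carrier C" "kernel B C h = \<phi> ` kernel A C f"
    using hom_factor_through_epi[OF assms] by metis
  interpret group_hom B C h
    using assms h by (simp add: group_hom_def group_hom_axioms_def)
  show ?thesis
    using FactGroup_iso[OF h(2)] h(3) by simp
qed

text \<open>Both epimorphisms identify the same elements of \<open>A\<close>, so the induced map
  from \<open>B\<close> to \<open>C\<close> is injective as well.\<close>

lemma epi_same_kernel_iso:
  assumes "group A" "group B" "group C"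
    and phi: "\<phi> \<in> hom A B" "\<phi> ` carrier A = carrier B"
    and "f \<in> hom A C" "f ` carrier A = carrier C"
    and ker: "\<And>x. x \<in> carrier A \<Longrightarrow> \<phi> x = \<one>\<^bsub>B\<^esub> \<longleftrightarrow> f x = \<one>\<^bsub>C\<^esub>"
  shows "B \<cong> C"
proof -
  obtain h where h: "h \<in> hom B C" "h ` carrier B = carrier C" "kernel B C h = \<phi> ` kernel A C f"
    using hom_factor_through_epi[OF assms(1-7)] ker by metis
  interpret h: group_hom B C h
    using assms h by (simp add: group_hom_def group_hom_axioms_def)
  have "kernel B C h \<subseteq> {\<one>\<^bsub>B\<^esub>}"
    unfolding h(3) using ker by (auto simp: kernel_def)
  moreover have "\<one>\<^bsub>B\<^esub> \<in> kernel B C h"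
    by (simp add: kernel_def)
  ultimately have "kernel B C h = {\<one>\<^bsub>B\<^esub>}"
    by blast
  then have "h \<in> iso B C"
    using h by (subst iso_kernel_image[OF assms(2,3)]) simp
  then show ?thesis
    by (auto simp: is_iso_def)
qed

text \<open>The group acts on the right cosets of \<open>Y\<close> by \<open>Y h \<mapsto> Y h g\<^sup>-\<^sup>1\<close>; point 1 is the coset \<open>Y\<close>.\<close>

lemma (in group) coset_action_exists:
  assumes fin: "finite (carrier G)" and Y: "subgroup Y G" and n: "card (rcosets Y) = n"
  obtains \<Phi> where "\<Phi> \<in> hom G (sym_group n)"
    "\<And>i j. i \<in> {1..n} \<Longrightarrow> j \<in> {1..n} \<Longrightarrow> \<exists>g\<in>carrier G. \<Phi> g i = j"
    "\<And>g. g \<in> carrier G \<Longrightarrow> \<Phi> g 1 = 1 \<longleftrightarrow> g \<in> Y"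
    "\<And>g. g \<in> carrier G \<Longrightarrow> derangement n (\<Phi> g) \<longleftrightarrow> (\<forall>h\<in>carrier G. h \<otimes> g \<otimes> inv h \<notin> Y)"
    "\<And>g. g \<in> carrier G \<Longrightarrow> \<Phi> g = id \<longleftrightarrow> (\<forall>h\<in>carrier G. h \<otimes> g \<otimes> inv h \<in> Y)"
proof -
  have Ysub: "Y \<subseteq> carrier G"
    using Y by (rule subgroup.subset)
  have finr: "finite (rcosets Y)"
    using fin by (simp add: RCOSETS_def)
  have YY: "Y \<in> rcosets Y"
    using rcosetsI[OF Ysub one_closed] coset_mult_one[OF Ysub] by simp
  have npos: "n \<ge> 1"
    using finr YY n by (metis One_nat_def Suc_leI card_gt_0_iff empty_iff)
  obtain \<beta>0 where \<beta>0: "bij_betw \<beta>0 {1..n} (rcosets Y)"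
    using finr n by (metis card_atLeastAtMost diff_Suc_1 finite_atLeastAtMost finite_same_card_bij)
  obtain \<beta> where \<beta>: "bij_betw \<beta> {1..n} (rcosets Y)" "\<beta> 1 = Y"
  proof -
    obtain i where i: "i \<in> {1..n}" "\<beta>0 i = Y"
      using \<beta>0 YY by (metis bij_betw_imp_surj_on imageE)
    \<comment> \<open>A transposition moves the coset \<open>Y\<close> to point 1, so that the
      stabilizer of 1 is \<open>Y\<close> itself and not a conjugate.\<close>
    have "bij_betw (\<beta>0 \<circ> transpose 1 i) {1..n} (rcosets Y)"
      using i npos by (intro bij_betw_trans[OF _ \<beta>0] permutes_imp_bij permutes_swap_id) auto
    then show ?thesis
      using that i by simp
  qed
  define \<gamma> where "\<gamma> = inv_into {1..n} \<beta>"
  have \<gamma>\<beta>: "\<gamma> (\<beta> i) = i" if "i \<in> {1..n}" for i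
    using \<beta>(1) that by (simp add: \<gamma>_def bij_betw_def)
  have \<beta>\<gamma>: "\<beta> (\<gamma> Z) = Z" "\<gamma> Z \<in> {1..n}" if "Z \<in> rcosets Y" for Z
    using \<beta>(1) that by (auto simp: \<gamma>_def bij_betw_def f_inv_into_f inv_into_into simp del: atLeastAtMost_iff)
  have \<beta>in: "\<beta> i \<in> rcosets Y" if "i \<in> {1..n}" for i
    using \<beta>(1) that by (meson bij_betwE)
  have act: "Z #> g \<in> rcosets Y" if "Z \<in> rcosets Y" "g \<in> carrier G" for Z g
    using that Ysub by (auto simp: RCOSETS_def coset_mult_assoc)
  \<comment> \<open>Right multiplication by \<open>g\<close> would reverse products; the inverse
    makes \<open>\<Phi>\<close> a homomorphism for composition. Points outside \<open>{1..n}\<close>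
    stay fixed, as \<open>permutes\<close> demands.\<close>
  define \<Phi> where "\<Phi> g i = (if i \<in> {1..n} then \<gamma> (\<beta> i #> inv g) else i)" for g i
  have \<Phi>in: "\<Phi> g i \<in> {1..n}" if "g \<in> carrier G" "i \<in> {1..n}" for g i
    using that \<beta>\<gamma>(2)[OF act[OF \<beta>in]] by (simp add: \<Phi>_def)
  have \<beta>\<Phi>: "\<beta> (\<Phi> g i) = \<beta> i #> inv g" if "g \<in> carrier G" "i \<in> {1..n}" for g i
    using that \<beta>\<gamma>(1)[OF act[OF \<beta>in]] by (simp add: \<Phi>_def)
  have sub: "Z \<subseteq> carrier G" if "Z \<in> rcosets Y" for Z
    using that rcosets_part_G[OF Y] by blast
  have mult: "\<Phi> (g \<otimes> h) = \<Phi> g \<circ> \<Phi> h" if "g \<in> carrier G" "h \<in> carrier G" for g h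
  proof
    fix i
    show "\<Phi> (g \<otimes> h) i = (\<Phi> g \<circ> \<Phi> h) i"
    proof (cases "i \<in> {1..n}")
      case True
      have "\<Phi> (g \<otimes> h) i = \<gamma> (\<beta> i #> (inv h \<otimes> inv g))"
        using True that by (simp add: \<Phi>_def inv_mult_group)
      also have "\<dots> = \<gamma> (\<beta> (\<Phi> h i) #> inv g)"
        using True that \<beta>\<Phi> sub[OF \<beta>in[OF True]] by (simp add: coset_mult_assoc)
      also have "\<dots> = \<Phi> g (\<Phi> h i)"
        using \<Phi>in[OF that(2) True] by (simp add: \<Phi>_def)
      finally show ?thesis by simp
    qed (auto simp: \<Phi>_def)
  qed
  have one: "\<Phi> \<one> = id"
    using \<gamma>\<beta> sub[OF \<beta>in] by (fastforce simp: \<Phi>_def coset_mult_one)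
  have bij: "\<Phi> g permutes {1..n}" if "g \<in> carrier G" for g
  proof (rule bij_imp_permutes)
    have "\<Phi> g \<circ> \<Phi> (inv g) = id" "\<Phi> (inv g) \<circ> \<Phi> g = id"
      using mult[OF that inv_closed[OF that]] mult[OF inv_closed[OF that] that] that one by simp_all
    then show "bij_betw (\<Phi> g) {1..n} {1..n}"
      using \<Phi>in that inv_closed[OF that]
      by (intro bij_betw_byWitness[of _ "\<Phi> (inv g)"]) (auto simp: fun_eq_iff simp del: atLeastAtMost_iff)
  qed (auto simp: \<Phi>_def)
  \<comment> \<open>The whole dictionary between points and conjugates: \<open>g\<close> fixes the
    coset \<open>Y h\<close> exactly if its conjugate by \<open>h\<close> lies in
    \<open>Y\<close>.\<close>
  have coset_fix: "Y #> h #> inv g = Y #> h \<longleftrightarrow> h \<otimes> g \<otimes> inv h \<in> Y"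
    if "g \<in> carrier G" "h \<in> carrier G" for g h
  proof -
    have "Y #> h #> inv g = Y #> h \<longleftrightarrow> Y #> (h \<otimes> inv g) = Y #> h"
      using that Ysub by (simp add: coset_mult_assoc)
    also have "\<dots> \<longleftrightarrow> h \<otimes> inv (h \<otimes> inv g) \<in> Y"
      using that Y by (metis coset_join1 coset_join2 coset_mult_inv1 coset_mult_inv2 inv_closed m_closed subgroup.subset)
    also have "h \<otimes> inv (h \<otimes> inv g) = h \<otimes> g \<otimes> inv h"
      using that by (simp add: inv_mult_group m_assoc)
    finally show ?thesis .
  qed
  have fix_iff: "\<Phi> g i = i \<longleftrightarrow> h \<otimes> g \<otimes> inv h \<in> Y"
    if "g \<in> carrier G" "h \<in> carrier G" "i \<in> {1..n}" "\<beta> i = Y #> h" for g h i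
  proof -
    have "\<Phi> g i = i \<longleftrightarrow> \<beta> (\<Phi> g i) = \<beta> i"
      using \<Phi>in that \<gamma>\<beta> by metis
    then show ?thesis
      using that \<beta>\<Phi> coset_fix by simp
  qed
  have pt: "\<exists>h\<in>carrier G. \<beta> i = Y #> h" if "i \<in> {1..n}" for i
    using \<beta>in[OF that] by (auto simp: RCOSETS_def)
  have pt': "\<exists>i\<in>{1..n}. \<beta> i = Y #> h" if "h \<in> carrier G" for h
    using \<beta>\<gamma> that Ysub rcosetsI by meson
  show ?thesis
  proof (rule that)
    show "\<Phi> \<in> hom G (sym_group n)"
      using bij mult by (auto intro!: homI simp: sym_group_def)
    show "\<exists>g\<in>carrier G. \<Phi> g i = j" if ij: "i \<in> {1..n}" "j \<in> {1..n}" for i j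
    proof -
      obtain a b where ab: "a \<in> carrier G" "b \<in> carrier G" "\<beta> i = Y #> a" "\<beta> j = Y #> b"
        using pt ij by metis
      define g where "g = inv (inv a \<otimes> b)"
      have g: "g \<in> carrier G"
        using ab by (simp add: g_def)
      have "\<beta> (\<Phi> g i) = Y #> a #> (inv a \<otimes> b)"
        using \<beta>\<Phi>[OF g ij(1)] ab by (simp add: g_def)
      also have "\<dots> = \<beta> j"
        using ab Ysub by (simp add: coset_mult_assoc flip: m_assoc)
      finally have "\<Phi> g i = j"
        using \<Phi>in[OF g ij(1)] ij \<gamma>\<beta> by metis
      then show ?thesis
        using g by blast
    qed
    show "\<Phi> g 1 = 1 \<longleftrightarrow> g \<in> Y" if "g \<in> carrier G" for g
      using fix_iff[OF that one_closed, of 1] npos \<beta>(2) that Ysub by (simp add: coset_mult_one)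
    show "derangement n (\<Phi> g) \<longleftrightarrow> (\<forall>h\<in>carrier G. h \<otimes> g \<otimes> inv h \<notin> Y)" if "g \<in> carrier G" for g
      unfolding derangement_def using fix_iff[OF that] pt pt' by meson
    show "\<Phi> g = id \<longleftrightarrow> (\<forall>h\<in>carrier G. h \<otimes> g \<otimes> inv h \<in> Y)" if g: "g \<in> carrier G" for g
    proof -
      have "\<Phi> g = id \<longleftrightarrow> (\<forall>i\<in>{1..n}. \<Phi> g i = i)"
        by (auto simp: \<Phi>_def fun_eq_iff)
      then show ?thesis
        using fix_iff[OF g] pt pt' by meson
    qed
  qed
qed

section \<open>The groups \<open>SL\<^sub>2(\<int>/q)\<close>\<close>

text \<open>Entries may be arbitrary integers and are reduced here, so that equations between
  matrices become congruences without range conditions.\<close>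

definition smat :: "nat \<Rightarrow> int \<Rightarrow> int \<Rightarrow> int \<Rightarrow> int \<Rightarrow> int \<times> int \<times> int \<times> int" where
  "smat q a b c d = (a mod int q, b mod int q, c mod int q, d mod int q)"

lemma smat_eq_iff:
  "smat q a b c d = smat q a' b' c' d' \<longleftrightarrow>
    [a = a'] (mod int q) \<and> [b = b'] (mod int q) \<and> [c = c'] (mod int q) \<and> [d = d'] (mod int q)"
  by (simp add: smat_def cong_def)

lemma smat_mult:
  "smat q a b c d \<otimes>\<^bsub>SL2 q\<^esub> smat q a' b' c' d' =
    smat q (a * a' + b * c') (a * b' + b * d') (c * a' + d * c') (c * b' + d * d')"
  unfolding SL2_def smat_def
  by (simp flip: cong_def, intro conjI cong_add cong_mult; simp)

lemma cong_mod_dvd_iff: "m dvd n \<Longrightarrow> [a mod n = b] (mod m) \<longleftrightarrow> [a = b] (mod m)" for m n a b :: int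
  by (simp add: cong_def mod_mod_cancel)

lemma SL2_det_mult:
  fixes m :: int
  assumes "[a * d - b * c = 1] (mod m)" "[a' * d' - b' * c' = 1] (mod m)"
  shows "[(a * a' + b * c') * (c * b' + d * d') - (a * b' + b * d') * (c * a' + d * c') = 1] (mod m)"
proof -
  have "(a * a' + b * c') * (c * b' + d * d') - (a * b' + b * d') * (c * a' + d * c') = (a * d - b * c) * (a' * d' - b' * c')"
    by (simp add: algebra_simps)
  then show ?thesis
    using cong_mult[OF assms] by simp
qed

context
  fixes q :: nat
  assumes q: "q > 1"
begin

lemma smat_in_SL2: "smat q a b c d \<in> carrier (SL2 q) \<longleftrightarrow> [a * d - b * c = 1] (mod int q)"
proof -
  have "[(a mod int q) * (d mod int q) - (b mod int q) * (c mod int q) = a * d - b * c] (mod int q)"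
    by (intro cong_diff cong_mult) simp_all
  then show ?thesis
    using q by (auto simp: SL2_def smat_def cong_def)
qed

lemma SL2_cases:
  assumes "x \<in> carrier (SL2 q)"
  obtains a b c d where "x = smat q a b c d" "[a * d - b * c = 1] (mod int q)" "x = (a, b, c, d)"
    "a \<in> {0..<int q}" "b \<in> {0..<int q}" "c \<in> {0..<int q}" "d \<in> {0..<int q}"
proof -
  obtain a b c d where x: "x = (a, b, c, d)"
    by (cases x)
  then have "a \<in> {0..<int q}" "b \<in> {0..<int q}" "c \<in> {0..<int q}" "d \<in> {0..<int q}"
    "[a * d - b * c = 1] (mod int q)"
    using assms q by (auto simp: SL2_def cong_def)
  then show ?thesis
    using that x by (simp add: smat_def)
qed

lemma one_SL2: "\<one>\<^bsub>SL2 q\<^esub> = smat q 1 0 0 1"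
  using q by (simp add: SL2_def smat_def)

lemma smat_inverse:
  assumes "[a * d - b * c = 1] (mod int q)"
  shows "smat q d (-b) (-c) a \<otimes>\<^bsub>SL2 q\<^esub> smat q a b c d = \<one>\<^bsub>SL2 q\<^esub>"
  using assms by (simp add: smat_mult one_SL2 smat_eq_iff algebra_simps)

lemma group_SL2: "group (SL2 q)"
proof (rule groupI)
  fix x y assume "x \<in> carrier (SL2 q)" "y \<in> carrier (SL2 q)"
  then show "x \<otimes>\<^bsub>SL2 q\<^esub> y \<in> carrier (SL2 q)"
    by (elim SL2_cases) (simp only: smat_mult smat_in_SL2 SL2_det_mult)
next
  fix x y z assume "x \<in> carrier (SL2 q)" "y \<in> carrier (SL2 q)" "z \<in> carrier (SL2 q)"
  then show "x \<otimes>\<^bsub>SL2 q\<^esub> y \<otimes>\<^bsub>SL2 q\<^esub> z = x \<otimes>\<^bsub>SL2 q\<^esub> (y \<otimes>\<^bsub>SL2 q\<^esub> z)"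
    by (elim SL2_cases) (simp only: smat_mult algebra_simps add.assoc)
next
  fix x assume "x \<in> carrier (SL2 q)"
  then show "\<one>\<^bsub>SL2 q\<^esub> \<otimes>\<^bsub>SL2 q\<^esub> x = x"
    by (elim SL2_cases) (simp only: smat_mult one_SL2, simp)
next
  fix x assume "x \<in> carrier (SL2 q)"
  then obtain a b c d where x: "x = smat q a b c d" "[a * d - b * c = 1] (mod int q)"
    by (rule SL2_cases)
  then have "smat q d (-b) (-c) a \<in> carrier (SL2 q)"
    by (simp add: smat_in_SL2 mult.commute)
  then show "\<exists>y\<in>carrier (SL2 q). y \<otimes>\<^bsub>SL2 q\<^esub> x = \<one>\<^bsub>SL2 q\<^esub>"
    using smat_inverse[OF x(2)] x(1) by blast
qed (simp add: one_SL2 smat_in_SL2)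

lemma smat_inv:
  assumes "[a * d - b * c = 1] (mod int q)"
  shows "inv\<^bsub>SL2 q\<^esub> smat q a b c d = smat q d (-b) (-c) a"
proof (rule group.inv_equality[OF group_SL2 smat_inverse[OF assms]])
  show "smat q a b c d \<in> carrier (SL2 q)" "smat q d (-b) (-c) a \<in> carrier (SL2 q)"
    using assms by (simp_all add: smat_in_SL2 mult.commute)
qed

lemma finite_SL2: "finite (carrier (SL2 q))"
proof (rule finite_subset)
  show "carrier (SL2 q) \<subseteq> {0..<int q} \<times> {0..<int q} \<times> {0..<int q} \<times> {0..<int q}"
    by (auto simp: SL2_def)
qed auto

lemma SL2_center_eq: "SL2_center q = {smat q 1 0 0 1, smat q (-1) 0 0 (-1)}"
proof -
  have "int q - 1 = - 1 mod int q"
    using q by (simp add: zmod_minus1)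
  then show ?thesis
    using q by (simp add: SL2_center_def smat_def)
qed

lemma smat_minus_one_in_SL2: "smat q (-1) 0 0 (-1) \<in> carrier (SL2 q)"
  by (simp add: smat_in_SL2)

lemma smat_minus:
  "smat q (-1) 0 0 (-1) \<otimes>\<^bsub>SL2 q\<^esub> smat q a b c d = smat q (-a) (-b) (-c) (-d)"
  by (simp add: smat_mult)

lemma normal_SL2_center: "SL2_center q \<lhd> SL2 q"
proof -
  interpret group "SL2 q" by (rule group_SL2)
  have "subgroup (SL2_center q) (SL2 q)"
  proof (rule subgroupI)
    show "inv\<^bsub>SL2 q\<^esub> x \<in> SL2_center q" if "x \<in> SL2_center q" for x
      using that by (auto simp: SL2_center_eq smat_inv)
  qed (auto simp: SL2_center_eq smat_in_SL2 smat_mult)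
  moreover have "x \<otimes>\<^bsub>SL2 q\<^esub> h \<otimes>\<^bsub>SL2 q\<^esub> inv\<^bsub>SL2 q\<^esub> x \<in> SL2_center q"
    if "x \<in> carrier (SL2 q)" "h \<in> SL2_center q" for x h
  proof -
    have "h \<in> carrier (SL2 q)"
      using that by (auto simp: SL2_center_eq smat_in_SL2)
    moreover have "x \<otimes>\<^bsub>SL2 q\<^esub> h = h \<otimes>\<^bsub>SL2 q\<^esub> x"
      using that by (elim SL2_cases) (auto simp: SL2_center_eq smat_mult)
    ultimately show ?thesis
      using that by (simp add: m_assoc)
  qed
  ultimately show ?thesis
    by (simp add: normal_inv_iff)
qed

lemma group_PSL2: "group (PSL2 q)"
  unfolding PSL2_def by (rule normal.factorgroup_is_group[OF normal_SL2_center])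

text \<open>With \<open>e = tr A - 2\<close> and \<open>B = A - 1\<close>, Cayley-Hamilton gives \<open>B\<^sup>2 = e A\<close>, so every power
  of \<open>A\<close> is an integer combination of \<open>1\<close> and \<open>B\<close>, computed here modulo \<open>e\<^sup>2\<close>.\<close>

lemma smat_pow:
  fixes n :: nat
  assumes det: "[a * d - b * c = 1] (mod int q)" and e: "e = a + d - 2"
  shows "\<exists>s t u v. u = 1 + e * int (n choose 2) + e^2 * s \<and> v = int n + e * int (Suc n choose 3) + e^2 * t \<and>
    smat q a b c d [^]\<^bsub>SL2 q\<^esub> n = smat q (u + v * (a - 1)) (v * b) (v * c) (u + v * (d - 1))"
proof (induction n)
  case 0
  show ?case
    by (rule exI[of _ 0], rule exI[of _ 0]) (simp add: one_SL2 binomial_eq_0)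
next
  case (Suc n)
  then obtain s t u v where u: "u = 1 + e * int (n choose 2) + e^2 * s"
    and v: "v = int n + e * int (Suc n choose 3) + e^2 * t"
    and IH: "smat q a b c d [^]\<^bsub>SL2 q\<^esub> n = smat q (u + v * (a - 1)) (v * b) (v * c) (u + v * (d - 1))"
    by blast
  \<comment> \<open>With B = A - 1 and B^2 = e(1 + B), the product (u + v B)(1 + B) equals (u + e v)
    + (u + (1 + e) v) B.\<close>
  define u' where "u' = u + e * v"
  define v' where "v' = u + (1 + e) * v"
  have c2: "Suc n choose 2 = (n choose 2) + n"
    by (simp add: numeral_2_eq_2)
  have c3: "Suc (Suc n) choose 3 = (Suc n choose 3) + ((n choose 2) + n)"
    by (metis One_nat_def Suc_1 add.commute binomial_Suc_Suc c2 numeral_3_eq_3)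
  have u': "u' = 1 + e * int (Suc n choose 2) + e^2 * (s + int (Suc n choose 3) + e * t)"
    unfolding c2 by (simp add: u'_def u v power2_eq_square algebra_simps)
  have v': "v' = int (Suc n) + e * int (Suc (Suc n) choose 3) + e^2 * (s + t + int (Suc n choose 3) + e * t)"
    unfolding c3 by (simp add: v'_def u v power2_eq_square algebra_simps)
  have bc: "[b * c = a * d - 1] (mod int q)"
    using cong_diff[OF cong_refl[of "a * d"] det] by simp
  have "[(u + v * (a - 1)) * a + v * (b * c) = (u + v * (a - 1)) * a + v * (a * d - 1)] (mod int q)"
    "[v * (b * c) + (u + v * (d - 1)) * d = v * (a * d - 1) + (u + v * (d - 1)) * d] (mod int q)"
    using bc by (auto intro!: cong_add cong_mult)
  moreover have "(u + v * (a - 1)) * a + v * (a * d - 1) = u' + v' * (a - 1)"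
    "v * (a * d - 1) + (u + v * (d - 1)) * d = u' + v' * (d - 1)"
    "(u + v * (a - 1)) * b + v * b * d = v' * b" "v * c * a + (u + v * (d - 1)) * c = v' * c"
    by (simp_all add: u'_def v'_def e algebra_simps)
  ultimately have "smat q a b c d [^]\<^bsub>SL2 q\<^esub> Suc n = smat q (u' + v' * (a - 1)) (v' * b) (v' * c) (u' + v' * (d - 1))"
    by (simp add: IH smat_mult smat_eq_iff mult_ac)
  then show ?case
    using u' v' by blast
qed

end

text \<open>For a prime \<open>r \<ge> 5\<close> both \<open>r choose 2\<close> and
  \<open>Suc r choose 3\<close> are multiples of \<open>r\<close>; for 3 the latter would be 4. The
  terms with e^2 gain the missing factor from \<open>r dvd e\<close>. So the coefficient of A - 1 is
  \<open>r\<close> times \<open>1 + e * v\<close>, which is prime to \<open>r\<close>.\<close>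

lemma smat_pow_prime:
  fixes r :: nat
  assumes q: "q > 1" and det: "[a * d - b * c = 1] (mod int q)" and e: "e = a + d - 2"
    and r: "Factorial_Ring.prime r" "r \<ge> 5" and re: "int r dvd e"
  shows "\<exists>u v. smat q a b c d [^]\<^bsub>SL2 q\<^esub> r =
    smat q (1 + int r * (e * u + (1 + e * v) * (a - 1))) (int r * (1 + e * v) * b)
      (int r * (1 + e * v) * c) (1 + int r * (e * u + (1 + e * v) * (d - 1)))"
proof -
  obtain s t u v where u: "u = 1 + e * int (r choose 2) + e^2 * s"
    and v: "v = int r + e * int (Suc r choose 3) + e^2 * t"
    and pow: "smat q a b c d [^]\<^bsub>SL2 q\<^esub> r = smat q (u + v * (a - 1)) (v * b) (v * c) (u + v * (d - 1))"
    using smat_pow[OF q det e, of r] by blast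
  have "r dvd (r choose 2)"
    using r by (intro dvd_choose_prime) auto
  then obtain x where x: "r choose 2 = r * x" ..
  have "r dvd (Suc r choose 3)"
  proof -
    have "Suc r choose 3 = (r choose 3) + (r choose 2)"
      by (simp add: numeral_3_eq_3 numeral_2_eq_2)
    then show ?thesis
      using r by (auto intro!: dvd_add dvd_choose_prime)
  qed
  then obtain y where y: "Suc r choose 3 = r * y" ..
  obtain z where z: "e = int r * z"
    using re ..
  have u': "u = 1 + int r * (e * (int x + z * s))"
    by (simp add: u x z power2_eq_square algebra_simps)
  have v': "v = int r * (1 + e * (int y + z * t))"
    by (simp add: v y z power2_eq_square algebra_simps)
  show ?thesis
    unfolding pow u' v'
    by (rule exI[of _ "int x + z * s"], rule exI[of _ "int y + z * t"]) (simp add: algebra_simps)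
qed

text \<open>Modulo \<open>r\<close> the matrix acts with period \<open>r\<close> on the r^2 - 1
  nonzero vectors. As \<open>r\<close> does not divide this number, some vector is fixed; the
  eigenvalue 1 and determinant 1 force trace 2.\<close>

lemma SL2_prime_power_trivial_trace:
  assumes q: "q > 1" and r: "Factorial_Ring.prime r" "r dvd q"
    and det: "[a * d - b * c = 1] (mod int q)"
    and one: "smat q a b c d [^]\<^bsub>SL2 q\<^esub> r = \<one>\<^bsub>SL2 q\<^esub>"
  shows "int r dvd a + d - 2"
proof -
  interpret group "SL2 q" by (rule group_SL2[OF q])
  define f where "f = (\<lambda>(v, w). ((a * v + b * w) mod int r, (c * v + d * w) mod int r))"
  define S where "S = {0..<int r} \<times> {0..<int r} - {(0, 0)}"
  have rq: "int r dvd int q"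
    using r by simp
  have det': "[a * d - b * c = 1] (mod int r)"
    using det rq by (rule cong_dvd_modulus)
  have r1: "r > 1"
    using r prime_gt_1_nat by blast
  have iter: "(f ^^ n) (v, w) = ((a' * v + b' * w) mod int r, (c' * v + d' * w) mod int r)"
    if "smat q a b c d [^]\<^bsub>SL2 q\<^esub> n = smat q a' b' c' d'" "(v, w) \<in> S" for n v w a' b' c' d'
    using that
  proof (induction n arbitrary: a' b' c' d')
    case 0
    then have "[a' = 1] (mod int q)" "[b' = 0] (mod int q)" "[c' = 0] (mod int q)" "[d' = 1] (mod int q)"
      by (auto simp: one_SL2[OF q] smat_eq_iff cong_sym)
    note * = this[THEN cong_dvd_modulus[OF _ rq]]
    have "[a' * v + b' * w = 1 * v + 0 * w] (mod int r)" "[c' * v + d' * w = 0 * v + 1 * w] (mod int r)"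
      by (intro cong_add cong_mult * cong_refl)+
    then show ?case
      using 0 by (auto simp: S_def cong_def)
  next
    case (Suc n)
    have "smat q a b c d [^]\<^bsub>SL2 q\<^esub> n \<in> carrier (SL2 q)"
      using det by (simp add: smat_in_SL2[OF q])
    then obtain a1 b1 c1 d1 where n: "smat q a b c d [^]\<^bsub>SL2 q\<^esub> n = smat q a1 b1 c1 d1"
      using SL2_cases[OF q] by metis
    have "smat q a b c d [^]\<^bsub>SL2 q\<^esub> Suc n = smat q a b c d \<otimes>\<^bsub>SL2 q\<^esub> smat q a1 b1 c1 d1"
      using nat_pow_Suc2[of "smat q a b c d" n] n det by (simp add: smat_in_SL2[OF q])
    then have "smat q a' b' c' d' = smat q (a * a1 + b * c1) (a * b1 + b * d1) (c * a1 + d * c1) (c * b1 + d * d1)"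
      using Suc.prems(1) by (simp add: smat_mult)
    then have "[a' = a * a1 + b * c1] (mod int r)" "[b' = a * b1 + b * d1] (mod int r)"
      "[c' = c * a1 + d * c1] (mod int r)" "[d' = c * b1 + d * d1] (mod int r)"
      unfolding smat_eq_iff using cong_dvd_modulus[OF _ rq] by blast+
    note * = this
    have "[a' * v + b' * w = (a * a1 + b * c1) * v + (a * b1 + b * d1) * w] (mod int r)"
      "[c' * v + d' * w = (c * a1 + d * c1) * v + (c * b1 + d * d1) * w] (mod int r)"
      by (intro cong_add cong_mult * cong_refl)+
    moreover have "(f ^^ Suc n) (v, w) = f ((a1 * v + b1 * w) mod int r, (c1 * v + d1 * w) mod int r)"
      using Suc.IH[OF n Suc.prems(2)] by simp
    moreover have "[a * ((a1 * v + b1 * w) mod int r) + b * ((c1 * v + d1 * w) mod int r)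
        = a * (a1 * v + b1 * w) + b * (c1 * v + d1 * w)] (mod int r)"
      "[c * ((a1 * v + b1 * w) mod int r) + d * ((c1 * v + d1 * w) mod int r)
        = c * (a1 * v + b1 * w) + d * (c1 * v + d1 * w)] (mod int r)"
      by (intro cong_add cong_mult; simp)+
    ultimately show ?case
      by (simp add: f_def cong_def algebra_simps)
  qed
  have zero: "v = 0 \<and> w = 0" if "[a * v + b * w = 0] (mod int r)" "[c * v + d * w = 0] (mod int r)"
    "v \<in> {0..<int r}" "w \<in> {0..<int r}" for v w
  proof -
    have "[d * (a * v + b * w) - b * (c * v + d * w) = d * 0 - b * 0] (mod int r)"
      "[a * (c * v + d * w) - c * (a * v + b * w) = a * 0 - c * 0] (mod int r)"
      by (intro cong_diff cong_mult that cong_refl)+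
    moreover have "d * (a * v + b * w) - b * (c * v + d * w) = (a * d - b * c) * v"
      "a * (c * v + d * w) - c * (a * v + b * w) = (a * d - b * c) * w"
      by (simp_all add: algebra_simps)
    moreover have "[(a * d - b * c) * v = 1 * v] (mod int r)" "[(a * d - b * c) * w = 1 * w] (mod int r)"
      using det' by (simp_all only: cong_scalar_right)
    ultimately have "[1 * v = 0] (mod int r)" "[1 * w = 0] (mod int r)"
      by (auto simp: cong_def)
    then show ?thesis
      using that by (simp add: cong_def)
  qed
  have "card S = r ^ 2 - 1"
    using r1 by (simp add: S_def card_Diff_singleton power2_eq_square)
  moreover have "r dvd r ^ 2 - 1 \<Longrightarrow> r dvd 1"
    using r1 by (intro dvd_diffD1[of r "r ^ 2" 1]) auto
  ultimately have ndvd: "\<not> r dvd card S"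
    using r1 by auto
  obtain v w where vw: "(v, w) \<in> S" "f (v, w) = (v, w)"
  proof -
    have "f ` S \<subseteq> S"
    proof
      fix y assume "y \<in> f ` S"
      then obtain v w where vw: "(v, w) \<in> S" and y: "y = f (v, w)"
        by auto
      then have "\<not> (v = 0 \<and> w = 0)"
        by (simp add: S_def)
      then have "f (v, w) \<noteq> (0, 0)"
      proof (rule contrapos_nn)
        assume "f (v, w) = (0, 0)"
        then show "v = 0 \<and> w = 0"
          using vw by (intro zero) (simp_all add: f_def S_def cong_def)
      qed
      moreover have "x mod int r \<in> {0..<int r}" for x
        using r1 by simp
      ultimately show "y \<in> S"
        unfolding y by (simp add: S_def f_def)
    qed
    moreover have "(f ^^ r) x = x" if "x \<in> S" for x
    proof (cases x)
      case (Pair v w)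
      then show ?thesis
        using iter[of r 1 0 0 1 v w] one that by (auto simp: one_SL2[OF q] S_def)
    qed
    moreover have "finite S"
      by (simp add: S_def)
    ultimately obtain x where "x \<in> S" "f x = x"
      using prime_period_imp_fixpoint[of S f r] r(1) ndvd by blast
    then show ?thesis
      using that by (metis surj_pair)
  qed
  have fix1: "[a * v + b * w = v] (mod int r)" "[c * v + d * w = w] (mod int r)"
    using vw by (auto simp: f_def S_def cong_def)
  \<comment> \<open>Multiplying the fixed point equations by the adjugate of A - 1 leaves det(A - 1)
    times the vector, and det(A - 1) is 2 - tr A modulo \<open>r\<close>.\<close>
  have "[(d - 1) * (a * v + b * w - v) - b * (c * v + d * w - w) = 0] (mod int r)"
    "[(a - 1) * (c * v + d * w - w) - c * (a * v + b * w - v) = 0] (mod int r)"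
    using fix1 by (simp_all add: cong_iff_dvd_diff)
  moreover have "(d - 1) * (a * v + b * w - v) - b * (c * v + d * w - w) = ((a * d - b * c) - 1) * v - (a + d - 2) * v"
    "(a - 1) * (c * v + d * w - w) - c * (a * v + b * w - v) = ((a * d - b * c) - 1) * w - (a + d - 2) * w"
    by (simp_all add: algebra_simps)
  moreover have "int r dvd ((a * d - b * c) - 1) * v" "int r dvd ((a * d - b * c) - 1) * w"
    using det' by (simp_all add: cong_iff_dvd_diff)
  ultimately have "int r dvd (a + d - 2) * v" "int r dvd (a + d - 2) * w"
    unfolding cong_0_iff by (simp_all only: dvd_diff_right_iff)
  moreover have "\<not> int r dvd v \<or> \<not> int r dvd w"
    using vw(1) by (auto simp: S_def zdvd_not_zless dest: zdvd_imp_le)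
  ultimately show ?thesis
    using r(1) prime_dvd_mult_iff[of "int r"] by auto
qed

section \<open>Arithmetic modulo \<open>q = p\<^sup>k\<close>\<close>

locale mersenne_power =
  fixes p k m :: nat
  assumes p: "Factorial_Ring.prime p" and p7: "p \<ge> 7" and k2: "k \<ge> 2" and mers: "p + 1 = 2 ^ m"
begin

definition q :: nat where "q = p ^ k"

lemma int_q: "int q = int p ^ k"
  by (simp add: q_def)

lemma q1: "q > 1"
  unfolding q_def using p7 k2 by (intro one_less_power) auto

lemma prime_int_p: "Factorial_Ring.prime (int p)"
  using p by simp

lemma p_dvd_q: "int p dvd int q"
  using k2 by (simp add: q_def)

lemma pow_dvd_q: "l \<le> k \<Longrightarrow> int p ^ l dvd int q"
  by (simp add: int_q le_imp_power_dvd)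

lemma odd_p: "odd p"
  using p p7 prime_odd_nat by simp

text \<open>Since \<open>p + 1\<close> is a power of 2 and at least 8, p is 3 modulo 4. This is how
  -1 becomes a nonresidue.\<close>

lemma odd_half: "odd ((p - 1) div 2)"
proof -
  have "m \<ge> 2"
  proof (rule ccontr)
    assume "\<not> m \<ge> 2"
    then have "(2::nat) ^ m \<le> 2 ^ 1"
      by (intro power_increasing) auto
    then show False
      using p7 mers by simp
  qed
  then have "(4::nat) dvd 2 ^ m"
    using le_imp_power_dvd[of 2 m "2::nat"] by simp
  then have "(4::nat) dvd p + 1"
    using mers by metis
  then show ?thesis
    by presburger
qed

lemma coprime_q_iff: "coprime x (int q) \<longleftrightarrow> \<not> int p dvd x"
proof
  assume "coprime x (int q)"
  then show "\<not> int p dvd x"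
    using p_dvd_q prime_int_p by (meson coprime_common_divisor not_prime_unit)
next
  assume "\<not> int p dvd x"
  then show "coprime x (int q)"
    using prime_imp_coprime[OF prime_int_p] by (simp add: int_q coprime_commute)
qed

lemma inverse_mod_q:
  assumes "\<not> int p dvd x"
  obtains y where "[x * y = 1] (mod int q)"
  using assms coprime_q_iff cong_solve_coprime_int by blast

lemma cong_q_imp_p: "[x = y] (mod int q) \<Longrightarrow> [x = y] (mod int p)"
  using p_dvd_q by (rule cong_dvd_modulus[rotated])

text \<open>The cofactor of \<open>z - 1\<close> in \<open>z\<^sup>p\<^sup>-\<^sup>1 - 1\<close> is congruent to \<open>p - 1\<close> modulo \<open>p\<close>, hence a unit.\<close>

lemma teichmueller_eq_1:
  assumes z: "[z = 1] (mod int p)" and one: "[z ^ (p - 1) = 1] (mod int q)"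
  shows "[z = 1] (mod int q)"
proof -
  define S where "S = (\<Sum>i<p - 1. z ^ i)"
  have "[S = (\<Sum>i<p - 1. 1 ^ i)] (mod int p)"
    unfolding S_def by (intro cong_sum cong_pow z)
  then have "[S = int p - 1] (mod int p)"
    using p7 by (simp add: of_nat_diff)
  moreover have "\<not> int p dvd int p - 1"
    using p7 by (simp add: zdvd_not_zless)
  ultimately have "coprime S (int q)"
    unfolding coprime_q_iff by (metis cong_dvd_iff)
  moreover have "int q dvd (z - 1) * S"
    using one unfolding S_def power_diff_1_eq[symmetric] by (simp add: cong_iff_dvd_diff)
  ultimately show ?thesis
    by (simp add: cong_iff_dvd_diff coprime_commute coprime_dvd_mult_left_iff)
qed

text \<open>The numbers y - 1 and y + 1 differ by 2, so one of them is a unit and all of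
  \<open>q\<close> divides the other.\<close>

lemma square_cong_1:
  assumes "[y ^ 2 = 1] (mod int q)"
  shows "[y = 1] (mod int q) \<or> [y = -1] (mod int q)"
proof -
  have dvd: "int q dvd (y - 1) * (y + 1)"
    using assms by (simp add: cong_iff_dvd_diff power2_eq_square algebra_simps)
  have "\<not> int p dvd y - 1 \<or> \<not> int p dvd y + 1"
  proof (rule ccontr)
    assume "\<not> ?thesis"
    then have "int p dvd (y + 1) - (y - 1)"
      using dvd_diff by blast
    then show False
      using p7 by (simp add: zdvd_not_zless)
  qed
  then have "coprime (y - 1) (int q) \<or> coprime (y + 1) (int q)"
    by (simp add: coprime_q_iff)
  then show ?thesis
    using dvd by (auto simp: cong_iff_dvd_diff coprime_commute coprime_dvd_mult_left_iff coprime_dvd_mult_right_iff)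
qed

section \<open>Squares and roots of unity modulo q\<close>

lemma totient_q: "totient q = p ^ (k - 1) * (p - 1)"
  using p k2 by (simp add: q_def totient_prime_power)

lemma euler_q: "\<not> int p dvd x \<Longrightarrow> [x ^ totient q = 1] (mod int q)"
  using residues.euler_theorem[of "int q" x] q1 by (simp add: residues_def coprime_q_iff)

lemma not_cong_minus_1: "\<not> [1 = -1] (mod int p)"
  using p7 by (simp add: cong_iff_dvd_diff zdvd_not_zless)

lemma half_totient: "odd (totient q div 2)" "totient q = 2 * (totient q div 2)"
proof -
  have "p - 1 = 2 * ((p - 1) div 2)"
    using odd_p by simp
  then have *: "totient q = 2 * (p ^ (k - 1) * ((p - 1) div 2))"
    unfolding totient_q by (metis mult.left_commute)
  then have "totient q div 2 = p ^ (k - 1) * ((p - 1) div 2)"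
    by simp
  then show "odd (totient q div 2)" "totient q = 2 * (totient q div 2)"
    using odd_p odd_half * by auto
qed

text \<open>Raising to half the totient of \<open>q\<close>, an odd number, would turn Euler's
  theorem into 1 = -1 modulo p.\<close>

lemma minus_1_not_square: "\<not> [y ^ 2 = -1] (mod int p)"
proof
  assume y: "[y ^ 2 = -1] (mod int p)"
  have "\<not> int p dvd y"
  proof
    assume "int p dvd y"
    then have "[y ^ 2 = 0] (mod int p)"
      by (simp add: cong_0_iff power2_eq_square)
    with y have "[0 = -1] (mod int p)"
      using cong_sym cong_trans by blast
    then show False
      using p7 by (simp add: cong_iff_dvd_diff zdvd_not_zless)
  qed
  then have "[y ^ totient q = 1] (mod int p)"
    using euler_q cong_q_imp_p by blast
  moreover have "[(y ^ 2) ^ (totient q div 2) = (-1) ^ (totient q div 2)] (mod int p)"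
    using y by (rule cong_pow)
  moreover have "(y ^ 2) ^ (totient q div 2) = y ^ totient q"
    using half_totient(2) by (metis power_mult)
  ultimately have "[1 = -1] (mod int p)"
    using half_totient(1) by (metis cong_sym cong_trans minus_one_power_iff)
  then show False
    using not_cong_minus_1 by simp
qed

text \<open>Let N be half the totient, which is odd. Then \<open>c ^ N\<close> is c times a square,
  and it is a square root of 1 by Euler's theorem, hence a sign.\<close>

lemma unit_times_square:
  assumes "\<not> int p dvd c"
  obtains x \<delta> where "[c * x ^ 2 = \<delta>] (mod int q)" "\<delta> = 1 \<or> \<delta> = -1"
proof -
  define N where "N = totient q div 2"
  define x where "x = c ^ ((N - 1) div 2)"
  have "c * x ^ 2 = c ^ (Suc (2 * ((N - 1) div 2)))"
    by (simp add: x_def power_mult mult.commute flip: power_mult)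
  also have "Suc (2 * ((N - 1) div 2)) = N"
    using half_totient(1) by (simp add: N_def odd_pos)
  finally have x: "c * x ^ 2 = c ^ N" .
  have "[(c ^ N) ^ 2 = 1] (mod int q)"
    using euler_q[OF assms] half_totient(2) by (simp add: N_def flip: power_mult) (metis mult.commute)
  then show ?thesis
    using square_cong_1 that[of x 1] that[of x "-1"] x by auto
qed

text \<open>The roots of unity are cyclic of order \<open>p - 1\<close>. Integer exponents make
  \<open>E (- i)\<close> the inverse of \<open>E i\<close>, as the dihedral computations
  require.\<close>

lemma roots_of_unity_parametrization:
  obtains E :: "int \<Rightarrow> int" where
    "\<And>i j. [E i * E j = E (i + j)] (mod int q)" "\<And>i. [E i = 1] (mod int q) \<longleftrightarrow> int (p - 1) dvd i"
    "E 0 = 1" "\<And>x. [x ^ (p - 1) = 1] (mod int q) \<longleftrightarrow> (\<exists>i. [x = E i] (mod int q))"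
proof -
  obtain g0 where g0: "residue_primroot q g0"
    using residue_primroot_odd_prime_power_exists[OF p odd_p] k2 unfolding q_def by (metis gr_zeroI not_numeral_le_zero)
  then have ord: "ord q g0 = p ^ (k - 1) * (p - 1)" and cop: "coprime q g0"
    by (simp_all add: residue_primroot_def totient_q)
  \<comment> \<open>This power of a primitive root has order exactly \<open>p - 1\<close>.\<close>
  define g where "g = g0 ^ (p ^ (k - 1))"
  have ordg: "[int g ^ d = 1] (mod int q) \<longleftrightarrow> (p - 1) dvd d" for d
  proof -
    have "[int g ^ d = 1] (mod int q) \<longleftrightarrow> [g0 ^ (p ^ (k - 1) * d) = 1] (mod q)"
      by (simp add: g_def power_mult flip: cong_int_iff)
    also have "\<dots> \<longleftrightarrow> (p - 1) dvd d"
      using p7 unfolding ord_divides ord by simp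
    finally show ?thesis .
  qed
  have gmod: "[int g ^ (i mod (p - 1)) = int g ^ i] (mod int q)" for i
  proof -
    have "int g ^ i = int g ^ (i mod (p - 1)) * int g ^ ((p - 1) * (i div (p - 1)))"
      by (simp flip: power_add)
    moreover have "[int g ^ (i mod (p - 1)) * int g ^ ((p - 1) * (i div (p - 1))) = int g ^ (i mod (p - 1)) * 1] (mod int q)"
      using ordg by (intro cong_mult cong_refl) simp
    ultimately show ?thesis
      by (simp add: cong_sym)
  qed
  \<comment> \<open>Reducing the exponent first gives a meaning to negative
    \<open>i\<close>.\<close>
  define E where "E i = int g ^ nat (i mod int (p - 1))" for i
  have pos: "i mod int (p - 1) \<ge> 0" for i
    using p7 by simp
  show ?thesis
  proof (rule that[of E])
    show "[E i * E j = E (i + j)] (mod int q)" for i j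
    proof -
      have "nat ((i + j) mod int (p - 1)) = nat (i mod int (p - 1) + j mod int (p - 1)) mod (p - 1)"
        using pos by (metis add_nonneg_nonneg mod_add_eq nat_int nat_mod_distrib of_nat_0_le_iff)
      moreover have "E i * E j = int g ^ nat (i mod int (p - 1) + j mod int (p - 1))"
        using pos by (simp add: E_def nat_add_distrib power_add)
      ultimately show ?thesis
        using gmod cong_sym unfolding E_def by metis
    qed
    show "[E i = 1] (mod int q) \<longleftrightarrow> int (p - 1) dvd i" for i
    proof -
      have "[E i = 1] (mod int q) \<longleftrightarrow> int (p - 1) dvd int (nat (i mod int (p - 1)))"
        unfolding E_def ordg by (simp only: int_dvd_int_iff)
      then show ?thesis
        using pos by (simp add: dvd_mod_iff)
    qed
    show "E 0 = 1"
      by (simp add: E_def)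
    show "[x ^ (p - 1) = 1] (mod int q) \<longleftrightarrow> (\<exists>i. [x = E i] (mod int q))" for x
    proof
      assume "\<exists>i. [x = E i] (mod int q)"
      then obtain i where "[x ^ (p - 1) = E i ^ (p - 1)] (mod int q)"
        using cong_pow by blast
      moreover have "[E i ^ (p - 1) = 1] (mod int q)"
        unfolding E_def power_mult[symmetric] ordg by simp
      ultimately show "[x ^ (p - 1) = 1] (mod int q)"
        by (rule cong_trans)
    next
      assume x: "[x ^ (p - 1) = 1] (mod int q)"
      define y where "y = nat (x mod int q)"
      have xy: "[int y = x] (mod int q)"
        using q1 by (simp add: y_def)
      have "[int y ^ (p - 1) = 1] (mod int q)"
        using cong_pow[OF xy] x by (rule cong_trans)
      then have y1: "[y ^ (p - 1) = 1] (mod q)"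
        by (simp flip: cong_int_iff)
      then have "coprime y q"
        using cong_imp_coprime[OF cong_sym[OF y1]] p7 by (simp add: coprime_commute)
      moreover have "y < q"
        using q1 by (simp add: y_def nat_less_iff)
      moreover have "y > 0"
        using \<open>coprime y q\<close> q1 by (cases "y = 0") auto
      ultimately have "y \<in> totatives q"
        by (simp add: totatives_def)
      then obtain j where j: "y = g0 ^ j mod q"
        using residue_primroot_is_generator[OF q1 g0] by (auto simp: bij_betw_def)
      have "[g0 ^ (j * (p - 1)) = y ^ (p - 1)] (mod q)"
        unfolding j by (simp add: cong_def power_mod power_mult)
      \<comment> \<open>The order of \<open>g0\<close> is p^(k-1) (p - 1), so p^(k-1) divides the
        exponent \<open>j\<close>, and the root of unity is a power of \<open>g\<close>.\<close>
      then have "ord q g0 dvd j * (p - 1)"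
        unfolding ord_divides[symmetric] using y1 by (rule cong_trans)
      then have "p ^ (k - 1) dvd j"
        using p7 unfolding ord by simp
      then obtain i where "j = p ^ (k - 1) * i" ..
      then have "[int y = int g ^ i] (mod int q)"
        by (simp add: j g_def cong_def flip: power_mult)
          (metis of_nat_mod of_nat_power mod_mod_trivial)
      moreover have "[int g ^ i = E (int i)] (mod int q)"
        using gmod[of i] by (simp add: E_def nat_mod_distrib cong_sym)
      ultimately show "\<exists>i. [x = E i] (mod int q)"
        using xy cong_sym cong_trans by blast
    qed
  qed
qed

end

section \<open>The point stabilizer and elements of prime order\<close>

context mersenne_power
begin

section \<open>Multiples of p^(k-1) and roots of unity modulo q\<close>

definition P :: int where "P = int p ^ (k - 1)"

lemma P_dvd_q: "P dvd int q"
  by (simp add: P_def pow_dvd_q)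

lemma p_dvd_P: "int p dvd P"
  unfolding P_def using k2 by (intro dvd_power) simp

lemma q_eq_p_P: "int q = int p * P"
  using k2 by (simp add: P_def int_q power_eq_if)

text \<open>The ideal generated by \<open>P\<close> squares to zero modulo q because
  \<open>2 * (k - 1) \<ge> k\<close>. Thus the determinant of a matrix in \<open>stab_lift\<close>
  involves only its two unit entries.\<close>

lemma q_dvd_mult_P:
  assumes "P dvd x" "P dvd y"
  shows "int q dvd x * y"
proof -
  have "int q dvd P * P"
    using k2 by (simp add: P_def int_q le_imp_power_dvd flip: power_add)
  then show ?thesis
    using mult_dvd_mono[OF assms] dvd_trans by blast
qed

text \<open>These are the Teichmueller units: the subgroup of order \<open>p - 1\<close>, which
  reduction maps bijectively onto the nonzero residues modulo p.\<close>

definition root_unity :: "int \<Rightarrow> bool" where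
  "root_unity x \<longleftrightarrow> [x ^ (p - 1) = 1] (mod int q)"

lemma root_unity_cong: "[x = y] (mod int q) \<Longrightarrow> root_unity x \<longleftrightarrow> root_unity y"
  unfolding root_unity_def by (meson cong_pow cong_sym cong_trans)

lemma root_unity_mod [simp]: "root_unity (x mod int q) \<longleftrightarrow> root_unity x"
  by (rule root_unity_cong) simp

lemma root_unity_mult: "root_unity x \<Longrightarrow> root_unity y \<Longrightarrow> root_unity (x * y)"
  unfolding root_unity_def power_mult_distrib using cong_mult by fastforce

lemma root_unity_1 [simp]: "root_unity 1"
  by (simp add: root_unity_def)

lemma root_unity_minus [simp]: "root_unity (- x) \<longleftrightarrow> root_unity x"
  using odd_p by (simp add: root_unity_def)

lemma root_unity_inverse:
  assumes "[x * y = 1] (mod int q)" "root_unity x"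
  shows "root_unity y"
proof -
  have "[x ^ (p - 1) * y ^ (p - 1) = 1 * y ^ (p - 1)] (mod int q)"
    using assms(2) unfolding root_unity_def by (intro cong_mult cong_refl)
  moreover have "[x ^ (p - 1) * y ^ (p - 1) = 1] (mod int q)"
    using cong_pow[OF assms(1), of "p - 1"] by (simp add: power_mult_distrib)
  ultimately show ?thesis
    unfolding root_unity_def by (metis cong_sym cong_trans mult_1)
qed

lemma root_unity_not_dvd:
  assumes "root_unity x"
  shows "\<not> int p dvd x"
proof
  assume "int p dvd x"
  then have "int p dvd x ^ (p - 1)"
    using p7 by (meson dvd_trans dvd_power zero_less_diff less_le_trans one_less_numeral_iff semiring_norm(77))
  moreover have "[x ^ (p - 1) = 1] (mod int p)"
    using assms cong_q_imp_p by (simp add: root_unity_def)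
  ultimately have "int p dvd 1"
    using cong_dvd_iff by blast
  then show False
    using p7 by simp
qed

lemma root_unity_eq_1: "root_unity x \<Longrightarrow> [x = 1] (mod int p) \<Longrightarrow> [x = 1] (mod int q)"
  unfolding root_unity_def by (rule teichmueller_eq_1)

text \<open>This becomes the preimage of the point stabilizer. Testing one unit entry is enough,
  since the determinant makes the other one its inverse up to sign. Both signs are included, so the
  kernel of the action lies inside.\<close>

definition stab_lift :: "(int \<times> int \<times> int \<times> int) set" where
  "stab_lift = {(a, b, c, d) \<in> carrier (SL2 q).
     P dvd b \<and> P dvd c \<and> root_unity a \<or> P dvd a \<and> P dvd d \<and> root_unity b}"

lemma smat_in_stab_lift:
  "smat q a b c d \<in> stab_lift \<longleftrightarrow> [a * d - b * c = 1] (mod int q) \<and>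
     (P dvd b \<and> P dvd c \<and> root_unity a \<or> P dvd a \<and> P dvd d \<and> root_unity b)"
proof -
  have "P dvd x mod int q \<longleftrightarrow> P dvd x" for x
    using P_dvd_q by (simp add: dvd_mod_iff)
  then show ?thesis
    using smat_in_SL2[OF q1, of a b c d] by (simp add: stab_lift_def smat_def)
qed

lemma stab_lift_subset: "stab_lift \<subseteq> carrier (SL2 q)"
  by (auto simp: stab_lift_def)

text \<open>Modulo \<open>q\<close> the two off-diagonal (resp. diagonal) entries multiply to 0.\<close>

lemma stab_lift_cases:
  assumes "x \<in> stab_lift"
  obtains (diag) a b c d where "x = smat q a b c d" "[a * d - b * c = 1] (mod int q)"
      "P dvd b" "P dvd c" "root_unity a" "root_unity d" "[a * d = 1] (mod int q)"
  | (anti) a b c d where "x = smat q a b c d" "[a * d - b * c = 1] (mod int q)"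
      "P dvd a" "P dvd d" "root_unity b" "root_unity c" "[b * c = - 1] (mod int q)"
proof -
  obtain a b c d where x: "x = smat q a b c d" and det: "[a * d - b * c = 1] (mod int q)"
    using assms stab_lift_subset SL2_cases[OF q1] by (metis subsetD)
  from assms consider "P dvd b" "P dvd c" "root_unity a" | "P dvd a" "P dvd d" "root_unity b"
    unfolding x smat_in_stab_lift by blast
  then show ?thesis
  proof cases
    case 1
    have "[a * d - b * c + b * c = 1 + 0] (mod int q)"
      using q_dvd_mult_P[OF 1(1,2)] by (intro cong_add det) (simp add: cong_0_iff)
    then have "[a * d = 1] (mod int q)"
      by simp
    then show ?thesis
      using diag x det 1 root_unity_inverse by blast
  next
    case 2
    have "[a * d - (a * d - b * c) = 0 - 1] (mod int q)"
      using q_dvd_mult_P[OF 2(1,2)] by (intro cong_diff det) (simp add: cong_0_iff)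
    then have bc: "[b * c = - 1] (mod int q)"
      by simp
    then have "[b * (- c) = 1] (mod int q)"
      using cong_minus_minus_iff[of "b * c" "-1"] by simp
    then have "root_unity c"
      using root_unity_inverse[of b "- c"] 2 by simp
    then show ?thesis
      using anti x det 2 bc by blast
  qed
qed

lemma root_unity_add_P:
  assumes "root_unity x" "root_unity y" "P dvd z" "P dvd w"
  shows "root_unity (x * y + z * w)" "root_unity (z * w + x * y)"
proof -
  have "[x * y + z * w = x * y + 0] (mod int q)"
    using q_dvd_mult_P[OF assms(3,4)] by (intro cong_add) (simp_all add: cong_0_iff)
  then show "root_unity (x * y + z * w)" "root_unity (z * w + x * y)"
    using root_unity_mult[OF assms(1,2)] root_unity_cong by (simp_all add: add.commute)
qed

lemma subgroup_stab_lift: "subgroup stab_lift (SL2 q)"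
proof -
  interpret group "SL2 q" by (rule group_SL2[OF q1])
  show ?thesis
  proof (rule subgroupI)
    show "stab_lift \<noteq> {}"
      using smat_in_stab_lift[of 1 0 0 1] by auto
    show "inv\<^bsub>SL2 q\<^esub> x \<in> stab_lift" if "x \<in> stab_lift" for x
      using that by (cases rule: stab_lift_cases) (auto simp: smat_inv[OF q1] smat_in_stab_lift mult.commute)
    show "x \<otimes>\<^bsub>SL2 q\<^esub> y \<in> stab_lift" if "x \<in> stab_lift" "y \<in> stab_lift" for x y
      using that(1)
    proof (cases rule: stab_lift_cases)
      case 1: (diag a b c d)
      from that(2) show ?thesis
      proof (cases rule: stab_lift_cases)
        case 2: (diag a' b' c' d')
        show ?thesis
          unfolding 1(1) 2(1) smat_mult smat_in_stab_lift
          by (rule conjI[OF SL2_det_mult[OF 1(2) 2(2)]]) (use 1 2 in \<open>simp add: root_unity_add_P\<close>)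
      next
        case 2: (anti a' b' c' d')
        show ?thesis
          unfolding 1(1) 2(1) smat_mult smat_in_stab_lift
          by (rule conjI[OF SL2_det_mult[OF 1(2) 2(2)]]) (use 1 2 in \<open>simp add: root_unity_add_P\<close>)
      qed
    next
      case 1: (anti a b c d)
      from that(2) show ?thesis
      proof (cases rule: stab_lift_cases)
        case 2: (diag a' b' c' d')
        show ?thesis
          unfolding 1(1) 2(1) smat_mult smat_in_stab_lift
          by (rule conjI[OF SL2_det_mult[OF 1(2) 2(2)]]) (use 1 2 in \<open>simp add: root_unity_add_P\<close>)
      next
        case 2: (anti a' b' c' d')
        show ?thesis
          unfolding 1(1) 2(1) smat_mult smat_in_stab_lift
          by (rule conjI[OF SL2_det_mult[OF 1(2) 2(2)]]) (use 1 2 in \<open>simp add: root_unity_add_P\<close>)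
      qed
    qed
  qed (rule stab_lift_subset)
qed

lemma smat_conj:
  assumes "[a * d - b * c = 1] (mod int q)"
  shows "smat q a b c d \<otimes>\<^bsub>SL2 q\<^esub> smat q a' b' c' d' \<otimes>\<^bsub>SL2 q\<^esub> inv\<^bsub>SL2 q\<^esub> smat q a b c d =
    smat q ((a * a' + b * c') * d - (a * b' + b * d') * c) ((a * b' + b * d') * a - (a * a' + b * c') * b)
      ((c * a' + d * c') * d - (c * b' + d * d') * c) ((c * b' + d * d') * a - (c * a' + d * c') * b)"
  using assms by (simp add: smat_inv[OF q1] smat_mult smat_eq_iff)

text \<open>This identifies the kernel of the coset action as {1, -1}. Conjugation by elementary
  matrices adds an off-diagonal entry to a diagonal one; as the sum must again be a root of unity,
  that entry vanishes.\<close>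

lemma core_stab_lift:
  assumes x: "x \<in> carrier (SL2 q)"
  shows "(\<forall>h\<in>carrier (SL2 q). h \<otimes>\<^bsub>SL2 q\<^esub> x \<otimes>\<^bsub>SL2 q\<^esub> inv\<^bsub>SL2 q\<^esub> h \<in> stab_lift) \<longleftrightarrow> x \<in> SL2_center q"
proof
  assume "x \<in> SL2_center q"
  moreover have "SL2_center q \<subseteq> stab_lift"
    by (simp add: SL2_center_eq[OF q1] smat_in_stab_lift)
  ultimately show "\<forall>h\<in>carrier (SL2 q). h \<otimes>\<^bsub>SL2 q\<^esub> x \<otimes>\<^bsub>SL2 q\<^esub> inv\<^bsub>SL2 q\<^esub> h \<in> stab_lift"
    using normal.inv_op_closed2[OF normal_SL2_center[OF q1]] by blast
next
  assume conj: "\<forall>h\<in>carrier (SL2 q). h \<otimes>\<^bsub>SL2 q\<^esub> x \<otimes>\<^bsub>SL2 q\<^esub> inv\<^bsub>SL2 q\<^esub> h \<in> stab_lift"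
  interpret group "SL2 q" by (rule group_SL2[OF q1])
  have "x \<in> stab_lift"
    using conj[rule_format, OF one_closed] x by simp
  have U: "smat q 1 1 0 1 \<otimes>\<^bsub>SL2 q\<^esub> x \<otimes>\<^bsub>SL2 q\<^esub> inv\<^bsub>SL2 q\<^esub> smat q 1 1 0 1 \<in> stab_lift"
    and L: "smat q 1 0 1 1 \<otimes>\<^bsub>SL2 q\<^esub> x \<otimes>\<^bsub>SL2 q\<^esub> inv\<^bsub>SL2 q\<^esub> smat q 1 0 1 1 \<in> stab_lift"
    using conj by (auto simp: smat_in_SL2[OF q1])
  from \<open>x \<in> stab_lift\<close> show "x \<in> SL2_center q"
  proof (cases rule: stab_lift_cases)
    case (diag a b c d)
    \<comment> \<open>The conjugates below still have a unit in the upper left corner, which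
      excludes the second alternative of \<open>stab_lift\<close>.\<close>
    have ndvd: "\<not> P dvd a + y" if "P dvd y" for y
      using root_unity_not_dvd[OF diag(5)] p_dvd_P that dvd_trans dvd_add_left_iff by metis
    \<comment> \<open>These are the upper right and upper left entries of the conjugate by (1, 1, 0,
      1); the first yields that \<open>a\<close> and \<open>d\<close> agree modulo p.\<close>
    have *: "P dvd b + d - (a + c)" "root_unity (a + c)"
      using U ndvd[OF diag(4)] unfolding diag(1) by (auto simp: smat_conj smat_in_stab_lift)
    have **: "root_unity (a - b)"
      using L ndvd[of "- b"] diag(3) unfolding diag(1) by (auto simp: smat_conj smat_in_stab_lift)
    have "P dvd (b + d - (a + c)) - b + c"
      by (rule dvd_add[OF dvd_diff[OF *(1) diag(3)] diag(4)])
    then have "int p dvd d - a"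
      using p_dvd_P dvd_trans by fastforce
    then have "[a * d = a * a] (mod int p)"
      by (intro cong_mult cong_refl) (simp add: cong_iff_dvd_diff)
    moreover have "[a * d = 1] (mod int p)"
      using diag(7) by (rule cong_q_imp_p)
    ultimately have "[a * a = 1] (mod int p)"
      using cong_sym cong_trans by blast
    then have "[a * a = 1] (mod int q)"
      using root_unity_eq_1 root_unity_mult diag(5) by blast
    then obtain \<epsilon> where \<epsilon>: "\<epsilon> = 1 \<or> \<epsilon> = -1" "[a = \<epsilon>] (mod int q)"
      using square_cong_1[of a] by (auto simp: power2_eq_square)
    \<comment> \<open>The number \<open>\<epsilon> * (a + z)\<close> is a root of unity and 1 modulo
      p, hence 1 modulo q, and \<open>z\<close> is 0. This is used for \<open>z = c\<close> and
      \<open>z = - b\<close>.\<close>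
    have eq: "[z = 0] (mod int q)" if "root_unity (a + z)" "P dvd z" for z
    proof -
      have e2: "\<epsilon> * \<epsilon> = 1"
        using \<epsilon>(1) by auto
      have "[z = 0] (mod int p)"
        using that(2) p_dvd_P dvd_trans cong_0_iff by blast
      then have "[\<epsilon> * (a + z) = \<epsilon> * (\<epsilon> + 0)] (mod int p)"
        using \<epsilon>(2) cong_q_imp_p by (intro cong_mult cong_add cong_refl) auto
      moreover have "root_unity (\<epsilon> * (a + z))"
        using \<epsilon>(1) that(1) by (intro root_unity_mult) auto
      ultimately have "[\<epsilon> * (a + z) = 1] (mod int q)"
        using root_unity_eq_1 e2 by simp
      then have "[\<epsilon> * (\<epsilon> * (a + z)) - a = \<epsilon> * 1 - \<epsilon>] (mod int q)"
        using \<epsilon>(2) by (intro cong_mult cong_diff cong_refl)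
      moreover have "\<epsilon> * (\<epsilon> * (a + z)) - a = z"
        by (simp add: e2 flip: mult.assoc)
      ultimately show ?thesis
        by simp
    qed
    have c: "[c = 0] (mod int q)" and b: "[- b = 0] (mod int q)"
      using eq[of c] eq[of "- b"] * ** diag(3,4) by auto
    have "[\<epsilon> * (\<epsilon> * d) = \<epsilon> * (a * d)] (mod int q)"
      using \<epsilon>(2) by (intro cong_mult cong_refl) (rule cong_sym)
    also have "[\<epsilon> * (a * d) = \<epsilon> * 1] (mod int q)"
      using diag(7) by (intro cong_mult cong_refl)
    finally have "[d = \<epsilon>] (mod int q)"
      using \<epsilon>(1) by auto
    then have "x = smat q \<epsilon> 0 0 \<epsilon>"
      using b c \<epsilon>(2) by (simp add: diag(1) smat_eq_iff cong_0_iff)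
    then show ?thesis
      using \<epsilon>(1) by (auto simp: SL2_center_eq[OF q1])
  next
    case (anti a b c d)
    \<comment> \<open>In the conjugate by (1, 1, 0, 1) the first column consists of the units
      \<open>a + c\<close> and \<open>c\<close>, which neither alternative permits.\<close>
    have "\<not> P dvd c"
      using root_unity_not_dvd[OF anti(6)] p_dvd_P dvd_trans by blast
    moreover from this have "\<not> P dvd a + c"
      using anti(3) dvd_add_right_iff by blast
    ultimately show ?thesis
      using U unfolding anti(1) by (auto simp: smat_conj smat_in_stab_lift)
  qed
qed

section \<open>Congruence subgroups and elements of order p and 2\<close>

definition congr_sub :: "nat \<Rightarrow> (int \<times> int \<times> int \<times> int) set" where
  "congr_sub l = {(a, b, c, d) \<in> carrier (SL2 q).
     int p ^ l dvd a - 1 \<and> int p ^ l dvd b \<and> int p ^ l dvd c \<and> int p ^ l dvd d - 1}"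

lemma smat_in_congr_sub:
  assumes "l \<le> k"
  shows "smat q a b c d \<in> congr_sub l \<longleftrightarrow> [a * d - b * c = 1] (mod int q) \<and>
     int p ^ l dvd a - 1 \<and> int p ^ l dvd b \<and> int p ^ l dvd c \<and> int p ^ l dvd d - 1"
proof -
  have "int p ^ l dvd x mod int q - y \<longleftrightarrow> int p ^ l dvd x - y" for x y
    using cong_mod_dvd_iff[OF pow_dvd_q[OF assms]] by (simp add: cong_iff_dvd_diff)
  from this[of _ 0] this[of _ 1] show ?thesis
    using smat_in_SL2[OF q1, of a b c d] by (simp add: congr_sub_def smat_def)
qed

text \<open>With w = 1 + e v a unit, A^p = 1 says that P divides e u + w(A - 1). So a power p^j
  dividing \<open>e\<close>, with j <= k - 1, divides A - 1, and then the determinant puts p^i into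
  \<open>e\<close> for every i <= min(k, 2j).\<close>

lemma order_p_in_congr_sub:
  assumes det: "[a * d - b * c = 1] (mod int q)"
    and one: "smat q a b c d [^]\<^bsub>SL2 q\<^esub> p = \<one>\<^bsub>SL2 q\<^esub>"
  shows "smat q a b c d \<in> congr_sub (k - 1)" "int q dvd a + d - 2"
proof -
  define e where "e = a + d - 2"
  have pe: "int p dvd e"
    using SL2_prime_power_trivial_trace[OF q1 p _ det one] p_dvd_q by (simp add: e_def)
  obtain u v where uv: "smat q (1 + int p * (e * u + (1 + e * v) * (a - 1))) (int p * (1 + e * v) * b)
      (int p * (1 + e * v) * c) (1 + int p * (e * u + (1 + e * v) * (d - 1))) = smat q 1 0 0 1"
    using smat_pow_prime[OF q1 det e_def p _ pe] p7 one by (auto simp: one_SL2[OF q1])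
  define w where "w = 1 + e * v"
  have cw: "coprime (int p ^ j) w" for j
  proof -
    have "\<not> int p dvd w"
    proof
      assume "int p dvd w"
      then have "int p dvd w - e * v"
        using pe by (intro dvd_diff dvd_mult2)
      then show False
        using p7 by (simp add: w_def)
    qed
    then show ?thesis
      using prime_imp_coprime[OF prime_int_p] by simp
  qed
  \<comment> \<open>One factor p of \<open>q\<close> is used up by the p-th power, so only
    divisibility by \<open>P\<close> remains for A - 1.\<close>
  have "int p * P dvd int p * (e * u + w * (a - 1))" "int p * P dvd int p * (e * u + w * (d - 1))"
    "int p * P dvd int p * (w * b)" "int p * P dvd int p * (w * c)"
    using uv by (auto simp: smat_eq_iff cong_iff_dvd_diff w_def mult.assoc simp flip: q_eq_p_P)
  moreover have "P dvd z" if "int p * P dvd int p * z" for z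
    using that p7 by simp
  ultimately have Pd: "P dvd e * u + w * (a - 1)" "P dvd e * u + w * (d - 1)" "P dvd w * b" "P dvd w * c"
    by blast+
  have entries: "int p ^ j dvd a - 1 \<and> int p ^ j dvd d - 1 \<and> int p ^ j dvd b \<and> int p ^ j dvd c"
    if j: "j \<le> k - 1" "int p ^ j dvd e" for j
  proof -
    have "int p ^ j dvd w * (a - 1)" "int p ^ j dvd w * (d - 1)" "int p ^ j dvd w * b" "int p ^ j dvd w * c"
      using Pd[unfolded P_def, THEN dvd_trans[OF le_imp_power_dvd[OF j(1), of "int p"]]] j(2)
      by (simp_all add: dvd_add_right_iff)
    then show ?thesis
      using cw by (simp add: coprime_dvd_mult_right_iff)
  qed
  \<comment> \<open>The bracket vanishes modulo q, and the rest is quadratic in the entries of A -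
    1: here the exponent doubles.\<close>
  have e_eq: "e = (a * d - b * c - 1) + b * c - (a - 1) * (d - 1)"
    by (simp add: e_def algebra_simps)
  have e_dvd: "int p ^ i dvd e" if j: "j \<le> k - 1" "int p ^ j dvd e" and i: "i \<le> k" "i \<le> 2 * j" for i j
  proof -
    have "int p ^ i dvd int p ^ j * int p ^ j"
      using i by (simp add: le_imp_power_dvd flip: power_add)
    moreover have "int p ^ i dvd a * d - b * c - 1"
      using det pow_dvd_q[OF i(1)] dvd_trans by (auto simp: cong_iff_dvd_diff)
    moreover have "int p ^ j * int p ^ j dvd b * c" "int p ^ j * int p ^ j dvd (a - 1) * (d - 1)"
      using entries[OF j] by (auto intro: mult_dvd_mono)
    ultimately show ?thesis
      unfolding e_eq by (meson dvd_add dvd_diff dvd_trans)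
  qed
  \<comment> \<open>From j >= 1, \<open>Suc j \<le> 2 * j\<close> allows a climb in single steps.
    The final passage from \<open>k - 1\<close> to \<open>k\<close> uses
    \<open>k \<le> 2 * (k - 1)\<close> and yields the trace modulo q.\<close>
  have "int p ^ j dvd e" if "1 \<le> j" "j \<le> k - 1" for j
    using that
  proof (induction j rule: dec_induct)
    case (step j)
    then show ?case
      using e_dvd[of j "Suc j"] by simp
  qed (use pe in simp)
  then have Pe: "int p ^ (k - 1) dvd e"
    using k2 by simp
  then show "smat q a b c d \<in> congr_sub (k - 1)"
    using entries[of "k - 1"] det by (simp add: smat_in_congr_sub)
  show "int q dvd a + d - 2"
    using e_dvd[of "k - 1" k] Pe k2 by (simp add: int_q e_def)
qed

text \<open>Conjugating by a product of two elementary matrices makes the diagonal of the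
  trace zero matrix \<open>(A - 1) / p\<^sup>k\<^sup>-\<^sup>1\<close> vanish modulo \<open>p\<close>.\<close>

lemma order_p_conj_in_stab_lift:
  assumes x: "x \<in> carrier (SL2 q)" "x [^]\<^bsub>SL2 q\<^esub> p = \<one>\<^bsub>SL2 q\<^esub>"
  shows "\<exists>h\<in>carrier (SL2 q). h \<otimes>\<^bsub>SL2 q\<^esub> x \<otimes>\<^bsub>SL2 q\<^esub> inv\<^bsub>SL2 q\<^esub> h \<in> stab_lift"
proof -
  obtain a b c d where x_eq: "x = smat q a b c d" and det: "[a * d - b * c = 1] (mod int q)"
    using x(1) by (rule SL2_cases[OF q1])
  have "smat q a b c d \<in> congr_sub (k - 1)" and tr: "int q dvd a + d - 2"
    using order_p_in_congr_sub[OF det] x(2) by (simp_all add: x_eq)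
  then have "P dvd a - 1" "P dvd b" "P dvd c" "P dvd d - 1"
    by (simp_all add: smat_in_congr_sub P_def)
  then obtain \<alpha> \<beta> \<gamma> \<delta> where e: "a - 1 = P * \<alpha>" "b = P * \<beta>" "c = P * \<gamma>" "d - 1 = P * \<delta>"
    by (auto elim!: dvdE)
  have "a + d - 2 = P * (\<alpha> + \<delta>)"
    using e by (simp add: algebra_simps)
  then have tr': "int p dvd \<alpha> + \<delta>"
    using tr p7 by (simp add: q_eq_p_P P_def mult.commute[of "int p"])
  \<comment> \<open>Write A = 1 + P M. Conjugation by (1, 0, -r, 1) gives M the upper left entry
    \<open>\<alpha> + \<beta> * r\<close> and the quadratic in \<open>r\<close> as lower left entry;
    then (1, -s, 0, 1) subtracts \<open>s\<close> times the latter from the former.\<close>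
  have "\<exists>r s. [s * (\<gamma> + r * (\<delta> - \<alpha>) - r * r * \<beta>) = \<alpha> + \<beta> * r] (mod int p)"
  proof (cases "\<exists>r. \<not> int p dvd \<gamma> + r * (\<delta> - \<alpha>) - r * r * \<beta>")
    case True
    then obtain r where "\<not> int p dvd \<gamma> + r * (\<delta> - \<alpha>) - r * r * \<beta>" ..
    then obtain y where "[(\<gamma> + r * (\<delta> - \<alpha>) - r * r * \<beta>) * y = 1] (mod int q)"
      by (rule inverse_mod_q)
    then have "[(\<gamma> + r * (\<delta> - \<alpha>) - r * r * \<beta>) * y * (\<alpha> + \<beta> * r) = 1 * (\<alpha> + \<beta> * r)] (mod int p)"
      using cong_q_imp_p by (intro cong_mult cong_refl) auto
    then show ?thesis
      by (intro exI[of _ r] exI[of _ "y * (\<alpha> + \<beta> * r)"]) (simp add: mult_ac)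
  next
    case False
    \<comment> \<open>A quadratic vanishing at 1 and -1 gives 2(\<open>\<alpha>\<close> -
      \<open>\<delta>\<close>) = 0; adding twice the trace leaves 4 \<open>\<alpha>\<close> = 0, so
      r = s = 0 already works.\<close>
    have d0: "int p dvd \<gamma>" and d1: "int p dvd \<gamma> + (\<delta> - \<alpha>) - \<beta>" and d2: "int p dvd \<gamma> + (\<alpha> - \<delta>) - \<beta>"
      using False[simplified, rule_format, of 0] False[simplified, rule_format, of 1]
        False[simplified, rule_format, of "-1"] by simp_all
    have "int p dvd (\<gamma> + (\<alpha> - \<delta>) - \<beta>) - (\<gamma> + (\<delta> - \<alpha>) - \<beta>) + 2 * (\<alpha> + \<delta>)"
      by (rule dvd_add[OF dvd_diff[OF d2 d1] dvd_mult[OF tr']])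
    then have "int p dvd 4 * \<alpha>"
      by simp
    moreover have "\<not> int p dvd 4"
      using p7 by (simp add: zdvd_not_zless)
    ultimately have "int p dvd \<alpha>"
      using prime_int_p prime_dvd_mult_iff by blast
    then show ?thesis
      by (intro exI[of _ 0]) (simp add: cong_0_iff cong_sym_eq[of 0])
  qed
  then obtain r s where rs: "[s * (\<gamma> + r * (\<delta> - \<alpha>) - r * r * \<beta>) = \<alpha> + \<beta> * r] (mod int p)"
    by blast
  define c' where "c' = c + r * (d - a) - r * r * b"
  have c': "c' = P * (\<gamma> + r * (\<delta> - \<alpha>) - r * r * \<beta>)"
  proof -
    have "a = P * \<alpha> + 1" "d = P * \<delta> + 1"
      using e by simp_all
    then show ?thesis
      by (simp add: c'_def e(2,3) algebra_simps)
  qed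
  have "int p dvd (\<alpha> + \<beta> * r) - s * (\<gamma> + r * (\<delta> - \<alpha>) - r * r * \<beta>)"
    using rs cong_sym by (simp add: cong_iff_dvd_diff dvd_diff_commute)
  then have "int q dvd P * ((\<alpha> + \<beta> * r) - s * (\<gamma> + r * (\<delta> - \<alpha>) - r * r * \<beta>))"
    unfolding q_eq_p_P by (simp add: mult.commute)
  also have "P * ((\<alpha> + \<beta> * r) - s * (\<gamma> + r * (\<delta> - \<alpha>) - r * r * \<beta>)) = (a + b * r - s * c') - 1"
    using e(1) by (simp add: c' e(2) algebra_simps)
  finally have A: "root_unity (a + b * r - s * c')"
    using root_unity_cong[of "a + b * r - s * c'" 1] by (simp add: cong_iff_dvd_diff)
  have Pc': "P dvd c'"
    by (simp add: c')
  have B: "P dvd b + s * (a - d) + 2 * (s * (b * r)) - s * s * c'"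
  proof -
    have "a - d = P * (\<alpha> - \<delta>)"
      using e by (simp add: algebra_simps)
    then show ?thesis
      using Pc' by (simp add: e(2) dvd_diff)
  qed
  \<comment> \<open>The product of (1, -s, 0, 1) and (1, 0, -r, 1).\<close>
  define h where "h = smat q (1 + s * r) (- s) (- r) 1"
  have hdet: "[(1 + s * r) * 1 - (- s) * (- r) = 1] (mod int q)"
    by (simp add: algebra_simps)
  have "h \<in> carrier (SL2 q)"
    using hdet by (simp add: h_def smat_in_SL2[OF q1])
  moreover have "h \<otimes>\<^bsub>SL2 q\<^esub> x \<otimes>\<^bsub>SL2 q\<^esub> inv\<^bsub>SL2 q\<^esub> h \<in> stab_lift"
  proof -
    interpret group "SL2 q" by (rule group_SL2[OF q1])
    have "h \<otimes>\<^bsub>SL2 q\<^esub> x \<otimes>\<^bsub>SL2 q\<^esub> inv\<^bsub>SL2 q\<^esub> h =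
      smat q (a + b * r - s * c') (b + s * (a - d) + 2 * (s * (b * r)) - s * s * c') c' (d - r * b + s * c')"
      unfolding h_def x_eq smat_conj[OF hdet]
      by (rule arg_cong4[where f = "smat q"]) (simp_all add: c'_def algebra_simps)
    moreover have "h \<otimes>\<^bsub>SL2 q\<^esub> x \<otimes>\<^bsub>SL2 q\<^esub> inv\<^bsub>SL2 q\<^esub> h \<in> carrier (SL2 q)"
      using \<open>h \<in> carrier (SL2 q)\<close> x(1) by simp
    ultimately show ?thesis
      using A B Pc' by (simp add: smat_in_stab_lift smat_in_SL2[OF q1])
  qed
  ultimately show ?thesis
    by blast
qed

text \<open>By Cayley-Hamilton the square \<open>\<epsilon>\<close> and the trace \<open>t\<close>
  satisfy t x = \<open>\<epsilon>\<close> + 1. For \<open>\<epsilon>\<close> = 1 the trace is a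
  unit, so x is scalar and thus a sign, which is excluded. For \<open>\<epsilon>\<close> = -1 the
  trace is 0, and x is brought to antidiagonal form.\<close>

lemma involution_conj_in_stab_lift:
  assumes x: "x \<in> carrier (SL2 q)" "x \<otimes>\<^bsub>SL2 q\<^esub> x \<in> SL2_center q" "x \<notin> SL2_center q"
  shows "\<exists>h\<in>carrier (SL2 q). h \<otimes>\<^bsub>SL2 q\<^esub> x \<otimes>\<^bsub>SL2 q\<^esub> inv\<^bsub>SL2 q\<^esub> h \<in> stab_lift"
proof -
  obtain a b c d where x_eq: "x = smat q a b c d" and det: "[a * d - b * c = 1] (mod int q)"
    using x(1) by (rule SL2_cases[OF q1])
  obtain \<epsilon> where \<epsilon>: "\<epsilon> = 1 \<or> \<epsilon> = -1" and sq: "x \<otimes>\<^bsub>SL2 q\<^esub> x = smat q \<epsilon> 0 0 \<epsilon>"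
    using x(2) by (auto simp: SL2_center_eq[OF q1])
  define t where "t = a + d"
  have sq: "[a * a + b * c = \<epsilon>] (mod int q)" "[t * b = 0] (mod int q)" "[t * c = 0] (mod int q)"
    using sq by (auto simp: x_eq smat_mult smat_eq_iff t_def algebra_simps)
  have "[(a * a + b * c) + (a * d - b * c) = \<epsilon> + 1] (mod int q)"
    by (intro cong_add sq det)
  then have ta: "[t * a = \<epsilon> + 1] (mod int q)"
    by (simp add: t_def algebra_simps)
  show ?thesis
  proof (cases "\<epsilon> = 1")
    case True
    have "\<not> int p dvd t"
    proof
      assume "int p dvd t"
      then have "int p dvd 2"
        using cong_q_imp_p[OF ta] True cong_dvd_iff by fastforce
      then show False
        using p7 by (simp add: zdvd_not_zless)
    qed
    then have "coprime (int q) t"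
      by (simp add: coprime_q_iff coprime_commute)
    then have b: "int q dvd b" and c: "int q dvd c"
      using sq by (simp_all add: cong_0_iff coprime_dvd_mult_right_iff)
    have "[a * a + b * c - b * c = 1 - 0] (mod int q)"
      using sq(1) b True by (intro cong_diff) (simp_all add: cong_0_iff)
    then obtain \<eta> where \<eta>: "\<eta> = 1 \<or> \<eta> = -1" "[a = \<eta>] (mod int q)"
      using square_cong_1[of a] by (auto simp: power2_eq_square)
    have "[a * d - b * c + b * c = 1 + 0] (mod int q)"
      using det b by (intro cong_add) (simp_all add: cong_0_iff)
    moreover have "[a * d = \<eta> * d] (mod int q)"
      using \<eta>(2) by (intro cong_mult cong_refl)
    ultimately have "[\<eta> * d = 1] (mod int q)"
      by (simp add: cong_def)
    then have "[\<eta> * (\<eta> * d) = \<eta> * 1] (mod int q)"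
      by (intro cong_mult cong_refl)
    then have "[d = \<eta>] (mod int q)"
      using \<eta>(1) by auto
    then have "x = smat q \<eta> 0 0 \<eta>"
      using \<eta>(2) b c by (simp add: x_eq smat_eq_iff cong_0_iff)
    then show ?thesis
      using x(3) \<eta>(1) by (auto simp: SL2_center_eq[OF q1])
  next
    case False
    then have e: "\<epsilon> = -1"
      using \<epsilon> by simp
    have "[d * (t * a) - c * (t * b) = d * 0 - c * 0] (mod int q)"
      using ta sq(2) e by (intro cong_diff cong_mult cong_refl) auto
    moreover have "d * (t * a) - c * (t * b) = t * (a * d - b * c)"
      by (simp add: algebra_simps)
    moreover have "[t * (a * d - b * c) = t * 1] (mod int q)"
      using det by (intro cong_mult cong_refl)
    ultimately have t: "int q dvd t"
      by (simp add: cong_def flip: cong_0_iff)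
    \<comment> \<open>Otherwise a * a would be -1 modulo p.\<close>
    have "\<not> int p dvd c"
    proof
      assume "int p dvd c"
      then have "[b * c = 0] (mod int p)"
        by (simp add: cong_0_iff)
      then have "[a * a + b * c - b * c = -1 - 0] (mod int p)"
        using cong_q_imp_p[OF sq(1)] e by (intro cong_diff) auto
      then show False
        using minus_1_not_square[of a] by (simp add: power2_eq_square)
    qed
    then obtain y \<delta> where y: "[c * y ^ 2 = \<delta>] (mod int q)" and \<delta>: "\<delta> = 1 \<or> \<delta> = -1"
      by (rule unit_times_square)
    have d2: "\<delta> * \<delta> = 1"
      using \<delta> by auto
    \<comment> \<open>The factor (1, -a/c, 0, 1) clears the upper left entry by means of the unit
      \<open>c\<close>; then diag(1/y, y) scales the lower left entry to c y^2 =
      \<open>\<delta>\<close>. Here 1/y is written as \<open>\<delta> * c * y\<close>.\<close>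
    define h where "h = smat q (\<delta> * c * y) (- (\<delta> * a * y)) 0 y"
    have "[\<delta> * (c * y ^ 2) = \<delta> * \<delta>] (mod int q)"
      using y by (intro cong_mult cong_refl)
    then have hdet: "[\<delta> * c * y * y - (- (\<delta> * a * y)) * 0 = 1] (mod int q)"
      by (simp add: d2 power2_eq_square mult.assoc)
    have h: "h \<in> carrier (SL2 q)"
      using hdet by (simp add: h_def smat_in_SL2[OF q1])
    define b' where "b' = \<delta> * \<delta> * (c * y ^ 2 * (a * a + b * c) - a * c * y ^ 2 * t)"
    interpret group "SL2 q" by (rule group_SL2[OF q1])
    have "h \<otimes>\<^bsub>SL2 q\<^esub> x \<otimes>\<^bsub>SL2 q\<^esub> inv\<^bsub>SL2 q\<^esub> h = smat q 0 b' (c * y ^ 2) (\<delta> * c * y ^ 2 * t)"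
      unfolding h_def x_eq smat_conj[OF hdet]
      by (rule arg_cong4[where f = "smat q"]) (simp_all add: b'_def t_def power2_eq_square algebra_simps)
    moreover have "h \<otimes>\<^bsub>SL2 q\<^esub> x \<otimes>\<^bsub>SL2 q\<^esub> inv\<^bsub>SL2 q\<^esub> h \<in> carrier (SL2 q)"
      using h x(1) by simp
    moreover have "[c * y ^ 2 * (a * a + b * c) - a * c * y ^ 2 * t = \<delta> * (-1) - 0] (mod int q)"
      using sq(1) e y t by (intro cong_diff cong_mult) (auto simp: cong_0_iff)
    then have "root_unity b'"
      using \<delta> root_unity_cong[of b' "- \<delta>"] by (auto simp: b'_def d2)
    moreover have "P dvd \<delta> * c * y ^ 2 * t"
      using P_dvd_q t dvd_trans by fastforce
    ultimately show ?thesis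
      using h by (intro bexI[of _ h]) (simp_all add: smat_in_stab_lift smat_in_SL2[OF q1])
  qed
qed

end

section \<open>The degree\<close>

lemma card_multiples_below:
  fixes d e :: nat
  assumes "d > 0"
  shows "card {x \<in> {0..<int (d * e)}. int d dvd x} = e"
proof -
  have "{x \<in> {0..<int (d * e)}. int d dvd x} = (\<lambda>i. int d * i) ` {0..<int e}"
    using assms by (auto simp: dvd_def image_iff zero_le_mult_iff)
  moreover have "inj_on (\<lambda>i. int d * i) {0..<int e}"
    using assms by (auto simp: inj_on_def)
  ultimately show ?thesis
    by (simp add: card_image)
qed

context mersenne_power
begin

lemma cong_imp_eq_below: "[x = y] (mod int q) \<Longrightarrow> x \<in> {0..<int q} \<Longrightarrow> y \<in> {0..<int q} \<Longrightarrow> x = y"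
  by (simp add: cong_def)

lemma card_multiples_p: "card {x \<in> {0..<int q}. int p dvd x} = p ^ (k - 1)"
proof -
  have "q = p * p ^ (k - 1)"
    using k2 by (simp add: q_def power_eq_if)
  then show ?thesis
    using card_multiples_below[of p "p ^ (k - 1)"] p7 by simp
qed

lemma card_multiples_P: "card {x \<in> {0..<int q}. P dvd x} = p"
proof -
  have "q = p ^ (k - 1) * p"
    using k2 by (simp add: q_def power_eq_if)
  then show ?thesis
    using card_multiples_below[of "p ^ (k - 1)" p] p7 by (simp add: P_def)
qed

lemma card_units_q: "card {x \<in> {0..<int q}. \<not> int p dvd x} = p ^ (k - 1) * (p - 1)"
proof -
  have "{x \<in> {0..<int q}. \<not> int p dvd x} = {0..<int q} - {x \<in> {0..<int q}. int p dvd x}"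
    by auto
  moreover have "card ({0..<int q} - {x \<in> {0..<int q}. int p dvd x}) = card {0..<int q} - card {x \<in> {0..<int q}. int p dvd x}"
    by (intro card_Diff_subset) (auto intro: finite_subset[of _ "{0..<int q}"])
  ultimately have "card {x \<in> {0..<int q}. \<not> int p dvd x} = q - p ^ (k - 1)"
    by (simp only: card_multiples_p) simp
  also have "\<dots> = p ^ (k - 1) * (p - 1)"
  proof -
    have "q = p ^ (k - 1) * p"
      using k2 by (simp add: q_def power_eq_if)
    then show ?thesis
      by (simp add: diff_mult_distrib2)
  qed
  finally show ?thesis .
qed

lemma card_root_unity: "card {x \<in> {0..<int q}. root_unity x} = p - 1"
proof -
  obtain E where E: "\<And>i j. [E i * E j = E (i + j)] (mod int q)"
    "\<And>i. [E i = 1] (mod int q) \<longleftrightarrow> int (p - 1) dvd i" "E 0 = 1"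
    "\<And>x. [x ^ (p - 1) = 1] (mod int q) \<longleftrightarrow> (\<exists>i. [x = E i] (mod int q))"
    by (rule roots_of_unity_parametrization) blast
  have eq: "[E i = E j] (mod int q) \<longleftrightarrow> int (p - 1) dvd i - j" for i j
  proof
    assume "[E i = E j] (mod int q)"
    then have "[E i * E (- j) = E j * E (- j)] (mod int q)"
      by (intro cong_mult cong_refl)
    then have "[E (i - j) = 1] (mod int q)"
      using E(1)[of i "- j"] E(1)[of j "- j"] E(3) by (simp add: cong_def)
    then show "int (p - 1) dvd i - j"
      using E(2) by simp
  next
    assume "int (p - 1) dvd i - j"
    then have "[E (i - j) * E j = 1 * E j] (mod int q)"
      using E(2) by (intro cong_mult cong_refl) simp
    then show "[E i = E j] (mod int q)"
      using E(1)[of "i - j" j] by (simp add: cong_def)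
  qed
  have "{x \<in> {0..<int q}. root_unity x} = (\<lambda>i. E i mod int q) ` {0..<int (p - 1)}"
  proof (intro equalityI subsetI)
    fix x assume x: "x \<in> {x \<in> {0..<int q}. root_unity x}"
    then obtain i where "[x = E i] (mod int q)"
      using E(4) by (auto simp: root_unity_def)
    moreover have "[E i = E (i mod int (p - 1))] (mod int q)"
      unfolding eq by (simp add: minus_mod_eq_mult_div)
    ultimately have "[x = E (i mod int (p - 1))] (mod int q)"
      by (rule cong_trans)
    then have "x = E (i mod int (p - 1)) mod int q"
      using x by (simp add: cong_def)
    moreover have "i mod int (p - 1) \<in> {0..<int (p - 1)}"
      using p7 by simp
    ultimately show "x \<in> (\<lambda>i. E i mod int q) ` {0..<int (p - 1)}"
      by blast
  next
    fix x assume "x \<in> (\<lambda>i. E i mod int q) ` {0..<int (p - 1)}"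
    moreover have "root_unity (E i)" for i
      unfolding root_unity_def E(4) by (blast intro: cong_refl)
    ultimately show "x \<in> {x \<in> {0..<int q}. root_unity x}"
      using q1 by auto
  qed
  moreover have "inj_on (\<lambda>i. E i mod int q) {0..<int (p - 1)}"
  proof (rule inj_onI)
    fix i j assume ij: "i \<in> {0..<int (p - 1)}" "j \<in> {0..<int (p - 1)}" "E i mod int q = E j mod int q"
    then have "[i = j] (mod int (p - 1))"
      using eq by (simp add: cong_def[symmetric] cong_iff_dvd_diff)
    then show "i = j"
      using ij by (simp add: cong_def)
  qed
  ultimately show ?thesis
    by (simp add: card_image)
qed

text \<open>With \<open>a\<close> as a unit pivot, the entries \<open>b\<close> and \<open>c\<close>
  are free and the determinant determines \<open>d\<close>. The next lemma uses \<open>b\<close> as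
  pivot instead.\<close>

lemma card_SL2_unit_a:
  assumes U: "U \<subseteq> {x \<in> {0..<int q}. \<not> int p dvd x}" and B: "B \<subseteq> {0..<int q}" and C: "C \<subseteq> {0..<int q}"
  shows "card {(a, b, c, d) \<in> carrier (SL2 q). a \<in> U \<and> b \<in> B \<and> c \<in> C} = card U * (card B * card C)"
proof -
  let ?S = "{(a, b, c, d) \<in> carrier (SL2 q). a \<in> U \<and> b \<in> B \<and> c \<in> C}"
  have "bij_betw (\<lambda>(a, b, c, d). (a, b, c)) ?S (U \<times> B \<times> C)"
  proof (rule bij_betwI')
    fix x y assume xy: "x \<in> ?S" "y \<in> ?S"
    obtain a b c d a' b' c' d' where [simp]: "x = (a, b, c, d)" "y = (a', b', c', d')"
      by (metis surj_pair)
    have "d = d'" if [simp]: "a' = a" "b' = b" "c' = c"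
    proof (rule cong_imp_eq_below)
      have "[a * d - b * c = 1] (mod int q)" "[a * d' - b * c = 1] (mod int q)"
        using xy q1 by (auto simp: SL2_def cong_def)
      then have "[a * d - b * c = a * d' - b * c] (mod int q)"
        by (simp add: cong_def)
      from cong_add[OF this cong_refl[of "b * c"]] have "[a * d = a * d'] (mod int q)"
        by simp
      moreover have "coprime a (int q)"
        using xy U by (auto simp: coprime_q_iff)
      ultimately show "[d = d'] (mod int q)"
        by (simp add: cong_mult_lcancel)
    qed (use xy in \<open>auto simp: SL2_def\<close>)
    then show "((case x of (a, b, c, d) \<Rightarrow> (a, b, c)) = (case y of (a, b, c, d) \<Rightarrow> (a, b, c))) = (x = y)"
      by auto
  next
    fix y assume "y \<in> U \<times> B \<times> C"
    then obtain a b c where y: "y = (a, b, c)" "a \<in> U" "b \<in> B" "c \<in> C"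
      by auto
    then obtain z where "[a * z = 1] (mod int q)"
      using U inverse_mod_q by blast
    then have "[a * z * (1 + b * c) = 1 * (1 + b * c)] (mod int q)"
      by (intro cong_mult cong_refl)
    then have "[a * (z * (1 + b * c)) - b * c = (1 + b * c) - b * c] (mod int q)"
      by (intro cong_diff cong_refl) (simp add: mult.assoc)
    then have "smat q a b c (z * (1 + b * c)) \<in> carrier (SL2 q)"
      by (simp add: smat_in_SL2[OF q1])
    moreover have "smat q a b c (z * (1 + b * c)) = (a, b, c, z * (1 + b * c) mod int q)"
      using y U B C by (auto simp: smat_def subset_iff)
    ultimately show "\<exists>x\<in>?S. y = (case x of (a, b, c, d) \<Rightarrow> (a, b, c))"
      using y by (intro bexI[of _ "(a, b, c, z * (1 + b * c) mod int q)"]) auto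
  qed auto
  then show ?thesis
    by (simp only: bij_betw_same_card card_cartesian_product)
qed

lemma card_SL2_unit_b:
  assumes A: "A \<subseteq> {0..<int q}" and U: "U \<subseteq> {x \<in> {0..<int q}. \<not> int p dvd x}" and D: "D \<subseteq> {0..<int q}"
  shows "card {(a, b, c, d) \<in> carrier (SL2 q). a \<in> A \<and> b \<in> U \<and> d \<in> D} = card A * (card U * card D)"
proof -
  let ?S = "{(a, b, c, d) \<in> carrier (SL2 q). a \<in> A \<and> b \<in> U \<and> d \<in> D}"
  have "bij_betw (\<lambda>(a, b, c, d). (a, b, d)) ?S (A \<times> U \<times> D)"
  proof (rule bij_betwI')
    fix x y assume xy: "x \<in> ?S" "y \<in> ?S"
    obtain a b c d a' b' c' d' where [simp]: "x = (a, b, c, d)" "y = (a', b', c', d')"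
      by (metis surj_pair)
    have "c = c'" if [simp]: "a' = a" "b' = b" "d' = d"
    proof (rule cong_imp_eq_below)
      have "[a * d - b * c = 1] (mod int q)" "[a * d - b * c' = 1] (mod int q)"
        using xy q1 by (auto simp: SL2_def cong_def)
      then have "[a * d - b * c = a * d - b * c'] (mod int q)"
        by (simp add: cong_def)
      from cong_diff[OF cong_refl[of "a * d"] this] have "[b * c = b * c'] (mod int q)"
        by simp
      moreover have "coprime b (int q)"
        using xy U by (auto simp: coprime_q_iff)
      ultimately show "[c = c'] (mod int q)"
        by (simp add: cong_mult_lcancel)
    qed (use xy in \<open>auto simp: SL2_def\<close>)
    then show "((case x of (a, b, c, d) \<Rightarrow> (a, b, d)) = (case y of (a, b, c, d) \<Rightarrow> (a, b, d))) = (x = y)"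
      by auto
  next
    fix y assume "y \<in> A \<times> U \<times> D"
    then obtain a b d where y: "y = (a, b, d)" "a \<in> A" "b \<in> U" "d \<in> D"
      by auto
    then obtain z where "[b * z = 1] (mod int q)"
      using U inverse_mod_q by blast
    then have "[b * z * (a * d - 1) = 1 * (a * d - 1)] (mod int q)"
      by (intro cong_mult cong_refl)
    then have "[a * d - b * (z * (a * d - 1)) = a * d - (a * d - 1)] (mod int q)"
      by (intro cong_diff cong_refl) (simp add: mult.assoc)
    then have "smat q a b (z * (a * d - 1)) d \<in> carrier (SL2 q)"
      by (simp add: smat_in_SL2[OF q1])
    moreover have "smat q a b (z * (a * d - 1)) d = (a, b, z * (a * d - 1) mod int q, d)"
      using y U A D by (auto simp: smat_def subset_iff)
    ultimately show "\<exists>x\<in>?S. y = (case x of (a, b, c, d) \<Rightarrow> (a, b, d))"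
      using y by (intro bexI[of _ "(a, b, z * (a * d - 1) mod int q, d)"]) auto
  qed auto
  then show ?thesis
    by (simp only: bij_betw_same_card card_cartesian_product)
qed

text \<open>The first row of a matrix of determinant 1 contains a unit, so counting splits according
  to whether \<open>a\<close> is one.\<close>

lemma card_SL2_q: "card (carrier (SL2 q)) = (p ^ (k - 1)) ^ 3 * (p * ((p - 1) * (p + 1)))"
proof -
  let ?U = "{x \<in> {0..<int q}. \<not> int p dvd x}" and ?M = "{x \<in> {0..<int q}. int p dvd x}" and ?Q = "{0..<int q}"
  let ?S = "{(a, b, c, d) \<in> carrier (SL2 q). a \<in> ?U \<and> b \<in> ?Q \<and> c \<in> ?Q}"
  let ?T = "{(a, b, c, d) \<in> carrier (SL2 q). a \<in> ?M \<and> b \<in> ?U \<and> d \<in> ?Q}"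
  have "carrier (SL2 q) \<subseteq> ?S \<union> ?T"
  proof
    fix x assume x: "x \<in> carrier (SL2 q)"
    then obtain a b c d where *: "x = (a, b, c, d)" "[a * d - b * c = 1] (mod int q)"
      "a \<in> ?Q" "b \<in> ?Q" "c \<in> ?Q" "d \<in> ?Q"
      by (rule SL2_cases[OF q1])
    have "\<not> (int p dvd a \<and> int p dvd b)"
    proof
      assume "int p dvd a \<and> int p dvd b"
      then have "int p dvd a * d - b * c"
        by simp
      then have "int p dvd 1"
        using cong_q_imp_p[OF *(2)] cong_dvd_iff by blast
      then show False
        using p7 by simp
    qed
    then show "x \<in> ?S \<union> ?T"
      using x * by auto
  qed
  then have "carrier (SL2 q) = ?S \<union> ?T"
    by blast
  moreover have "?S \<inter> ?T = {}"
    by auto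
  moreover have "finite ?S" "finite ?T"
    using finite_SL2[OF q1] by (auto intro: finite_subset[rotated])
  ultimately have "card (carrier (SL2 q)) = card ?S + card ?T"
    by (metis (no_types, lifting) card_Un_disjoint)
  also have "\<dots> = p ^ (k - 1) * (p - 1) * (q * q) + p ^ (k - 1) * (p ^ (k - 1) * (p - 1) * q)"
  proof -
    have "card ?S = card ?U * (card ?Q * card ?Q)" "card ?T = card ?M * (card ?U * card ?Q)"
      by ((rule card_SL2_unit_a card_SL2_unit_b; blast)+)
    then show ?thesis
      by (simp only: card_units_q card_multiples_p card_atLeastLessThan_int) simp
  qed
  also have "\<dots> = (p ^ (k - 1)) ^ 3 * (p * ((p - 1) * (p + 1)))"
  proof -
    have "q = p * p ^ (k - 1)"
      using k2 by (simp add: q_def power_eq_if)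
    then show ?thesis
      by (simp add: power3_eq_cube algebra_simps)
  qed
  finally show ?thesis .
qed

lemma card_stab_lift: "card stab_lift = 2 * (p - 1) * p ^ 2"
proof -
  let ?U = "{x \<in> {0..<int q}. root_unity x}" and ?M = "{x \<in> {0..<int q}. P dvd x}"
  let ?S = "{(a, b, c, d) \<in> carrier (SL2 q). a \<in> ?U \<and> b \<in> ?M \<and> c \<in> ?M}"
  let ?T = "{(a, b, c, d) \<in> carrier (SL2 q). a \<in> ?M \<and> b \<in> ?U \<and> d \<in> ?M}"
  have U: "?U \<subseteq> {x \<in> {0..<int q}. \<not> int p dvd x}"
    using root_unity_not_dvd by blast
  have "stab_lift = ?S \<union> ?T"
    unfolding stab_lift_def by (auto simp: SL2_def)
  moreover have "?S \<inter> ?T = {}"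
    using root_unity_not_dvd p_dvd_P dvd_trans by blast
  moreover have "finite ?S" "finite ?T"
    using finite_SL2[OF q1] by (auto intro: finite_subset[rotated])
  ultimately have "card stab_lift = card ?S + card ?T"
    by (metis (no_types, lifting) card_Un_disjoint)
  also have "\<dots> = (p - 1) * (p * p) + p * ((p - 1) * p)"
  proof -
    have "card ?S = card ?U * (card ?M * card ?M)" "card ?T = card ?M * (card ?U * card ?M)"
      by ((rule card_SL2_unit_a[OF U] card_SL2_unit_b[OF _ U]; blast)+)
    then show ?thesis
      by (simp only: card_root_unity card_multiples_P)
  qed
  finally show ?thesis
    by (simp add: power2_eq_square)
qed

text \<open>The degree is defined with truncating division; it is exact because \<open>p + 1\<close>
  is even.\<close>

lemma double_degree: "2 * (p ^ (3 * k - 4) * (p + 1) div 2) = p ^ (3 * k - 4) * (p + 1)"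
  using odd_p by simp

lemma card_rcosets_stab_lift:
  "card (rcosets\<^bsub>SL2 q\<^esub> stab_lift) = p ^ (3 * k - 4) * (p + 1) div 2"
proof -
  let ?n = "p ^ (3 * k - 4) * (p + 1) div 2"
  interpret group "SL2 q" by (rule group_SL2[OF q1])
  \<comment> \<open>The subtraction in \<open>3 * k - 4\<close> is not truncated since
    \<open>k \<ge> 2\<close>. The extra factor p combines with the p in the order of SL_2(p) to
    match p^2 in \<open>card stab_lift\<close>.\<close>
  have "3 * (k - 1) = 3 * k - 4 + 1"
    using k2 by simp
  then have "(p ^ (k - 1)) ^ 3 = p ^ (3 * k - 4) * p"
    by (metis mult.commute power_add power_mult power_one_right)
  then have "order (SL2 q) = (p ^ (3 * k - 4) * (p + 1)) * ((p - 1) * p ^ 2)"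
    unfolding order_def card_SL2_q by (simp only: power2_eq_square mult_ac)
  also have "\<dots> = ?n * card stab_lift"
    unfolding card_stab_lift by (metis double_degree mult.assoc mult.commute)
  finally have "card (rcosets\<^bsub>SL2 q\<^esub> stab_lift) * card stab_lift = ?n * card stab_lift"
    using lagrange[OF subgroup_stab_lift] by simp
  moreover have "card stab_lift > 0"
    using p7 by (simp add: card_stab_lift)
  ultimately show ?thesis
    by simp
qed

end

section \<open>Congruence subgroups and their factors\<close>

definition reduce :: "nat \<Rightarrow> int \<times> int \<times> int \<times> int \<Rightarrow> int \<times> int \<times> int \<times> int" where
  "reduce r = (\<lambda>(a, b, c, d). smat r a b c d)"

lemma reduce_smat:
  assumes "r dvd q"
  shows "reduce r (smat q a b c d) = smat r a b c d"
proof -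
  have "int r dvd int q"
    using assms by simp
  then show ?thesis
    by (simp add: reduce_def smat_def mod_mod_cancel)
qed

lemma reduce_hom:
  assumes "r > 1" "r dvd q" "q > 1"
  shows "reduce r \<in> hom (SL2 q) (SL2 r)"
proof (rule homI)
  fix x y assume xy: "x \<in> carrier (SL2 q)" "y \<in> carrier (SL2 q)"
  obtain a b c d where x: "x = smat q a b c d" "[a * d - b * c = 1] (mod int q)"
    using SL2_cases[OF assms(3) xy(1)] by metis
  obtain a' b' c' d' where y: "y = smat q a' b' c' d'"
    using SL2_cases[OF assms(3) xy(2)] by metis
  show "reduce r x \<in> carrier (SL2 r)"
    using x(2) assms cong_dvd_modulus[of _ _ "int q" "int r"] by (simp add: x(1) reduce_smat smat_in_SL2)
  show "reduce r (x \<otimes>\<^bsub>SL2 q\<^esub> y) = reduce r x \<otimes>\<^bsub>SL2 r\<^esub> reduce r y"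
    using assms by (simp add: x(1) y reduce_smat smat_mult)
qed

lemma group_elem_ab: "group (elem_ab p n)"
  by (simp add: elem_ab_def)

context mersenne_power
begin

lemma p_gt_1: "p > 1"
  using p7 by simp

lemma p_power_gt_1: "l \<ge> 1 \<Longrightarrow> p ^ l > 1"
  using p7 by (intro one_less_power) auto

lemma p_power_dvd_q: "l \<le> k \<Longrightarrow> p ^ l dvd q"
  by (simp add: q_def le_imp_power_dvd)

text \<open>Normality comes from this description. The bound \<open>1 \<le> l\<close> matters: for
  modulus 1 the condition \<open>mod 1 = 1\<close> leaves \<open>SL2\<close> with an empty
  carrier.\<close>

lemma congr_sub_eq_kernel:
  assumes "1 \<le> l" "l \<le> k"
  shows "congr_sub l = kernel (SL2 q) (SL2 (p ^ l)) (reduce (p ^ l))"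
proof -
  have "x \<in> congr_sub l \<longleftrightarrow> reduce (p ^ l) x = \<one>\<^bsub>SL2 (p ^ l)\<^esub>" if xc: "x \<in> carrier (SL2 q)" for x
  proof -
    obtain a b c d where x: "x = smat q a b c d" "[a * d - b * c = 1] (mod int q)"
      using SL2_cases[OF q1 xc] by metis
    show ?thesis
      using x(2) unfolding x(1) one_SL2[OF p_power_gt_1[OF assms(1)]] reduce_smat[OF p_power_dvd_q[OF assms(2)]]
      by (simp add: smat_in_congr_sub[OF assms(2)] smat_eq_iff cong_iff_dvd_diff)
  qed
  moreover have "congr_sub l \<subseteq> carrier (SL2 q)"
    by (auto simp: congr_sub_def)
  ultimately show ?thesis
    by (auto simp: kernel_def)
qed

lemma group_hom_reduce:
  assumes "1 \<le> l" "l \<le> k"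
  shows "group_hom (SL2 q) (SL2 (p ^ l)) (reduce (p ^ l))"
  using reduce_hom[OF p_power_gt_1[OF assms(1)] p_power_dvd_q[OF assms(2)] q1]
    group_SL2[OF q1] group_SL2[OF p_power_gt_1[OF assms(1)]]
  by (simp add: group_hom_def group_hom_axioms_def)

lemma normal_congr_sub: "1 \<le> l \<Longrightarrow> l \<le> k \<Longrightarrow> congr_sub l \<lhd> SL2 q"
  using group_hom.normal_kernel[OF group_hom_reduce] congr_sub_eq_kernel by metis

lemma subgroup_congr_sub: "1 \<le> l \<Longrightarrow> l \<le> k \<Longrightarrow> subgroup (congr_sub l) (SL2 q)"
  using normal_congr_sub normal_imp_subgroup by blast

lemma congr_sub_mono: "l \<le> l' \<Longrightarrow> congr_sub l' \<subseteq> congr_sub l"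
  using dvd_trans[OF le_imp_power_dvd[of l l' "int p"]] by (auto simp: congr_sub_def)

text \<open>The signs differ by 2, a unit modulo p. Hence \<open>\<Phi>\<close> will be injective on
  every congruence subgroup of positive level.\<close>

lemma congr_sub_center:
  assumes "1 \<le> l" "x \<in> congr_sub l" "x \<in> SL2_center q"
  shows "x = \<one>\<^bsub>SL2 q\<^esub>"
proof -
  have "x \<noteq> smat q (-1) 0 0 (-1)"
  proof
    assume "x = smat q (-1) 0 0 (-1)"
    moreover have "x \<in> congr_sub 1"
      using assms congr_sub_mono by blast
    ultimately have "int p dvd - 2"
      using k2 by (simp add: smat_in_congr_sub)
    then show False
      using p7 by (simp add: zdvd_not_zless)
  qed
  then show ?thesis
    using assms(3) by (auto simp: SL2_center_eq[OF q1] one_SL2[OF q1])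
qed

lemma congr_sub_k: "congr_sub k = {\<one>\<^bsub>SL2 q\<^esub>}"
proof
  show "congr_sub k \<subseteq> {\<one>\<^bsub>SL2 q\<^esub>}"
  proof
    fix x assume x: "x \<in> congr_sub k"
    then have "x \<in> carrier (SL2 q)"
      by (auto simp: congr_sub_def)
    then obtain a b c d where "x = smat q a b c d"
      using SL2_cases[OF q1] by metis
    then show "x \<in> {\<one>\<^bsub>SL2 q\<^esub>}"
      using x by (simp add: smat_in_congr_sub one_SL2[OF q1] smat_eq_iff cong_iff_dvd_diff int_q)
  qed
  show "{\<one>\<^bsub>SL2 q\<^esub>} \<subseteq> congr_sub k"
    by (simp add: one_SL2[OF q1] smat_in_congr_sub)
qed

section \<open>Base p digits and the factors of the congruence filtration\<close>

definition digit :: "nat \<Rightarrow> int \<Rightarrow> int" where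
  "digit l x = x div int p ^ l mod int p"

lemma digit_range: "digit l x \<in> {0..<int p}"
  using p7 by (simp add: digit_def)

lemma digit_cong:
  assumes "[x = y] (mod int p ^ Suc l)"
  shows "digit l x = digit l y"
proof -
  have "x mod (int p ^ l * int p) div int p ^ l = digit l x" for x
    using p7 unfolding zmod_zmult2_eq[OF of_nat_0_le_iff] by (simp add: digit_def)
  then show ?thesis
    using assms by (metis cong_def mult.commute power_Suc)
qed

lemma digit_add:
  assumes "int p ^ l dvd x" "int p ^ l dvd y"
  shows "digit l (x + y) = (digit l x + digit l y) mod int p"
  using assms by (simp add: digit_def div_plus_div_distrib_dvd_left mod_simps)

lemma digit_eq_0_iff:
  assumes "int p ^ l dvd x"
  shows "digit l x = 0 \<longleftrightarrow> int p ^ Suc l dvd x"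
proof -
  obtain y where "x = int p ^ l * y"
    using assms ..
  then show ?thesis
    using p7 by (simp add: digit_def mult.commute[of "int p"] mod_eq_0_iff_dvd)
qed

lemma digit_pow_mult: "y \<in> {0..<int p} \<Longrightarrow> digit l (int p ^ l * y) = y"
  using p7 by (simp add: digit_def)

text \<open>The order of the entries lets one map serve twice: \<open>n = 3\<close> for the factors
  of the chain, and \<open>n = 2\<close>, with only \<open>b\<close> and \<open>c\<close>, for the
  normal part of the stabilizer.\<close>

definition entry_digits :: "nat \<Rightarrow> nat \<Rightarrow> int \<times> int \<times> int \<times> int \<Rightarrow> nat \<Rightarrow> int" where
  "entry_digits n l = (\<lambda>(a, b, c, d). \<lambda>i\<in>{..<n}. digit l ([b, c, a - 1] ! i))"

lemma entry_digits_smat: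
  assumes "n \<le> 3" "l < k"
  shows "entry_digits n l (smat q a b c d) = (\<lambda>i\<in>{..<n}. digit l ([b, c, a - 1] ! i))"
proof -
  have "int p ^ Suc l dvd int q"
    using pow_dvd_q[of "Suc l"] assms by simp
  then have "[x mod int q - y = x - y] (mod int p ^ Suc l)" for x y
    using cong_mod_dvd_iff by (intro cong_diff cong_refl) simp
  then have "digit l (x mod int q - y) = digit l (x - y)" for x y
    by (rule digit_cong)
  from this[of _ 0] this[of _ 1]
  have "digit l ([b mod int q, c mod int q, a mod int q - 1] ! i) = digit l ([b, c, a - 1] ! i)" if "i < n" for i
    using that assms(1) by (auto simp: nth_Cons' less_Suc_eq numeral_3_eq_3)
  then show ?thesis
    by (auto simp: entry_digits_def smat_def)
qed

lemma entry_digits_carrier: "n \<le> 3 \<Longrightarrow> entry_digits n l x \<in> carrier (elem_ab p n)"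
  using digit_range p7 by (cases x) (auto simp: entry_digits_def elem_ab_def carrier_integer_mod_group)

text \<open>In (1 + X)(1 + Y) = 1 + X + Y + XY the last term is divisible by p^(2l), and
  \<open>2 * l \<ge> Suc l\<close>; so digit \<open>l\<close> is additive.\<close>

lemma entry_digits_hom:
  assumes n: "n \<le> 3" and l: "1 \<le> l" "l < k"
  shows "entry_digits n l \<in> hom (SL2 q\<lparr>carrier := congr_sub l\<rparr>) (elem_ab p n)"
proof (rule homI)
  show "entry_digits n l x \<in> carrier (elem_ab p n)" for x
    using n by (rule entry_digits_carrier)
  fix x y assume xy: "x \<in> carrier (SL2 q\<lparr>carrier := congr_sub l\<rparr>)" "y \<in> carrier (SL2 q\<lparr>carrier := congr_sub l\<rparr>)"
  then have "x \<in> carrier (SL2 q)" "y \<in> carrier (SL2 q)"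
    by (auto simp: congr_sub_def)
  then obtain a b c d a' b' c' d' where e: "x = smat q a b c d" "y = smat q a' b' c' d'"
    by (elim SL2_cases[OF q1])
  have x: "int p ^ l dvd a - 1" "int p ^ l dvd b" "int p ^ l dvd c" "int p ^ l dvd d - 1"
    and y: "int p ^ l dvd a' - 1" "int p ^ l dvd b'" "int p ^ l dvd c'" "int p ^ l dvd d' - 1"
    using xy l by (simp_all add: e smat_in_congr_sub)
  have dvd2: "int p ^ Suc l dvd u * v" if "int p ^ l dvd u" "int p ^ l dvd v" for u v
  proof -
    have "int p ^ Suc l dvd int p ^ (l + l)"
      using l by (intro le_imp_power_dvd) simp
    then show ?thesis
      unfolding power_add using mult_dvd_mono[OF that] by (rule dvd_trans)
  qed
  have cong: "[u + w = v] (mod int p ^ Suc l)" if "u = v" "int p ^ Suc l dvd w" for u v w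
    using that by (simp add: cong_iff_dvd_diff)
  have "digit l (a * b' + b * d') = (digit l b + digit l b') mod int p"
  proof -
    have "a * b' + b * d' = (b + b') + ((a - 1) * b' + b * (d' - 1))"
      by (simp add: algebra_simps)
    then have "digit l (a * b' + b * d') = digit l (b + b')"
      using cong[OF refl] dvd2 x y by (intro digit_cong) (simp only: dvd_add)
    then show ?thesis
      using digit_add x y by simp
  qed
  moreover have "digit l (c * a' + d * c') = (digit l c + digit l c') mod int p"
  proof -
    have "c * a' + d * c' = (c + c') + (c * (a' - 1) + (d - 1) * c')"
      by (simp add: algebra_simps)
    then have "digit l (c * a' + d * c') = digit l (c + c')"
      using cong[OF refl] dvd2 x y by (intro digit_cong) (simp only: dvd_add)
    then show ?thesis
      using digit_add x y by simp
  qed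
  moreover have "digit l (a * a' + b * c' - 1) = (digit l (a - 1) + digit l (a' - 1)) mod int p"
  proof -
    have "a * a' + b * c' - 1 = ((a - 1) + (a' - 1)) + ((a - 1) * (a' - 1) + b * c')"
      by (simp add: algebra_simps)
    then have "digit l (a * a' + b * c' - 1) = digit l ((a - 1) + (a' - 1))"
      using cong[OF refl] dvd2 x y by (intro digit_cong) (simp only: dvd_add)
    then show ?thesis
      using digit_add[OF x(1) y(1)] by simp
  qed
  ultimately have "digit l ([a * b' + b * d', c * a' + d * c', a * a' + b * c' - 1] ! i) =
      (digit l ([b, c, a - 1] ! i) + digit l ([b', c', a' - 1] ! i)) mod int p" if "i < n" for i
    using that n by (auto simp: nth_Cons' less_Suc_eq numeral_3_eq_3)
  then show "entry_digits n l (x \<otimes>\<^bsub>SL2 q\<lparr>carrier := congr_sub l\<rparr>\<^esub> y) =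
      entry_digits n l x \<otimes>\<^bsub>elem_ab p n\<^esub> entry_digits n l y"
    using n l by (auto simp: e smat_mult entry_digits_smat elem_ab_def)
qed

lemma entry_digits_eq_one_iff:
  assumes "n \<le> 3" "1 \<le> l" "l < k" "smat q a b c d \<in> congr_sub l"
  shows "entry_digits n l (smat q a b c d) = \<one>\<^bsub>elem_ab p n\<^esub> \<longleftrightarrow>
    (\<forall>i<n. int p ^ Suc l dvd [b, c, a - 1] ! i)"
proof -
  have "int p ^ l dvd [b, c, a - 1] ! i" if "i < n" for i
    using that assms by (auto simp: smat_in_congr_sub nth_Cons' less_Suc_eq numeral_3_eq_3)
  then have "digit l ([b, c, a - 1] ! i) = 0 \<longleftrightarrow> int p ^ Suc l dvd [b, c, a - 1] ! i" if "i < n" for i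
    using that digit_eq_0_iff by blast
  then show ?thesis
    using assms by (auto simp: entry_digits_smat elem_ab_def fun_eq_iff restrict_def)
qed

text \<open>The determinant controls the fourth entry, which is why the factors have rank three and
  not four.\<close>

lemma dvd_last_entry:
  assumes "n dvd int q" "[a * d - b * c = 1] (mod int q)" "n dvd a - 1" "n dvd b"
  shows "n dvd d - 1"
proof -
  have "n dvd a * d - b * c - 1"
    using assms(1,2) dvd_trans unfolding cong_iff_dvd_diff by blast
  then have "n dvd (a * d - b * c - 1) + b * c - (a - 1) * d"
    by (rule dvd_diff[OF dvd_add[OF _ dvd_mult2[OF assms(4)]] dvd_mult2[OF assms(3)]])
  then show ?thesis
    by (simp add: algebra_simps)
qed

lemma kernel_entry_digits:
  assumes l: "1 \<le> l" "l < k"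
  shows "kernel (SL2 q\<lparr>carrier := congr_sub l\<rparr>) (elem_ab p 3) (entry_digits 3 l) = congr_sub (Suc l)"
proof -
  have "entry_digits 3 l x = \<one>\<^bsub>elem_ab p 3\<^esub> \<longleftrightarrow> x \<in> congr_sub (Suc l)" if x: "x \<in> congr_sub l" for x
  proof -
    have "x \<in> carrier (SL2 q)"
      using x by (auto simp: congr_sub_def)
    then obtain a b c d where e: "x = smat q a b c d" and det: "[a * d - b * c = 1] (mod int q)"
      by (rule SL2_cases[OF q1])
    have "int p ^ Suc l dvd d - 1" if "int p ^ Suc l dvd b" "int p ^ Suc l dvd a - 1"
      using l that by (intro dvd_last_entry[OF pow_dvd_q det]) auto
    then show ?thesis
      using l x det entry_digits_eq_one_iff[of 3 l a b c d]
      by (auto simp: e smat_in_congr_sub less_Suc_eq numeral_3_eq_3)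
  qed
  moreover have "congr_sub (Suc l) \<subseteq> congr_sub l"
    by (rule congr_sub_mono) simp
  ultimately show ?thesis
    by (auto simp: kernel_def)
qed

text \<open>Three digits prescribe \<open>a\<close>, \<open>b\<close>, \<open>c\<close>. As
  \<open>a\<close> is 1 modulo p, it is a unit, so the determinant can be solved for
  \<open>d\<close>; \<open>dvd_last_entry\<close> gives \<open>d\<close> the right level.\<close>

lemma entry_digits_surj:
  assumes l: "1 \<le> l" "l < k"
  shows "entry_digits 3 l ` congr_sub l = carrier (elem_ab p 3)"
proof
  show "entry_digits 3 l ` congr_sub l \<subseteq> carrier (elem_ab p 3)"
    using entry_digits_carrier by auto
  show "carrier (elem_ab p 3) \<subseteq> entry_digits 3 l ` congr_sub l"
  proof
    fix g assume g: "g \<in> carrier (elem_ab p 3)"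
    then have gr: "g i \<in> {0..<int p}" if "i < 3" for i
      using that p7 by (auto simp: elem_ab_def carrier_integer_mod_group PiE_iff)
    define a where "a = 1 + int p ^ l * g 2"
    define b where "b = int p ^ l * g 0"
    define c where "c = int p ^ l * g 1"
    have "\<not> int p dvd a"
    proof
      assume "int p dvd a"
      moreover have "int p dvd int p ^ l * g 2"
        using l by (intro dvd_mult2 dvd_power) simp
      ultimately have "int p dvd a - int p ^ l * g 2"
        by (rule dvd_diff)
      then show False
        using p7 by (simp add: a_def)
    qed
    then obtain y where y: "[a * y = 1] (mod int q)"
      by (rule inverse_mod_q)
    define d where "d = y * (1 + b * c)"
    have "[a * y * (1 + b * c) - b * c = 1 * (1 + b * c) - b * c] (mod int q)"
      by (intro cong_diff cong_mult y cong_refl)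
    then have det: "[a * d - b * c = 1] (mod int q)"
      by (simp add: d_def mult.assoc)
    have abc: "int p ^ l dvd a - 1" "int p ^ l dvd b" "int p ^ l dvd c"
      by (simp_all add: a_def b_def c_def)
    moreover have "int p ^ l dvd d - 1"
      using l abc by (intro dvd_last_entry[OF pow_dvd_q det]) auto
    ultimately have "smat q a b c d \<in> congr_sub l"
      using det l by (simp add: smat_in_congr_sub)
    moreover have "entry_digits 3 l (smat q a b c d) = g"
    proof
      fix i
      show "entry_digits 3 l (smat q a b c d) i = g i"
        using g gr l digit_pow_mult
        by (auto simp: entry_digits_smat a_def b_def c_def elem_ab_def PiE_iff extensional_def
            nth_Cons' less_Suc_eq numeral_3_eq_3 numeral_2_eq_2)
    qed
    ultimately show "g \<in> entry_digits 3 l ` congr_sub l"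
      by blast
  qed
qed

text \<open>Being 1 modulo p rules out the antidiagonal case and forces the roots of unity on the
  diagonal to equal 1.\<close>

lemma stab_lift_congr_sub:
  "congr_sub (k - 1) \<inter> stab_lift = {smat q 1 b c 1 | b c. P dvd b \<and> P dvd c}" (is "?L = ?R")
proof
  show "?R \<subseteq> ?L"
  proof
    fix x assume "x \<in> ?R"
    then obtain b c where x: "x = smat q 1 b c 1" "P dvd b" "P dvd c"
      by blast
    then have "[1 * 1 - b * c = 1] (mod int q)"
      using q_dvd_mult_P by (simp add: cong_iff_dvd_diff)
    then show "x \<in> ?L"
      using x(2,3) smat_in_congr_sub[of "k - 1" 1 b c 1] by (simp add: x(1) smat_in_stab_lift P_def)
  qed
  show "?L \<subseteq> ?R"
  proof
    fix x assume x: "x \<in> ?L"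
    moreover have "1 \<le> k - 1"
      using k2 by simp
    ultimately have "x \<in> stab_lift" "x \<in> congr_sub 1"
      using congr_sub_mono by blast+
    from this(1) show "x \<in> ?R"
    proof (cases rule: stab_lift_cases)
      case (diag a b c d)
      have "[a = 1] (mod int p)" "[d = 1] (mod int p)"
        using \<open>x \<in> congr_sub 1\<close> k2 by (simp_all add: diag(1) smat_in_congr_sub cong_iff_dvd_diff)
      then have "x = smat q 1 b c 1"
        using root_unity_eq_1 diag by (simp add: smat_eq_iff)
      then show ?thesis
        using diag by blast
    next
      case (anti a b c d)
      have "int p dvd a - 1" "int p dvd a"
        using \<open>x \<in> congr_sub 1\<close> k2 anti(3) p_dvd_P dvd_trans by (auto simp: anti(1) smat_in_congr_sub)
      then have "int p dvd a - (a - 1)"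
        using dvd_diff by blast
      then show ?thesis
        using p7 by simp
    qed
  qed
qed

lemma entry_digits_2_surj: "entry_digits 2 (k - 1) ` (congr_sub (k - 1) \<inter> stab_lift) = carrier (elem_ab p 2)"
proof
  show "entry_digits 2 (k - 1) ` (congr_sub (k - 1) \<inter> stab_lift) \<subseteq> carrier (elem_ab p 2)"
    using entry_digits_carrier by auto
  show "carrier (elem_ab p 2) \<subseteq> entry_digits 2 (k - 1) ` (congr_sub (k - 1) \<inter> stab_lift)"
  proof
    fix g assume g: "g \<in> carrier (elem_ab p 2)"
    then have gr: "g i \<in> {0..<int p}" if "i < 2" for i
      using that p7 by (auto simp: elem_ab_def carrier_integer_mod_group PiE_iff)
    have "entry_digits 2 (k - 1) (smat q 1 (P * g 0) (P * g 1) 1) = g"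
    proof
      fix i
      show "entry_digits 2 (k - 1) (smat q 1 (P * g 0) (P * g 1) 1) i = g i"
        using g gr k2 digit_pow_mult
        by (auto simp: entry_digits_smat P_def elem_ab_def PiE_iff extensional_def
            nth_Cons' less_Suc_eq numeral_2_eq_2)
    qed
    moreover have "smat q 1 (P * g 0) (P * g 1) 1 \<in> congr_sub (k - 1) \<inter> stab_lift"
      unfolding stab_lift_congr_sub using dvd_triv_left by blast
    ultimately show "g \<in> entry_digits 2 (k - 1) ` (congr_sub (k - 1) \<inter> stab_lift)"
      by (metis imageI)
  qed
qed

text \<open>A unit of the first row modulo p is a unit modulo q. Keeping it and two further entries,
  one solves for the last one, which modulo p has to be the original entry.\<close>

lemma reduce_p_surj: "reduce p ` carrier (SL2 q) = carrier (SL2 p)"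
proof
  have pq: "p dvd q"
    using p_dvd_q by simp
  show "reduce p ` carrier (SL2 q) \<subseteq> carrier (SL2 p)"
    using reduce_hom[OF p_gt_1 pq q1] by (auto simp: hom_def)
  show "carrier (SL2 p) \<subseteq> reduce p ` carrier (SL2 q)"
  proof
    fix x assume "x \<in> carrier (SL2 p)"
    then obtain a b c d where x: "x = smat p a b c d" and det: "[a * d - b * c = 1] (mod int p)"
      using SL2_cases[OF p_gt_1] by metis
    have "\<not> int p dvd a \<or> \<not> int p dvd b"
    proof (rule ccontr)
      assume "\<not> ?thesis"
      then have "int p dvd a * d - b * c"
        by (simp add: dvd_diff)
      then have "int p dvd 1"
        using det cong_dvd_iff by blast
      then show False
        using p7 by simp
    qed
    then consider "\<not> int p dvd a" | "\<not> int p dvd b"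
      by blast
    then show "x \<in> reduce p ` carrier (SL2 q)"
    proof cases
      case 1
      then obtain y where y: "[a * y = 1] (mod int q)"
        by (rule inverse_mod_q)
      have "[a * y * (1 + b * c) - b * c = 1 * (1 + b * c) - b * c] (mod int q)"
        by (intro cong_diff cong_mult y cong_refl)
      then have "smat q a b c (y * (1 + b * c)) \<in> carrier (SL2 q)"
        by (simp add: smat_in_SL2[OF q1] mult.assoc)
      moreover have "[y * (1 + b * c) = d] (mod int p)"
      proof -
        have "[1 + b * c = (a * d - b * c) + b * c] (mod int p)"
          using det by (intro cong_add cong_refl) (rule cong_sym)
        then have "[y * (1 + b * c) = y * (a * d)] (mod int p)"
          by (intro cong_mult cong_refl) simp
        also have "[y * (a * d) = (a * y) * d] (mod int p)"
          by (simp add: mult_ac)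
        also have "[(a * y) * d = 1 * d] (mod int p)"
          using y by (intro cong_mult cong_refl cong_q_imp_p)
        finally show ?thesis
          by simp
      qed
      then have "x = reduce p (smat q a b c (y * (1 + b * c)))"
        unfolding reduce_smat[OF pq] x smat_eq_iff by (simp add: cong_sym)
      ultimately show ?thesis
        by blast
    next
      case 2
      then obtain y where y: "[b * y = 1] (mod int q)"
        by (rule inverse_mod_q)
      have "[a * d - b * y * (a * d - 1) = a * d - 1 * (a * d - 1)] (mod int q)"
        by (intro cong_diff cong_mult y cong_refl)
      then have "smat q a b (y * (a * d - 1)) d \<in> carrier (SL2 q)"
        by (simp add: smat_in_SL2[OF q1] mult.assoc)
      moreover have "[y * (a * d - 1) = c] (mod int p)"
      proof -
        have "[a * d - 1 = a * d - (a * d - b * c)] (mod int p)"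
          using det by (intro cong_diff cong_refl) (rule cong_sym)
        then have "[y * (a * d - 1) = y * (b * c)] (mod int p)"
          by (intro cong_mult cong_refl) simp
        also have "[y * (b * c) = (b * y) * c] (mod int p)"
          by (simp add: mult_ac)
        also have "[(b * y) * c = 1 * c] (mod int p)"
          using y by (intro cong_mult cong_refl cong_q_imp_p)
        finally show ?thesis
          by simp
      qed
      then have "x = reduce p (smat q a b (y * (a * d - 1)) d)"
        unfolding reduce_smat[OF pq] x smat_eq_iff by (simp add: cong_sym)
      ultimately show ?thesis
        by blast
    qed
  qed
qed

end

section \<open>The permutation group\<close>

lemma carrier_perm_grp [simp]: "carrier (perm_grp d H) = H"
  and mult_perm_grp [simp]: "x \<otimes>\<^bsub>perm_grp d H\<^esub> y = x \<circ> y"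
  and one_perm_grp [simp]: "\<one>\<^bsub>perm_grp d H\<^esub> = id"
  by (simp_all add: perm_grp_def sym_group_def)

text \<open>These are the properties of the coset action used from here on, with the core of the
  stabilizer already replaced by the signs.\<close>

locale mersenne_action = mersenne_power +
  fixes \<Phi> :: "int \<times> int \<times> int \<times> int \<Rightarrow> nat \<Rightarrow> nat" and n :: nat
  assumes Phi_hom: "\<Phi> \<in> hom (SL2 q) (sym_group n)"
    and Phi_trans: "\<And>i j. i \<in> {1..n} \<Longrightarrow> j \<in> {1..n} \<Longrightarrow> \<exists>g\<in>carrier (SL2 q). \<Phi> g i = j"
    and Phi_stab: "\<And>g. g \<in> carrier (SL2 q) \<Longrightarrow> \<Phi> g 1 = 1 \<longleftrightarrow> g \<in> stab_lift"
    and Phi_derangement: "\<And>g. g \<in> carrier (SL2 q) \<Longrightarrow> derangement n (\<Phi> g) \<longleftrightarrow>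
      (\<forall>h\<in>carrier (SL2 q). h \<otimes>\<^bsub>SL2 q\<^esub> g \<otimes>\<^bsub>SL2 q\<^esub> inv\<^bsub>SL2 q\<^esub> h \<notin> stab_lift)"
    and Phi_id: "\<And>g. g \<in> carrier (SL2 q) \<Longrightarrow> \<Phi> g = id \<longleftrightarrow> g \<in> SL2_center q"
    and n_eq: "n = p ^ (3 * k - 4) * (p + 1) div 2"
begin

definition H :: "(nat \<Rightarrow> nat) set" where
  "H = \<Phi> ` carrier (SL2 q)"

abbreviation G :: "(nat \<Rightarrow> nat) monoid" where
  "G \<equiv> perm_grp n H"

lemma subgroup_H: "subgroup H (sym_group n)"
proof -
  interpret group_hom "SL2 q" "sym_group n" \<Phi>
    using Phi_hom group_SL2[OF q1] sym_group_is_group by (simp add: group_hom_def group_hom_axioms_def)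
  show ?thesis
    unfolding H_def by (rule img_is_subgroup)
qed

lemma group_G: "group G"
  unfolding perm_grp_def by (rule subgroup.subgroup_is_group[OF subgroup_H sym_group_is_group])

sublocale Phi: group_hom "SL2 q" G \<Phi>
proof -
  have "\<Phi> \<in> hom (SL2 q) G"
  proof (rule homI)
    show "\<Phi> x \<in> carrier G" if "x \<in> carrier (SL2 q)" for x
      using that by (simp add: H_def)
    show "\<Phi> (x \<otimes>\<^bsub>SL2 q\<^esub> y) = \<Phi> x \<otimes>\<^bsub>G\<^esub> \<Phi> y" if "x \<in> carrier (SL2 q)" "y \<in> carrier (SL2 q)" for x y
      using hom_mult[OF Phi_hom that] by (simp add: sym_group_mult)
  qed
  then show "group_hom (SL2 q) G \<Phi>"
    using group_SL2[OF q1] group_G by (simp add: group_hom_def group_hom_axioms_def)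
qed

lemma Phi_in_H: "x \<in> carrier (SL2 q) \<Longrightarrow> \<Phi> x \<in> H"
  by (simp add: H_def)

lemma Phi_mult: "x \<in> carrier (SL2 q) \<Longrightarrow> y \<in> carrier (SL2 q) \<Longrightarrow> \<Phi> (x \<otimes>\<^bsub>SL2 q\<^esub> y) = \<Phi> x \<circ> \<Phi> y"
  using Phi.hom_mult by simp

lemma Phi_minus:
  assumes "x \<in> carrier (SL2 q)"
  shows "\<Phi> (smat q (-1) 0 0 (-1) \<otimes>\<^bsub>SL2 q\<^esub> x) = \<Phi> x"
  using assms Phi_id[OF smat_minus_one_in_SL2[OF q1]]
  by (simp add: Phi_mult smat_minus_one_in_SL2[OF q1] SL2_center_eq[OF q1])

lemma Phi_eq_cases:
  assumes "\<Phi> x = \<Phi> y" and x: "x \<in> carrier (SL2 q)" and y: "y \<in> carrier (SL2 q)"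
  shows "x = y \<or> x = smat q (-1) 0 0 (-1) \<otimes>\<^bsub>SL2 q\<^esub> y"
proof -
  have "\<Phi> (x \<otimes>\<^bsub>SL2 q\<^esub> inv\<^bsub>SL2 q\<^esub> y) = \<Phi> (y \<otimes>\<^bsub>SL2 q\<^esub> inv\<^bsub>SL2 q\<^esub> y)"
    using assms by (simp only: Phi_mult Phi.G.inv_closed)
  also have "\<dots> = id"
    using y Phi.hom_one by simp
  finally have "x \<otimes>\<^bsub>SL2 q\<^esub> inv\<^bsub>SL2 q\<^esub> y \<in> SL2_center q"
    using Phi_id[of "x \<otimes>\<^bsub>SL2 q\<^esub> inv\<^bsub>SL2 q\<^esub> y"] x y by (simp del: Phi.hom_mult)
  then have "x \<otimes>\<^bsub>SL2 q\<^esub> inv\<^bsub>SL2 q\<^esub> y = \<one>\<^bsub>SL2 q\<^esub> \<or> x \<otimes>\<^bsub>SL2 q\<^esub> inv\<^bsub>SL2 q\<^esub> y = smat q (-1) 0 0 (-1)"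
    by (simp add: SL2_center_eq[OF q1] one_SL2[OF q1])
  moreover have "x = x \<otimes>\<^bsub>SL2 q\<^esub> inv\<^bsub>SL2 q\<^esub> y \<otimes>\<^bsub>SL2 q\<^esub> y"
    using x y by (simp add: Phi.G.m_assoc)
  ultimately show ?thesis
    using y by (metis Phi.G.l_one)
qed

section \<open>Prime divisors of the degree and the absence of derangements of prime order\<close>

lemma n_pos: "n \<ge> 1"
proof -
  have "0 < p ^ (3 * k - 4) * (p + 1)"
    using p7 by simp
  then show ?thesis
    using double_degree unfolding n_eq by linarith
qed

lemma prime_dvd_n:
  assumes "Factorial_Ring.prime r" "r dvd n"
  shows "r = p \<or> r = 2"
proof -
  have "2 * n = p ^ (3 * k - 4) * 2 ^ m"
    unfolding n_eq double_degree by (simp only: mers)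
  then have "r dvd p ^ (3 * k - 4) * 2 ^ m"
    using assms(2) by (metis dvd_mult)
  then have "r dvd p \<or> r dvd 2"
    using assms(1) prime_dvd_mult_iff prime_dvd_power by blast
  then show ?thesis
    using assms(1) p two_is_prime_nat primes_dvd_imp_eq by blast
qed

lemma pow_G: "\<sigma> [^]\<^bsub>G\<^esub> (j::nat) = \<sigma> ^^ j"
  by (induction j) (simp_all add: funpow_Suc_right del: funpow.simps(2))

lemma minus_one_pow: "smat q (-1) 0 0 (-1) [^]\<^bsub>SL2 q\<^esub> (j::nat) = smat q ((-1) ^ j) 0 0 ((-1) ^ j)"
  by (induction j) (simp_all add: one_SL2[OF q1] smat_mult)

text \<open>A lift has p-th power 1 or -1. In the second case its negative has p-th power 1, since p
  is odd, and induces the same permutation.\<close>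

lemma order_p_not_derangement:
  assumes x: "x \<in> carrier (SL2 q)" and one: "\<Phi> x [^]\<^bsub>G\<^esub> p = \<one>\<^bsub>G\<^esub>"
  shows "\<not> derangement n (\<Phi> x)"
proof -
  let ?z = "smat q (-1) 0 0 (-1)"
  have z: "?z \<in> carrier (SL2 q)"
    by (rule smat_minus_one_in_SL2[OF q1])
  have "\<Phi> (x [^]\<^bsub>SL2 q\<^esub> p) = id"
    using one x by (simp add: Phi.hom_nat_pow)
  then have "x [^]\<^bsub>SL2 q\<^esub> p \<in> SL2_center q"
    using Phi_id x by simp
  then consider "x [^]\<^bsub>SL2 q\<^esub> p = \<one>\<^bsub>SL2 q\<^esub>" | "x [^]\<^bsub>SL2 q\<^esub> p = ?z"
    by (auto simp: SL2_center_eq[OF q1] one_SL2[OF q1])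
  then obtain y where y: "y \<in> carrier (SL2 q)" "\<Phi> y = \<Phi> x" "y [^]\<^bsub>SL2 q\<^esub> p = \<one>\<^bsub>SL2 q\<^esub>"
  proof cases
    case 1
    then show ?thesis
      using that x by blast
  next
    case 2
    have "?z \<otimes>\<^bsub>SL2 q\<^esub> x = x \<otimes>\<^bsub>SL2 q\<^esub> ?z"
      using x by (elim SL2_cases[OF q1]) (simp only: smat_mult, simp)
    then have "(?z \<otimes>\<^bsub>SL2 q\<^esub> x) [^]\<^bsub>SL2 q\<^esub> p = ?z [^]\<^bsub>SL2 q\<^esub> p \<otimes>\<^bsub>SL2 q\<^esub> x [^]\<^bsub>SL2 q\<^esub> p"
      using x z by (intro Phi.G.pow_mult_distrib)
    also have "\<dots> = \<one>\<^bsub>SL2 q\<^esub>"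
      using odd_p by (simp add: 2 minus_one_pow smat_mult one_SL2[OF q1])
    finally show ?thesis
      using that[of "?z \<otimes>\<^bsub>SL2 q\<^esub> x"] x z Phi_minus by simp
  qed
  then show ?thesis
    using order_p_conj_in_stab_lift Phi_derangement[OF y(1)] by simp
qed

lemma involution_not_derangement:
  assumes x: "x \<in> carrier (SL2 q)" and one: "\<Phi> x [^]\<^bsub>G\<^esub> (2::nat) = \<one>\<^bsub>G\<^esub>"
  shows "\<not> derangement n (\<Phi> x)"
proof
  assume d: "derangement n (\<Phi> x)"
  have "\<Phi> (x \<otimes>\<^bsub>SL2 q\<^esub> x) = id"
    using one x by (simp add: Phi_mult pow_G numeral_2_eq_2)
  then have "x \<otimes>\<^bsub>SL2 q\<^esub> x \<in> SL2_center q"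
    using Phi_id[of "x \<otimes>\<^bsub>SL2 q\<^esub> x"] x by (simp del: Phi.hom_mult)
  \<comment> \<open>The identity fixes point 1, which exists by \<open>n_pos\<close>; so
    \<open>x\<close> is not central.\<close>
  moreover have "\<Phi> x \<noteq> id"
    using d n_pos by (auto simp: derangement_def)
  ultimately show False
    using involution_conj_in_stab_lift[OF x] Phi_id[OF x] Phi_derangement[OF x] d by blast
qed

lemma elusive_H: "elusive n H"
proof -
  have "transitive_perm_grp n H"
    unfolding transitive_perm_grp_def using subgroup_H Phi_trans by (auto simp: H_def)
  moreover have False if \<sigma>: "\<sigma> \<in> H" "derangement n \<sigma>" "Factorial_Ring.prime (group.ord G \<sigma>)" for \<sigma>
  proof -
    define r where "r = group.ord G \<sigma>"
    have r: "Factorial_Ring.prime r"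
      using \<sigma>(3) by (simp add: r_def)
    obtain x where x: "x \<in> carrier (SL2 q)" "\<sigma> = \<Phi> x"
      using \<sigma>(1) by (auto simp: H_def)
    have pow: "\<sigma> [^]\<^bsub>G\<^esub> r = \<one>\<^bsub>G\<^esub>"
      unfolding r_def using \<sigma>(1) by (intro Phi.H.pow_ord_eq_1) simp
    \<comment> \<open>If the prime \<open>r\<close> does not divide the number of points, orbit
      counting produces a fixed point.\<close>
    have "r dvd n"
    proof (rule ccontr)
      assume "\<not> r dvd n"
      moreover have "\<sigma> permutes {1..n}"
        using \<sigma>(1) subgroup.subset[OF subgroup_H] by (auto simp: sym_group_def)
      ultimately obtain i where "i \<in> {1..n}" "\<sigma> i = i"
        using prime_period_imp_fixpoint[of "{1..n}" \<sigma> r] r pow by (auto simp: permutes_image pow_G)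
      then show False
        using \<sigma>(2) by (auto simp: derangement_def)
    qed
    then show False
      using prime_dvd_n[OF r] pow order_p_not_derangement[OF x(1)] involution_not_derangement[OF x(1)] \<sigma>(2)
      by (auto simp: x(2))
  qed
  ultimately show ?thesis
    unfolding elusive_def by blast
qed

section \<open>The normal chain and its factors\<close>

definition Ns :: "nat \<Rightarrow> (nat \<Rightarrow> nat) set" where
  "Ns l = \<Phi> ` congr_sub l"

lemma normal_Ns: "1 \<le> l \<Longrightarrow> l \<le> k \<Longrightarrow> Ns l \<lhd> G"
  unfolding Ns_def using normal.surj_hom_normal_subgroup[OF normal_congr_sub Phi.group_hom_axioms]
  by (simp add: H_def)

lemma Ns_k: "Ns k = {id}"
  using Phi.hom_one by (simp add: Ns_def congr_sub_k)

lemma Phi_congr_sub_eq_id: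
  assumes "1 \<le> l" "x \<in> congr_sub l" "\<Phi> x = id"
  shows "x = \<one>\<^bsub>SL2 q\<^esub>"
proof -
  have "x \<in> carrier (SL2 q)"
    using assms(2) by (auto simp: congr_sub_def)
  then show ?thesis
    using congr_sub_center assms Phi_id by blast
qed

lemma inj_on_Phi_congr_sub:
  assumes l: "1 \<le> l" "l \<le> k"
  shows "inj_on \<Phi> (congr_sub l)"
proof (rule inj_onI)
  fix x y assume xy: "x \<in> congr_sub l" "y \<in> congr_sub l" "\<Phi> x = \<Phi> y"
  then have c: "x \<in> carrier (SL2 q)" "y \<in> carrier (SL2 q)"
    by (auto simp: congr_sub_def)
  have "\<Phi> (x \<otimes>\<^bsub>SL2 q\<^esub> inv\<^bsub>SL2 q\<^esub> y) = \<Phi> (y \<otimes>\<^bsub>SL2 q\<^esub> inv\<^bsub>SL2 q\<^esub> y)"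
    using xy c by (simp only: Phi_mult Phi.G.inv_closed)
  then have "\<Phi> (x \<otimes>\<^bsub>SL2 q\<^esub> inv\<^bsub>SL2 q\<^esub> y) = id"
    using c Phi.hom_one by simp
  moreover have "x \<otimes>\<^bsub>SL2 q\<^esub> inv\<^bsub>SL2 q\<^esub> y \<in> congr_sub l"
    using xy subgroup_congr_sub[OF l] by (simp add: subgroup.m_closed subgroup.m_inv_closed)
  ultimately have "x \<otimes>\<^bsub>SL2 q\<^esub> inv\<^bsub>SL2 q\<^esub> y = \<one>\<^bsub>SL2 q\<^esub>"
    using Phi_congr_sub_eq_id l by blast
  then show "x = y"
    using c by (metis Phi.G.inv_closed Phi.G.inv_equality Phi.G.inv_inv)
qed

lemma Ns_Suc_psubset:
  assumes l: "1 \<le> l" "l < k"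
  shows "Ns (Suc l) \<subset> Ns l"
proof -
  have sub: "congr_sub (Suc l) \<subseteq> congr_sub l"
    by (rule congr_sub_mono) simp
  \<comment> \<open>A transvection with entry p^l has level exactly \<open>l\<close>.\<close>
  have u: "smat q 1 (int p ^ l) 0 1 \<in> congr_sub l" "smat q 1 (int p ^ l) 0 1 \<notin> congr_sub (Suc l)"
    using l p7 by (simp_all add: smat_in_congr_sub)
  then have "\<Phi> (smat q 1 (int p ^ l) 0 1) \<notin> Ns (Suc l)"
    unfolding Ns_def using inj_on_image_mem_iff[OF inj_on_Phi_congr_sub _ sub] l by simp
  then show ?thesis
    using u sub unfolding Ns_def by blast
qed

text \<open>Since \<open>\<Phi>\<close> is injective on \<open>congr_sub l\<close>, the digit map
  descends to \<open>Ns l\<close>.\<close>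

lemma Ns_factor_iso:
  assumes l: "1 \<le> l" "l < k"
  shows "(G\<lparr>carrier := Ns l\<rparr>) Mod Ns (Suc l) \<cong> elem_ab p 3"
proof -
  have sub: "subgroup (congr_sub l) (SL2 q)"
    using subgroup_congr_sub l by simp
  interpret ind: group_hom "SL2 q\<lparr>carrier := congr_sub l\<rparr>" "G\<lparr>carrier := Ns l\<rparr>" \<Phi>
    unfolding Ns_def by (rule Phi.induced_group_hom[OF sub])
  have "(G\<lparr>carrier := Ns l\<rparr>) Mod (\<Phi> ` kernel (SL2 q\<lparr>carrier := congr_sub l\<rparr>) (elem_ab p 3) (entry_digits 3 l)) \<cong> elem_ab p 3"
  proof (rule epi_FactGroup_iso)
    show "entry_digits 3 l x = \<one>\<^bsub>elem_ab p 3\<^esub>"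
      if "x \<in> carrier (SL2 q\<lparr>carrier := congr_sub l\<rparr>)" "\<Phi> x = \<one>\<^bsub>G\<lparr>carrier := Ns l\<rparr>\<^esub>" for x
    proof -
      have "x = \<one>\<^bsub>SL2 q\<^esub>"
        using that l by (intro Phi_congr_sub_eq_id[of l]) simp_all
      moreover have "\<one>\<^bsub>SL2 q\<^esub> \<in> congr_sub (Suc l)"
        using subgroup.one_closed[OF subgroup_congr_sub] l by simp
      ultimately show ?thesis
        unfolding kernel_entry_digits[OF l, symmetric] by (simp add: kernel_def)
    qed
  qed (use ind.G.group_axioms ind.H.group_axioms group_elem_ab ind.homh entry_digits_hom entry_digits_surj l
      in \<open>simp_all add: Ns_def\<close>)
  then show ?thesis
    by (simp add: kernel_entry_digits[OF l] Ns_def)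
qed

section \<open>The quotient by the first congruence subgroup and the missing complement\<close>

lemma center_coset_eq_iff:
  assumes "x \<in> carrier (SL2 p)"
  shows "SL2_center p #>\<^bsub>SL2 p\<^esub> x = SL2_center p \<longleftrightarrow> x \<in> SL2_center p"
  using group.coset_join1[OF group_SL2[OF p_gt_1]] group.coset_join2[OF group_SL2[OF p_gt_1]]
    normal_imp_subgroup[OF normal_SL2_center[OF p_gt_1]] assms by blast

text \<open>The kernel of the map from \<open>SL2 q\<close> to \<open>PSL2 p\<close> consists of
  \<open>congr_sub 1\<close> and its negatives; the sign disappears under \<open>\<Phi>\<close>, so
  its image is \<open>Ns 1\<close>.\<close>

lemma G_Mod_N_iso: "G Mod Ns 1 \<cong> PSL2 p"
proof -
  have pq: "p dvd q"
    using p_dvd_q by simp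
  define f where "f = (\<lambda>a. SL2_center p #>\<^bsub>SL2 p\<^esub> a) \<circ> reduce p"
  have red: "reduce p \<in> hom (SL2 q) (SL2 p)"
    by (rule reduce_hom[OF p_gt_1 pq q1])
  have fone: "f x = \<one>\<^bsub>PSL2 p\<^esub> \<longleftrightarrow> reduce p x \<in> SL2_center p" if "x \<in> carrier (SL2 q)" for x
    using center_coset_eq_iff hom_in_carrier[OF red that] by (simp add: f_def PSL2_def)
  have fhom: "f \<in> hom (SL2 q) (PSL2 p)"
    unfolding f_def PSL2_def
    by (rule Group.hom_compose[OF red normal.r_coset_hom_Mod[OF normal_SL2_center[OF p_gt_1]]])
  have fsurj: "f ` carrier (SL2 q) = carrier (PSL2 p)"
    unfolding f_def image_comp[symmetric] reduce_p_surj
    by (auto simp: PSL2_def FactGroup_def RCOSETS_def)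
  have "G Mod (\<Phi> ` kernel (SL2 q) (PSL2 p) f) \<cong> PSL2 p"
  proof (rule epi_FactGroup_iso[OF group_SL2[OF q1] group_G group_PSL2[OF p_gt_1] Phi.homh _ fhom fsurj])
    show "\<Phi> ` carrier (SL2 q) = carrier G"
      by (simp add: H_def)
    show "f x = \<one>\<^bsub>PSL2 p\<^esub>" if "x \<in> carrier (SL2 q)" "\<Phi> x = \<one>\<^bsub>G\<^esub>" for x
      using that Phi_id[of x] by (auto simp: fone SL2_center_eq[OF q1] SL2_center_eq[OF p_gt_1] reduce_smat[OF pq])
  qed
  moreover have "\<Phi> ` kernel (SL2 q) (PSL2 p) f = Ns 1"
  proof (intro equalityI subsetI)
    fix y assume "y \<in> \<Phi> ` kernel (SL2 q) (PSL2 p) f"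
    then obtain x where y: "y = \<Phi> x" and x: "x \<in> carrier (SL2 q)" "reduce p x \<in> SL2_center p"
      using fone by (auto simp: kernel_def)
    obtain a b c d where e: "x = smat q a b c d" and det: "[a * d - b * c = 1] (mod int q)"
      using SL2_cases[OF q1 x(1)] by metis
    from x(2) consider "smat p a b c d = smat p 1 0 0 1" | "smat p a b c d = smat p (-1) 0 0 (-1)"
      by (auto simp: e reduce_smat[OF pq] SL2_center_eq[OF p_gt_1])
    then show "y \<in> Ns 1"
    proof cases
      case 1
      then have "x \<in> congr_sub 1"
        using det k2 by (simp add: e smat_in_congr_sub smat_eq_iff cong_iff_dvd_diff)
      then show ?thesis
        by (simp add: y Ns_def)
    next
      case 2
      have neg: "int p dvd - u - 1" if "int p dvd u + 1" for u
        using that by (metis dvd_minus_iff minus_add_distrib uminus_add_conv_diff diff_minus_eq_add add.commute)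
      have "smat q (-1) 0 0 (-1) \<otimes>\<^bsub>SL2 q\<^esub> x \<in> congr_sub 1"
        using 2 det k2 neg by (simp add: e smat_minus[OF q1] smat_in_congr_sub smat_eq_iff cong_iff_dvd_diff)
      then show ?thesis
        unfolding y Phi_minus[OF x(1), symmetric] Ns_def by (rule imageI)
    qed
  next
    fix y assume "y \<in> Ns 1"
    then obtain x where y: "y = \<Phi> x" "x \<in> congr_sub 1"
      by (auto simp: Ns_def)
    then have "x \<in> kernel (SL2 q) (SL2 p) (reduce p)"
      using congr_sub_eq_kernel[of 1] k2 by simp
    then have "x \<in> kernel (SL2 q) (PSL2 p) f"
      using fone by (auto simp: kernel_def SL2_center_eq[OF p_gt_1] one_SL2[OF p_gt_1])
    then show "y \<in> \<Phi> ` kernel (SL2 q) (PSL2 p) f"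
      by (simp add: y)
  qed
  ultimately show ?thesis
    by simp
qed

lemma unipotent_pow: "r > 1 \<Longrightarrow> smat r 1 1 0 1 [^]\<^bsub>SL2 r\<^esub> j = smat r 1 (int j) 0 1" for j :: nat
  by (induction j) (simp_all add: one_SL2 smat_mult add.commute)

lemma k_1: "1 \<le> k - 1" "k - 1 \<le> k" "k - 1 < k" "Suc (k - 1) = k"
  using k2 by auto

text \<open>A complement would contain an element of order \<open>p\<close> lifting a unipotent element of
  \<open>SL\<^sub>2(p)\<close>, but elements of order \<open>p\<close> are trivial modulo \<open>p\<close>.\<close>

lemma N_no_complement:
  assumes K: "subgroup K G" and NK: "Ns 1 \<inter> K = {\<one>\<^bsub>G\<^esub>}" and cover: "Ns 1 <#>\<^bsub>G\<^esub> K = carrier G"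
  shows False
proof -
  let ?u = "smat q 1 1 0 1"
  have pq: "p dvd q"
    using p_dvd_q by simp
  interpret red: group_hom "SL2 q" "SL2 p" "reduce p"
    using group_hom_reduce[of 1] k2 by simp
  have c1: "congr_sub 1 = kernel (SL2 q) (SL2 p) (reduce p)"
    using congr_sub_eq_kernel[of 1] k2 by simp
  have u: "?u \<in> carrier (SL2 q)"
    by (simp add: smat_in_SL2[OF q1])
  then have "\<Phi> ?u \<in> Ns 1 <#>\<^bsub>G\<^esub> K"
    unfolding cover by (simp add: Phi_in_H)
  then obtain B \<kappa> where B: "B \<in> congr_sub 1" and \<kappa>: "\<kappa> \<in> K" and eq: "\<Phi> ?u = \<Phi> B \<otimes>\<^bsub>G\<^esub> \<kappa>"
    by (auto simp: set_mult_def Ns_def)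
  have Bc: "B \<in> carrier (SL2 q)" and redB: "reduce p B = \<one>\<^bsub>SL2 p\<^esub>"
    using B unfolding c1 by (simp_all add: kernel_def)
  have \<kappa>c: "\<kappa> \<in> carrier G"
    using \<kappa> subgroup.mem_carrier[OF K] by blast
  \<comment> \<open>A lift of \<open>\<kappa>\<close> that has the same reduction modulo p as
    \<open>?u\<close>, because \<open>B\<close> reduces to 1.\<close>
  define A where "A = inv\<^bsub>SL2 q\<^esub> B \<otimes>\<^bsub>SL2 q\<^esub> ?u"
  have A: "A \<in> carrier (SL2 q)"
    using Bc u by (simp add: A_def)
  have "\<Phi> A = inv\<^bsub>G\<^esub> \<Phi> B \<otimes>\<^bsub>G\<^esub> (\<Phi> B \<otimes>\<^bsub>G\<^esub> \<kappa>)"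
    unfolding A_def eq[symmetric] using Bc u by (simp del: mult_perm_grp)
  then have PhiA: "\<Phi> A = \<kappa>"
    using Bc \<kappa>c Phi.H.m_assoc[of "inv\<^bsub>G\<^esub> \<Phi> B" "\<Phi> B" \<kappa>] Phi.H.l_inv[of "\<Phi> B"] Phi.H.l_one[of \<kappa>]
      Phi.hom_closed[of B] by (simp del: mult_perm_grp one_perm_grp carrier_perm_grp)
  have redA: "reduce p A = smat p 1 1 0 1"
    using Bc u redB by (simp add: A_def reduce_smat[OF pq] one_SL2[OF p_gt_1] smat_mult smat_inv[OF p_gt_1])
  have "reduce p (A [^]\<^bsub>SL2 q\<^esub> p) = \<one>\<^bsub>SL2 p\<^esub>"
    using A by (simp add: red.hom_nat_pow redA unipotent_pow[OF p_gt_1] one_SL2[OF p_gt_1] smat_eq_iff cong_0_iff)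
  then have Ap: "A [^]\<^bsub>SL2 q\<^esub> p \<in> congr_sub 1"
    using A unfolding c1 by (simp add: kernel_def)
  then have "\<Phi> (A [^]\<^bsub>SL2 q\<^esub> p) \<in> Ns 1"
    by (simp add: Ns_def)
  moreover have "\<kappa> [^]\<^bsub>G\<^esub> j \<in> K" for j :: nat
    by (induction j)
      (use \<kappa> subgroup.one_closed[OF K] subgroup.m_closed[OF K] in \<open>simp_all del: mult_perm_grp one_perm_grp\<close>)
  ultimately have "\<Phi> (A [^]\<^bsub>SL2 q\<^esub> p) = \<one>\<^bsub>G\<^esub>"
    using NK A PhiA by (simp add: Phi.hom_nat_pow) blast
  \<comment> \<open>No sign is left over: the p-th power lies in \<open>congr_sub 1\<close>, which
    does not contain -1.\<close>
  then have Aone: "A [^]\<^bsub>SL2 q\<^esub> p = \<one>\<^bsub>SL2 q\<^esub>"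
    using Phi_congr_sub_eq_id[of 1] Ap by simp
  obtain a b c d where e: "A = smat q a b c d" and det: "[a * d - b * c = 1] (mod int q)"
    using A by (rule SL2_cases[OF q1])
  have "A \<in> congr_sub 1"
    using order_p_in_congr_sub(1)[OF det] Aone congr_sub_mono[OF k_1(1)] unfolding e by blast
  then have "smat p 1 1 0 1 = smat p 1 0 0 1"
    using redA unfolding c1 by (simp add: kernel_def one_SL2[OF p_gt_1])
  then show False
    using p7 by (simp add: smat_eq_iff cong_0_iff)
qed

section \<open>The point stabilizer and its elementary abelian normal subgroup\<close>

lemma point_stab_eq: "point_stab H 1 = \<Phi> ` stab_lift"
  using Phi_stab stab_lift_subset by (auto simp: point_stab_def H_def)

lemma subgroup_point_stab: "subgroup (point_stab H 1) G"
  unfolding point_stab_eq by (rule Phi.subgroup_img_is_subgroup[OF subgroup_stab_lift])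

abbreviation W :: "(int \<times> int \<times> int \<times> int) set" where
  "W \<equiv> congr_sub (k - 1) \<inter> stab_lift"

lemma subgroup_W: "subgroup W (SL2 q)"
  using Phi.G.subgroups_Inter_pair subgroup_congr_sub[OF k_1(1,2)] subgroup_stab_lift by blast

lemma Phi_W: "\<Phi> ` W = Ns (k - 1) \<inter> point_stab H 1"
proof
  show "\<Phi> ` W \<subseteq> Ns (k - 1) \<inter> point_stab H 1"
    unfolding Ns_def point_stab_eq by blast
  show "Ns (k - 1) \<inter> point_stab H 1 \<subseteq> \<Phi> ` W"
  proof
    fix y assume y: "y \<in> Ns (k - 1) \<inter> point_stab H 1"
    then obtain x where x: "x \<in> congr_sub (k - 1)" "y = \<Phi> x"
      by (auto simp: Ns_def)
    moreover have "x \<in> stab_lift"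
      using y x Phi_stab[of x] by (auto simp: point_stab_def congr_sub_def)
    ultimately show "y \<in> \<Phi> ` W"
      by blast
  qed
qed

lemma normal_Phi_W: "\<Phi> ` W \<lhd> G\<lparr>carrier := point_stab H 1\<rparr>"
  unfolding Phi_W by (rule Phi.H.normal_Int_subgroup[OF subgroup_point_stab normal_Ns[OF k_1(1,2)]])

text \<open>On \<open>W\<close> the diagonal is 1 and the other entries are multiples of
  \<open>P\<close>, so both maps have trivial kernel: two digits determine the matrix.\<close>

lemma Phi_W_iso: "G\<lparr>carrier := \<Phi> ` W\<rparr> \<cong> elem_ab p 2"
proof -
  interpret ind: group_hom "SL2 q\<lparr>carrier := W\<rparr>" "G\<lparr>carrier := \<Phi> ` W\<rparr>" \<Phi>
    by (rule Phi.induced_group_hom[OF subgroup_W])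
  have hom: "entry_digits 2 (k - 1) \<in> hom (SL2 q\<lparr>carrier := W\<rparr>) (elem_ab p 2)"
    using entry_digits_hom[of 2 "k - 1"] k_1 by (auto simp: hom_def)
  have ker: "\<Phi> x = \<one>\<^bsub>G\<lparr>carrier := \<Phi> ` W\<rparr>\<^esub> \<longleftrightarrow> entry_digits 2 (k - 1) x = \<one>\<^bsub>elem_ab p 2\<^esub>"
    if x: "x \<in> carrier (SL2 q\<lparr>carrier := W\<rparr>)" for x
  proof -
    have xW: "x \<in> W"
      using x by simp
    then obtain b c where e: "x = smat q 1 b c 1"
      unfolding stab_lift_congr_sub by blast
    have "\<Phi> x = id \<longleftrightarrow> x = \<one>\<^bsub>SL2 q\<^esub>"
      using Phi_congr_sub_eq_id[OF k_1(1)] xW Phi.hom_one by (metis IntD1 one_perm_grp)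
    also have "\<dots> \<longleftrightarrow> int p ^ k dvd b \<and> int p ^ k dvd c"
      by (simp add: e one_SL2[OF q1] smat_eq_iff cong_0_iff int_q)
    also have "\<dots> \<longleftrightarrow> entry_digits 2 (k - 1) x = \<one>\<^bsub>elem_ab p 2\<^esub>"
      using entry_digits_eq_one_iff[of 2 "k - 1" 1 b c 1] xW k_1
      by (auto simp: e less_Suc_eq numeral_2_eq_2)
    finally show ?thesis
      by simp
  qed
  show ?thesis
    by (rule epi_same_kernel_iso[OF ind.G.group_axioms ind.H.group_axioms group_elem_ab ind.homh _ hom _ ker])
      (use entry_digits_2_surj in simp_all)
qed

end

section \<open>The point stabilizer as a semidirect product\<close>

context mersenne_action
begin

context
  fixes E :: "int \<Rightarrow> int"
  assumes E_mult: "\<And>i j. [E i * E j = E (i + j)] (mod int q)"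
    and E_1: "\<And>i. [E i = 1] (mod int q) \<longleftrightarrow> int (p - 1) dvd i"
    and E_0: "E 0 = 1"
    and E_surj: "\<And>x. root_unity x \<longleftrightarrow> (\<exists>i. [x = E i] (mod int q))"
begin

text \<open>\<open>monomial_mat (i, s)\<close> is \<open>D\<^sub>i w\<^sup>s\<close> with \<open>D\<^sub>i\<close> diagonal and \<open>w = ((0, 1), (-1, 0))\<close>; as
  \<open>w\<^sup>2 = -1\<close>, these multiply like elements of a dihedral group only after applying \<open>\<Phi>\<close>.\<close>

definition monomial_mat :: "int \<times> bool \<Rightarrow> int \<times> int \<times> int \<times> int" where
  "monomial_mat = (\<lambda>(i, s). if s then smat q 0 (E i) (- E (- i)) 0 else smat q (E i) 0 0 (E (- i)))"

lemma E_inverse: "[E i * E (- i) = 1] (mod int q)"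
  using E_mult[of i "- i"] E_0 by simp

lemma root_unity_E: "root_unity (E i)"
  unfolding E_surj by (blast intro: cong_refl)

lemma monomial_mat_in_stab_lift: "monomial_mat x \<in> stab_lift"
  using E_inverse root_unity_E by (cases x) (auto simp: monomial_mat_def smat_in_stab_lift)

lemma monomial_mat_in_SL2: "monomial_mat x \<in> carrier (SL2 q)"
  using monomial_mat_in_stab_lift stab_lift_subset by blast

lemma monomial_mat_0: "monomial_mat (0, False) = \<one>\<^bsub>SL2 q\<^esub>"
  by (simp add: monomial_mat_def E_0 one_SL2[OF q1])

lemma Phi_monomial_mat_mult:
  "\<Phi> (monomial_mat (i, s)) \<circ> \<Phi> (monomial_mat (j, t)) = \<Phi> (monomial_mat (i + (if s then - j else j), s \<noteq> t))"
proof -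
  have neg: "[- (E i * E j) = - E (i + j)] (mod int q)" for i j
    using E_mult cong_minus_minus_iff by blast
  have EE: "[E (- i) * E (- j) = E (- i - j)] (mod int q)" "[E i * E (- j) = E (i - j)] (mod int q)"
    "[E (- i) * E j = E (j - i)] (mod int q)"
    "[- (E (- i) * E (- j)) = - E (- i - j)] (mod int q)" "[- (E i * E (- j)) = - E (i - j)] (mod int q)"
    "[- (E (- i) * E j) = - E (j - i)] (mod int q)"
    using E_mult[of "- i" "- j"] E_mult[of i "- j"] E_mult[of "- i" j] neg[of "- i" "- j"] neg[of i "- j"] neg[of "- i" j]
    by simp_all
  let ?x = "monomial_mat (i, s) \<otimes>\<^bsub>SL2 q\<^esub> monomial_mat (j, t)"
  let ?y = "monomial_mat (i + (if s then - j else j), s \<noteq> t)"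
  \<comment> \<open>Two reflections multiply to minus a diagonal matrix; the remaining cases agree
    without a sign.\<close>
  have "?x = ?y \<or> ?x = smat q (-1) 0 0 (-1) \<otimes>\<^bsub>SL2 q\<^esub> ?y"
    using E_mult[of i j] EE
    by (cases s; cases t) (simp_all add: monomial_mat_def smat_mult smat_eq_iff add.commute)
  then have "\<Phi> ?x = \<Phi> ?y"
    using Phi_minus[OF monomial_mat_in_SL2] by metis
  then show ?thesis
    by (simp add: Phi_mult[OF monomial_mat_in_SL2 monomial_mat_in_SL2] del: Phi.hom_mult)
qed

abbreviation half :: int where "half \<equiv> int ((p - 1) div 2)"

lemma p_minus_1: "int (p - 1) = 2 * half"
proof -
  have "p - 1 = 2 * ((p - 1) div 2)"
    using odd_p by simp
  then show ?thesis
    by presburger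
qed

text \<open>At multiples of \<open>half\<close> the value of \<open>E\<close> is a sign, so shifting
  the index by them changes the matrix only by a sign. This halves the torus from order
  \<open>p - 1\<close> to \<open>(p - 1) div 2\<close>, leaving a dihedral group of order
  \<open>p - 1\<close>.\<close>

lemma Phi_monomial_mat_mod: "\<Phi> (monomial_mat (i mod half, s)) = \<Phi> (monomial_mat (i, s))"
proof -
  define j where "j = half * (i div half)"
  have i: "i = i mod half + j"
    by (simp add: j_def)
  \<comment> \<open>Twice \<open>j\<close> is a multiple of \<open>p - 1\<close>, so
    \<open>E j\<close> is a square root of 1.\<close>
  have "[E (j + j) = 1] (mod int q)"
    unfolding E_1 p_minus_1 j_def by (simp flip: mult_2)
  with E_mult have "[E j * E j = 1] (mod int q)"
    by (rule cong_trans)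
  then obtain \<eta> where \<eta>: "\<eta> = 1 \<or> \<eta> = -1" "[E j = \<eta>] (mod int q)"
    using square_cong_1[of "E j"] by (auto simp: power2_eq_square)
  have "[\<eta> * E (- j) = E j * E (- j)] (mod int q)"
    using \<eta>(2) by (intro cong_mult cong_refl) (rule cong_sym)
  then have "[\<eta> * E (- j) = 1] (mod int q)"
    using E_inverse cong_trans by blast
  then have "[\<eta> * (\<eta> * E (- j)) = \<eta> * 1] (mod int q)"
    by (intro cong_mult cong_refl)
  then have mj: "[E (- j) = \<eta>] (mod int q)"
    using \<eta>(1) by auto
  have "[E (i mod half) * E j = E (i mod half) * \<eta>] (mod int q)"
    using \<eta>(2) by (intro cong_mult cong_refl)
  from cong_trans[OF cong_sym[OF E_mult] this] have a: "[E i = E (i mod half) * \<eta>] (mod int q)"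
    by (simp only: i[symmetric])
  have i': "- (i mod half) + - j = - i"
    using i by linarith
  have "[E (- (i mod half)) * E (- j) = E (- (i mod half)) * \<eta>] (mod int q)"
    using mj by (intro cong_mult cong_refl)
  from cong_trans[OF cong_sym[OF E_mult] this] have b: "[E (- i) = E (- (i mod half)) * \<eta>] (mod int q)"
    by (simp only: i')
  have "monomial_mat (i, s) = monomial_mat (i mod half, s) \<or>
      monomial_mat (i, s) = smat q (-1) 0 0 (-1) \<otimes>\<^bsub>SL2 q\<^esub> monomial_mat (i mod half, s)"
    using \<eta>(1)
  proof
    assume "\<eta> = 1"
    then have "monomial_mat (i, s) = monomial_mat (i mod half, s)"
      using a b by (simp add: monomial_mat_def smat_eq_iff cong_minus_minus_iff)
    then show ?thesis ..
  next
    assume \<eta>: "\<eta> = -1"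
    have "[- E (- i) = - (E (- (i mod half)) * \<eta>)] (mod int q)"
      using b by (simp only: cong_minus_minus_iff)
    then have "monomial_mat (i, s) = smat q (-1) 0 0 (-1) \<otimes>\<^bsub>SL2 q\<^esub> monomial_mat (i mod half, s)"
      using a b \<eta> by (simp add: monomial_mat_def smat_mult smat_eq_iff)
    then show ?thesis ..
  qed
  then show ?thesis
    using Phi_minus[OF monomial_mat_in_SL2] by metis
qed

lemma E_not_0: "\<not> [E i = 0] (mod int q)"
  using root_unity_not_dvd[OF root_unity_E] p_dvd_q dvd_trans unfolding cong_0_iff by blast

text \<open>Equal images differ by a sign. Comparing zero entries gives equal flags; squaring the
  remaining relation removes the sign, so \<open>p - 1\<close> divides
  \<open>2 * (i - j)\<close>.\<close>

lemma Phi_monomial_mat_eqD: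
  assumes "\<Phi> (monomial_mat (i, s)) = \<Phi> (monomial_mat (j, t))"
  shows "s = t" "half dvd i - j"
proof -
  from Phi_eq_cases[OF assms monomial_mat_in_SL2 monomial_mat_in_SL2]
  obtain \<eta> where \<eta>: "\<eta> = 1 \<or> \<eta> = -1"
    and eq: "monomial_mat (i, s) = smat q \<eta> 0 0 \<eta> \<otimes>\<^bsub>SL2 q\<^esub> monomial_mat (j, t)"
    using monomial_mat_in_SL2 one_SL2[OF q1] by (metis Phi.G.l_one)
  show st: "s = t"
  proof (rule ccontr)
    assume "s \<noteq> t"
    then have "[E i = 0] (mod int q)"
      using eq by (cases s) (auto simp: monomial_mat_def smat_mult smat_eq_iff)
    then show False
      using E_not_0 by simp
  qed
  have ij: "[E i = \<eta> * E j] (mod int q)"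
    using eq st by (cases s) (auto simp: monomial_mat_def smat_mult smat_eq_iff)
  have "[E i * E (- j) = \<eta> * E j * E (- j)] (mod int q)"
    using ij by (intro cong_mult cong_refl)
  also have "[\<eta> * E j * E (- j) = \<eta> * 1] (mod int q)"
    unfolding mult.assoc by (intro cong_mult cong_refl E_inverse)
  finally have "[E (i + - j) = \<eta> * 1] (mod int q)"
    by (rule cong_trans[OF cong_sym[OF E_mult]])
  then have "[E (i - j) = \<eta>] (mod int q)"
    by simp
  then have "[E (i - j) * E (i - j) = \<eta> * \<eta>] (mod int q)"
    by (intro cong_mult)
  from cong_trans[OF cong_sym[OF E_mult] this] have "[E ((i - j) + (i - j)) = 1] (mod int q)"
    using \<eta> by auto
  then have "2 * half dvd 2 * (i - j)"
    unfolding E_1 p_minus_1 mult_2[of "i - j"] .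
  then show "half dvd i - j"
    unfolding dvd_mult_cancel_left by simp
qed

definition monomial_grp :: "(nat \<Rightarrow> nat) set" where
  "monomial_grp = range (\<lambda>x. \<Phi> (monomial_mat x))"

lemma monomial_grp_subset: "monomial_grp \<subseteq> point_stab H 1"
  unfolding monomial_grp_def point_stab_eq using monomial_mat_in_stab_lift by blast

lemma subgroup_monomial_grp: "subgroup monomial_grp G"
proof (rule Phi.H.subgroupI)
  show "monomial_grp \<subseteq> carrier G"
    using monomial_grp_subset subgroup.subset[OF subgroup_point_stab] by blast
  show "monomial_grp \<noteq> {}"
    by (simp add: monomial_grp_def)
  show "x \<otimes>\<^bsub>G\<^esub> y \<in> monomial_grp" if xy: "x \<in> monomial_grp" "y \<in> monomial_grp" for x y
  proof -
    obtain i s j t where "x = \<Phi> (monomial_mat (i, s))" "y = \<Phi> (monomial_mat (j, t))"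
      using xy by (auto simp: monomial_grp_def)
    then show ?thesis
      using Phi_monomial_mat_mult by (auto simp: monomial_grp_def)
  qed
  show "inv\<^bsub>G\<^esub> x \<in> monomial_grp" if x_in: "x \<in> monomial_grp" for x
  proof -
    obtain i s where x: "x = \<Phi> (monomial_mat (i, s))"
      using x_in by (auto simp: monomial_grp_def)
    \<comment> \<open>Reflections are their own inverses; rotations are inverted by negating the
      index.\<close>
    define y where "y = \<Phi> (monomial_mat (if s then i else - i, s))"
    have "y \<otimes>\<^bsub>G\<^esub> x = \<Phi> (monomial_mat (0, False))"
      unfolding x y_def mult_perm_grp Phi_monomial_mat_mult by simp
    also have "\<dots> = \<one>\<^bsub>G\<^esub>"
      unfolding monomial_mat_0 by (rule Phi.hom_one)
    finally have "inv\<^bsub>G\<^esub> x = y"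
      using Phi_in_H monomial_mat_in_SL2 by (intro Phi.H.inv_equality) (simp_all add: x y_def)
    then show ?thesis
      by (simp add: y_def monomial_grp_def)
  qed
qed

lemma monomial_grp_iso: "G\<lparr>carrier := monomial_grp\<rparr> \<cong> dihedral (p - 1)"
proof -
  define D where "D = carrier (dihedral (p - 1))"
  define \<psi> where "\<psi> = (\<lambda>x. \<Phi> (monomial_mat x))"
  have D: "D = {0..<half} \<times> UNIV"
    by (simp add: D_def dihedral_def)
  have half: "half > 0"
    using p7 by simp
  have bij: "bij_betw \<psi> D monomial_grp"
  proof (rule bij_betw_imageI)
    show "inj_on \<psi> D"
    proof (rule inj_onI)
      fix x y assume xy: "x \<in> D" "y \<in> D" "\<psi> x = \<psi> y"
      obtain i s j t where e: "x = (i, s)" "y = (j, t)"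
        by (metis surj_pair)
      have "s = t" "half dvd i - j"
        using Phi_monomial_mat_eqD xy(3) by (simp_all add: e \<psi>_def)
      then have "[i = j] (mod half)"
        by (simp add: cong_iff_dvd_diff)
      then show "x = y"
        using xy(1,2) \<open>s = t\<close> by (simp add: e D cong_def)
    qed
    show "\<psi> ` D = monomial_grp"
    proof
      show "\<psi> ` D \<subseteq> monomial_grp"
        by (auto simp: \<psi>_def monomial_grp_def)
      show "monomial_grp \<subseteq> \<psi> ` D"
      proof
        fix y assume "y \<in> monomial_grp"
        then obtain i s where "y = \<Phi> (monomial_mat (i, s))"
          by (auto simp: monomial_grp_def)
        then have "y = \<psi> (i mod half, s)"
          by (simp only: \<psi>_def Phi_monomial_mat_mod)
        moreover have "(i mod half, s) \<in> D"
          using half by (simp add: D)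
        ultimately show "y \<in> \<psi> ` D"
          by blast
      qed
    qed
  qed
  have mult: "x \<otimes>\<^bsub>dihedral (p - 1)\<^esub> y \<in> D" "\<psi> (x \<otimes>\<^bsub>dihedral (p - 1)\<^esub> y) = \<psi> x \<circ> \<psi> y" for x y
  proof -
    obtain i s j t where e: "x = (i, s)" "y = (j, t)"
      by (metis surj_pair)
    have xy: "x \<otimes>\<^bsub>dihedral (p - 1)\<^esub> y = ((i + (if s then - j else j)) mod half, s \<noteq> t)"
      by (simp add: e dihedral_def)
    show "x \<otimes>\<^bsub>dihedral (p - 1)\<^esub> y \<in> D"
      unfolding xy using half by (simp add: D)
    show "\<psi> (x \<otimes>\<^bsub>dihedral (p - 1)\<^esub> y) = \<psi> x \<circ> \<psi> y"
      unfolding xy unfolding e \<psi>_def Phi_monomial_mat_mod Phi_monomial_mat_mult ..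
  qed
  have "inv_into D \<psi> \<in> iso (G\<lparr>carrier := monomial_grp\<rparr>) (dihedral (p - 1))"
  proof (rule isoI)
    show "inv_into D \<psi> \<in> hom (G\<lparr>carrier := monomial_grp\<rparr>) (dihedral (p - 1))"
    proof (rule homI)
      fix u v assume uv: "u \<in> carrier (G\<lparr>carrier := monomial_grp\<rparr>)" "v \<in> carrier (G\<lparr>carrier := monomial_grp\<rparr>)"
      then have "u \<in> \<psi> ` D" "v \<in> \<psi> ` D"
        using bij by (simp_all add: bij_betw_def)
      then obtain x y where xy: "x \<in> D" "y \<in> D" and uv': "u = \<psi> x" "v = \<psi> y"
        by blast
      have inv: "inv_into D \<psi> (\<psi> z) = z" if "z \<in> D" for z
        using bij that by (simp add: bij_betw_def)
      show "inv_into D \<psi> u \<in> carrier (dihedral (p - 1))"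
        using inv[OF xy(1)] xy(1) by (simp add: uv' D_def)
      show "inv_into D \<psi> (u \<otimes>\<^bsub>G\<lparr>carrier := monomial_grp\<rparr>\<^esub> v) =
          inv_into D \<psi> u \<otimes>\<^bsub>dihedral (p - 1)\<^esub> inv_into D \<psi> v"
        using inv[OF mult(1)[of x y], unfolded mult(2)] inv xy by (simp add: uv')
    qed
    show "bij_betw (inv_into D \<psi>) (carrier (G\<lparr>carrier := monomial_grp\<rparr>)) (carrier (dihedral (p - 1)))"
      using bij_betw_inv_into[OF bij] by (simp add: D_def)
  qed
  then show ?thesis
    by (auto simp: is_iso_def)
qed

text \<open>A matrix of \<open>W\<close> has diagonal 1, so it cannot be antidiagonal up to sign;
  being diagonal, it is the identity.\<close>

lemma Phi_W_Int_monomial_grp: "\<Phi> ` W \<inter> monomial_grp = {id}"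
proof
  have "id \<in> \<Phi> ` W"
    using subgroup.one_closed[OF subgroup_W] Phi.hom_one by (metis image_eqI one_perm_grp)
  moreover have "id \<in> monomial_grp"
    using subgroup.one_closed[OF subgroup_monomial_grp] by simp
  ultimately show "{id} \<subseteq> \<Phi> ` W \<inter> monomial_grp"
    by simp
  show "\<Phi> ` W \<inter> monomial_grp \<subseteq> {id}"
  proof
    fix y assume "y \<in> \<Phi> ` W \<inter> monomial_grp"
    then obtain x i s where x: "x \<in> W" "y = \<Phi> x" "\<Phi> x = \<Phi> (monomial_mat (i, s))"
      by (auto simp: monomial_grp_def)
    obtain b c where e: "x = smat q 1 b c 1"
      using x(1) unfolding stab_lift_congr_sub by blast
    have "x \<in> carrier (SL2 q)"
      using subgroup.subset[OF subgroup_W] x(1) by blast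
    from Phi_eq_cases[OF x(3) this monomial_mat_in_SL2]
    have "x = smat q 1 0 0 1"
    proof (cases s)
      case True
      then show ?thesis
        using \<open>x = _ \<or> x = _\<close> q1 by (auto simp: e monomial_mat_def smat_mult smat_eq_iff cong_def)
    next
      case False
      then show ?thesis
        using \<open>x = _ \<or> x = _\<close> by (auto simp: e monomial_mat_def smat_mult smat_eq_iff)
    qed
    then show "y \<in> {id}"
      using Phi.hom_one by (simp add: x(2) one_SL2[OF q1])
  qed
qed

text \<open>The unit entries of a matrix in \<open>stab_lift\<close> determine a monomial matrix;
  dividing by it on the right leaves an element of \<open>W\<close>.\<close>

lemma Phi_W_mult_monomial_grp: "\<Phi> ` W <#>\<^bsub>G\<^esub> monomial_grp = point_stab H 1"
proof
  have "\<Phi> ` W \<subseteq> point_stab H 1"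
    unfolding Phi_W by (rule Int_lower2)
  then show "\<Phi> ` W <#>\<^bsub>G\<^esub> monomial_grp \<subseteq> point_stab H 1"
    using monomial_grp_subset subgroup.m_closed[OF subgroup_point_stab] by (auto simp: set_mult_def)
  show "point_stab H 1 \<subseteq> \<Phi> ` W <#>\<^bsub>G\<^esub> monomial_grp"
  proof
    fix y assume "y \<in> point_stab H 1"
    then obtain x where y: "y = \<Phi> x" and x: "x \<in> stab_lift"
      unfolding point_stab_eq by blast
    have "\<exists>\<beta> \<gamma> z. P dvd \<beta> \<and> P dvd \<gamma> \<and> x = smat q 1 \<beta> \<gamma> 1 \<otimes>\<^bsub>SL2 q\<^esub> monomial_mat z"
      using x
    proof (cases rule: stab_lift_cases)
      case (diag a b c d)
      obtain i where i: "[a = E i] (mod int q)"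
        using diag(5) E_surj by blast
      have "[E (- i) * (a * d) = E (- i) * 1] (mod int q)"
        using diag(7) by (intro cong_mult cong_refl)
      moreover have "[E (- i) * (a * d) = E (- i) * (E i * d)] (mod int q)"
        using i by (intro cong_mult cong_refl)
      moreover have "[E i * E (- i) * d = 1 * d] (mod int q)"
        by (intro cong_mult cong_refl E_inverse)
      ultimately have d: "[d = E (- i)] (mod int q)"
        by (simp add: cong_def mult_ac)
      have "[b * (E i * E (- i)) = b * 1] (mod int q)" "[c * (E i * E (- i)) = c * 1] (mod int q)"
        by (intro cong_mult cong_refl E_inverse)+
      \<comment> \<open>Right multiplication by diag(E i, E(-i)) scales the columns, so
        \<open>b\<close> and \<open>c\<close> are rescaled inversely.\<close>
      then have "x = smat q 1 (b * E i) (c * E (- i)) 1 \<otimes>\<^bsub>SL2 q\<^esub> monomial_mat (i, False)"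
        using i d by (simp add: diag(1) monomial_mat_def smat_mult smat_eq_iff mult_ac cong_sym_eq)
      moreover have "P dvd b * E i" "P dvd c * E (- i)"
        using diag(3,4) by simp_all
      ultimately show ?thesis
        by blast
    next
      case (anti a b c d)
      obtain i where i: "[b = E i] (mod int q)"
        using anti(5) E_surj by blast
      have "[E (- i) * (b * c) = E (- i) * (- 1)] (mod int q)"
        using anti(7) by (intro cong_mult cong_refl)
      moreover have "[E (- i) * (b * c) = E (- i) * (E i * c)] (mod int q)"
        using i by (intro cong_mult cong_refl)
      moreover have "[E i * E (- i) * c = 1 * c] (mod int q)"
        by (intro cong_mult cong_refl E_inverse)
      ultimately have c: "[c = - E (- i)] (mod int q)"
        by (simp add: cong_def mult_ac)
      have "[a * (E i * E (- i)) = a * 1] (mod int q)" "[d * (E i * E (- i)) = d * 1] (mod int q)"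
        by (intro cong_mult cong_refl E_inverse)+
      \<comment> \<open>The antidiagonal factor swaps the columns, so the off-diagonal entries of
        the \<open>W\<close> part come from \<open>a\<close> and \<open>d\<close>; the minus sign is
        that of \<open>- E (- i)\<close>.\<close>
      then have "x = smat q 1 (- (a * E i)) (d * E (- i)) 1 \<otimes>\<^bsub>SL2 q\<^esub> monomial_mat (i, True)"
        using i c by (simp add: anti(1) monomial_mat_def smat_mult smat_eq_iff mult_ac cong_sym_eq)
      moreover have "P dvd - (a * E i)" "P dvd d * E (- i)"
        using anti(3,4) by simp_all
      ultimately show ?thesis
        by blast
    qed
    then obtain w z where w: "w \<in> W" and xe: "x = w \<otimes>\<^bsub>SL2 q\<^esub> monomial_mat z"
      unfolding stab_lift_congr_sub by blast
    have "w \<in> carrier (SL2 q)"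
      using subgroup.subset[OF subgroup_W] w by blast
    then have "y = \<Phi> w \<otimes>\<^bsub>G\<^esub> \<Phi> (monomial_mat z)"
      unfolding y xe by (rule Phi.hom_mult[OF _ monomial_mat_in_SL2])
    then show "y \<in> \<Phi> ` W <#>\<^bsub>G\<^esub> monomial_grp"
      using w unfolding set_mult_def monomial_grp_def by blast
  qed
qed

lemma point_stab_semidirect:
  "internal_semidirect (G\<lparr>carrier := point_stab H 1\<rparr>) (\<Phi> ` W) monomial_grp"
proof -
  have "subgroup monomial_grp (G\<lparr>carrier := point_stab H 1\<rparr>)"
    using Phi.H.subgroup_incl[OF subgroup_monomial_grp subgroup_point_stab monomial_grp_subset] .
  moreover have "\<Phi> ` W <#>\<^bsub>G\<lparr>carrier := point_stab H 1\<rparr>\<^esub> monomial_grp = \<Phi> ` W <#>\<^bsub>G\<^esub> monomial_grp"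
    by (simp add: set_mult_def)
  ultimately show ?thesis
    unfolding internal_semidirect_def using normal_Phi_W Phi_W_Int_monomial_grp Phi_W_mult_monomial_grp by simp
qed

end

lemma point_stab_structure:
  "\<exists>A B. internal_semidirect (G\<lparr>carrier := point_stab H 1\<rparr>) A B \<and>
     (G\<lparr>carrier := A\<rparr>) \<cong> elem_ab p 2 \<and> (G\<lparr>carrier := B\<rparr>) \<cong> dihedral (p - 1)"
proof -
  obtain E :: "int \<Rightarrow> int" where E: "\<And>i j. [E i * E j = E (i + j)] (mod int q)"
    "\<And>i. [E i = 1] (mod int q) \<longleftrightarrow> int (p - 1) dvd i" "E 0 = 1"
    "\<And>x. root_unity x \<longleftrightarrow> (\<exists>i. [x = E i] (mod int q))"
    unfolding root_unity_def by (rule roots_of_unity_parametrization) blast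
  show ?thesis
    using point_stab_semidirect[OF E] Phi_W_iso monomial_grp_iso[OF E] by blast
qed

end

lemma (in mersenne_power) mersenne_action_exists:
  obtains \<Phi> where "mersenne_action p k m \<Phi> (p ^ (3 * k - 4) * (p + 1) div 2)"
proof -
  interpret group "SL2 q" by (rule group_SL2[OF q1])
  obtain \<Phi> where "\<Phi> \<in> hom (SL2 q) (sym_group (p ^ (3 * k - 4) * (p + 1) div 2))"
    "\<And>i j. i \<in> {1..p ^ (3 * k - 4) * (p + 1) div 2} \<Longrightarrow> j \<in> {1..p ^ (3 * k - 4) * (p + 1) div 2} \<Longrightarrow>
      \<exists>g\<in>carrier (SL2 q). \<Phi> g i = j"
    "\<And>g. g \<in> carrier (SL2 q) \<Longrightarrow> \<Phi> g 1 = 1 \<longleftrightarrow> g \<in> stab_lift"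
    "\<And>g. g \<in> carrier (SL2 q) \<Longrightarrow> derangement (p ^ (3 * k - 4) * (p + 1) div 2) (\<Phi> g) \<longleftrightarrow>
      (\<forall>h\<in>carrier (SL2 q). h \<otimes>\<^bsub>SL2 q\<^esub> g \<otimes>\<^bsub>SL2 q\<^esub> inv\<^bsub>SL2 q\<^esub> h \<notin> stab_lift)"
    "\<And>g. g \<in> carrier (SL2 q) \<Longrightarrow> \<Phi> g = id \<longleftrightarrow>
      (\<forall>h\<in>carrier (SL2 q). h \<otimes>\<^bsub>SL2 q\<^esub> g \<otimes>\<^bsub>SL2 q\<^esub> inv\<^bsub>SL2 q\<^esub> h \<in> stab_lift)"
    by (rule coset_action_exists[OF finite_SL2[OF q1] subgroup_stab_lift card_rcosets_stab_lift]) blast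
  then show ?thesis
    using core_stab_lift
    by (intro that[of \<Phi>] mersenne_action.intro mersenne_power_axioms mersenne_action_axioms.intro) auto
qed

theorem theorem1p3:
  fixes p k :: nat
  assumes "mersenne_prime p" and "p \<ge> 7" and "k \<ge> 2"
  shows "\<exists>H N. let n = p ^ (3*k - 4) * (p + 1) div 2 in let G = perm_grp n H in
      elusive n H \<and>
      N \<lhd> G \<and> (G Mod N) \<cong> PSL2 p \<and>
      \<not> (\<exists>K. subgroup K G \<and> N \<inter> K = {\<one>\<^bsub>G\<^esub>} \<and> N <#>\<^bsub>G\<^esub> K = carrier G) \<and>
      (\<exists>Ns :: nat \<Rightarrow> (nat \<Rightarrow> nat) set.
          Ns 1 = N \<and> Ns k = {\<one>\<^bsub>G\<^esub>} \<and>
          (\<forall>l\<in>{1..k}. Ns l \<lhd> G) \<and>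
          (\<forall>l\<in>{1..<k}. Ns (Suc l) \<subset> Ns l \<and>
               ((G\<lparr>carrier := Ns l\<rparr>) Mod Ns (Suc l)) \<cong> elem_ab p 3)) \<and>
      (\<exists>A B. internal_semidirect (G\<lparr>carrier := point_stab H 1\<rparr>) A B \<and>
          (G\<lparr>carrier := A\<rparr>) \<cong> elem_ab p 2 \<and>
          (G\<lparr>carrier := B\<rparr>) \<cong> dihedral (p - 1))"
proof -
  obtain m where p: "Factorial_Ring.prime p" and m: "p = 2 ^ m - 1"
    using assms(1) by (auto simp: mersenne_prime_def)
  then have "p + 1 = 2 ^ m"
    by simp
  then interpret mersenne_power p k m
    using assms p by unfold_locales
  obtain \<Phi> where "mersenne_action p k m \<Phi> (p ^ (3 * k - 4) * (p + 1) div 2)"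
    by (rule mersenne_action_exists)
  then interpret mersenne_action p k m \<Phi> "p ^ (3 * k - 4) * (p + 1) div 2" .
  have "elusive (p ^ (3 * k - 4) * (p + 1) div 2) H \<and> Ns 1 \<lhd> G \<and> (G Mod Ns 1) \<cong> PSL2 p \<and>
      \<not> (\<exists>K. subgroup K G \<and> Ns 1 \<inter> K = {\<one>\<^bsub>G\<^esub>} \<and> Ns 1 <#>\<^bsub>G\<^esub> K = carrier G) \<and>
      (\<exists>Ns' :: nat \<Rightarrow> (nat \<Rightarrow> nat) set.
          Ns' 1 = Ns 1 \<and> Ns' k = {\<one>\<^bsub>G\<^esub>} \<and>
          (\<forall>l\<in>{1..k}. Ns' l \<lhd> G) \<and>
          (\<forall>l\<in>{1..<k}. Ns' (Suc l) \<subset> Ns' l \<and>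
               ((G\<lparr>carrier := Ns' l\<rparr>) Mod Ns' (Suc l)) \<cong> elem_ab p 3)) \<and>
      (\<exists>A B. internal_semidirect (G\<lparr>carrier := point_stab H 1\<rparr>) A B \<and>
          (G\<lparr>carrier := A\<rparr>) \<cong> elem_ab p 2 \<and>
          (G\<lparr>carrier := B\<rparr>) \<cong> dihedral (p - 1))"
  proof (intro conjI)
    show "elusive (p ^ (3 * k - 4) * (p + 1) div 2) H"
      by (rule elusive_H)
    show "Ns 1 \<lhd> G"
      using normal_Ns assms(3) by simp
    show "G Mod Ns 1 \<cong> PSL2 p"
      by (rule G_Mod_N_iso)
    show "\<not> (\<exists>K. subgroup K G \<and> Ns 1 \<inter> K = {\<one>\<^bsub>G\<^esub>} \<and> Ns 1 <#>\<^bsub>G\<^esub> K = carrier G)"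
      using N_no_complement by blast
    show "\<exists>A B. internal_semidirect (G\<lparr>carrier := point_stab H 1\<rparr>) A B \<and>
          (G\<lparr>carrier := A\<rparr>) \<cong> elem_ab p 2 \<and> (G\<lparr>carrier := B\<rparr>) \<cong> dihedral (p - 1)"
      by (rule point_stab_structure)
  qed (rule exI[of _ Ns], use Ns_k normal_Ns Ns_Suc_psubset Ns_factor_iso in simp)
  then show ?thesis
    unfolding Let_def by blast
qed

end
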